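(* (Odd Littlewood-Richardson rule, hive form.) Let $n\ge1$ and let $\mu,\nu,\lambda$ be partitions with at most $n$ parts. Then the odd Littlewood-Richardson coefficient $c_{\mu\nu}^\lambda$ is $$c_{\mu\nu}^\lambda=(-1)^{N(\mu)+N(\lambda)}\sum_{H\in\mathfrak{H}(\lambda,\mu,\nu)\cap V_{\mathbb{Z}}}(-1)^{Q_{\mathfrak{H}}(H)},$$ where $$Q_{\mathfrak{H}}(H)=\sum_{i=1}^n\sum_{j=i}^n h_{i-1,j-1}\left(h_{i,j}-h_{i-1,j}-h_{i,j-1}+h_{i-1,j-1}\right)-\sum_{i=1}^{n-1}h_{i,i}^2$$ for $H=(h_{i,j})$, with the convention $h_{i,j}=0$ if $i>j$.
   Context: Hives. Fix $n\ge1$. Let $V_{\mathbb{Z}}=\mathbb{Z}^{\binom{n+2}{2}}$ and $V=V_{\mathbb{Z}}\otimes\mathbb{R}$, with coordinates indexed by pairs $(i,j)$, $0\le i\le j\le n$. A hive is an element $H=(h_{i,j})\in V$ with $h_{0,0}=0$ satisfying (R) $h_{i,j}-h_{i,j-1}\ge h_{i-1,j}-h_{i-1,j-1}$ for $1\le i<j\le n$; (V) $h_{i-1,j}-h_{i-1,j-1}\ge h_{i,j+1}-h_{i,j}$ for $1\le i\le j<n$; (L) $h_{i,j}-h_{i-1,j}\ge h_{i+1,j+1}-h_{i,j+1}$ for $1\le i\le j<n$. For partitions $\lambda,\mu,\nu$ with at most $n$ parts (padded by zeros), $\mathfrak{H}(\lambda,\mu,\nu)$ is the set of hives with $\lambda_j=h_{j,j}-h_{j-1,j-1}$,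 $\mu_j=h_{0,j}-h_{0,j-1}$, $\nu_j=h_{j,n}-h_{j-1,n}$ for all $1\le j\le n$. Odd symmetric functions. Let $\mathrm{OPol}_m=\mathbb{Z}\langle x_1,\dots,x_m\rangle/(x_ix_j+x_jx_i : i\ne j)$, graded by polynomial degree, and $\tilde x_i=(-1)^{i-1}x_i$. For a word $w=i_1\cdots i_r$ in $\{1,\dots,m\}$ put $\tilde x^w=\tilde x_{i_1}\cdots\tilde x_{i_r}$. The ring $\mathrm{O}\Lambda_m\subset\mathrm{OPol}_m$ of odd symmetric polynomials is the subring generated by the elements $\sum_{1\le i_1\le\dots\le i_k\le m}\tilde x_{i_1}\cdots\tilde x_{i_k}$, $k\ge1$ (equivalently the intersection of the kernels of the odd divided difference operators). The maps $\mathrm{OPol}_{m+1}\to\mathrm{OPol}_m$, $x_{m+1}\mapsto 0$, $x_i\mapsto x_i$ ($i\le m$), restrict to $\mathrm{O}\Lambda_{m+1}\to\mathrm{O}\Lambda_m$, and $\mathrm{O}\Lambda=\varprojlim\mathrm{O}\Lambda_m$ in the category of graded rings. Partitions are identified with Young diagrams (English convention, row 1 on top). For a diagram $\lambda$: $N(\lambda)$ is the sum over boxes $B$ of the number of boxes in rows strictly above that of $B$ (any column), and $dN(\lambda)$ is the sum over boxes $B$ of the number of boxes in the same column as $B$ and strictly above it. $SSYT(\lambda)$ is the set of semistandard tableaux of shape $\lambda$ (rows non-decreasing left to right, columns strictly increasing top to bottom); the row word $w_r(T)$ is obtained by reading entries left to right in each row, bottom row to top row. The odd Schur function $s_\lambda\in\mathrm{O}\Lambda$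 is the element whose image in $\mathrm{O}\Lambda_m$ is $(-1)^{dN(\lambda)+N(\lambda)}\sum_T\tilde x^{w_r(T)}$, sum over $T\in SSYT(\lambda)$ with entries in $\{1,\dots,m\}$. The $s_\lambda$ form a $\mathbb{Z}$-basis of $\mathrm{O}\Lambda$, and $c_{\mu\nu}^\lambda\in\mathbb{Z}$ is defined by $s_\mu s_\nu=\sum_\lambda c_{\mu\nu}^\lambda s_\lambda$. *)

theory Defs
  imports
    "HOL-Algebra.QuotRing"
    "HOL-Algebra.Generated_Rings"
    "HOL-Library.Poly_Mapping"
begin

section \<open>Partitions and tableaux\<close>

text \<open>A partition is the list of its positive parts; rows, columns and parts are numbered from 1.\<close>

definition is_partition :: "nat list \<Rightarrow> bool" where
  "is_partition lam \<longleftrightarrow> sorted_wrt (\<ge>) lam \<and> 0 \<notin> set lam"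

definition part :: "nat list \<Rightarrow> nat \<Rightarrow> nat" where
  "part lam j = (if 1 \<le> j \<and> j \<le> length lam then lam ! (j - 1) else 0)"

definition diagram :: "nat list \<Rightarrow> (nat \<times> nat) set" where
  "diagram lam = {(r, c). 1 \<le> r \<and> r \<le> length lam \<and> 1 \<le> c \<and> c \<le> part lam r}"

definition N :: "nat list \<Rightarrow> nat" where
  "N lam = (\<Sum>B\<in>diagram lam. card {C \<in> diagram lam. fst C < fst B})"

definition dN :: "nat list \<Rightarrow> nat" where
  "dN lam = (\<Sum>B\<in>diagram lam. card {C \<in> diagram lam. snd C = snd B \<and> fst C < fst B})"

text \<open>A tableau takes the junk value 0 outside its diagram, so that it is determined by its
  entries.\<close>

definition ssyt :: "nat \<Rightarrow> nat list \<Rightarrow> (nat \<Rightarrow> nat \<Rightarrow> nat) set" where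
  "ssyt m lam = {T.
     (\<forall>r c. (r, c) \<in> diagram lam \<longrightarrow> 1 \<le> T r c \<and> T r c \<le> m) \<and>
     (\<forall>r c. (r, c) \<notin> diagram lam \<longrightarrow> T r c = 0) \<and>
     (\<forall>r c c'. (r, c) \<in> diagram lam \<and> (r, c') \<in> diagram lam \<and> c < c' \<longrightarrow> T r c \<le> T r c') \<and>
     (\<forall>r r' c. (r, c) \<in> diagram lam \<and> (r', c) \<in> diagram lam \<and> r < r' \<longrightarrow> T r c < T r' c)}"

definition row_word :: "nat list \<Rightarrow> (nat \<Rightarrow> nat \<Rightarrow> nat) \<Rightarrow> nat list" where
  "row_word lam T =
     concat (map (\<lambda>r. map (T r) [1..<Suc (part lam r)]) (rev [1..<Suc (length lam)]))"

section \<open>Odd polynomials\<close>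

text \<open>The free associative ring on \<open>x\<^sub>1, \<dots>, x\<^sub>m\<close>: finitely supported integer combinations of words in
  \<open>{1..m}\<close>, the product being the bilinear extension of concatenation.\<close>

definition free_ring :: "nat \<Rightarrow> (nat list \<Rightarrow>\<^sub>0 int) ring" where
  "free_ring m =
     \<lparr>carrier = {p. Poly_Mapping.keys p \<subseteq> lists {1..m}},
      mult = (\<lambda>p q. frag_extend (\<lambda>u. frag_extend (\<lambda>v. frag_of (u @ v)) q) p),
      one = frag_of [],
      zero = 0,
      add = (+)\<rparr>"

definition odd_ideal :: "nat \<Rightarrow> (nat list \<Rightarrow>\<^sub>0 int) set" where
  "odd_ideal m = genideal (free_ring m)
     {frag_of [i, j] + frag_of [j, i] | i j. i \<in> {1..m} \<and> j \<in> {1..m} \<and> i \<noteq> j}"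

type_synonym opol = "(nat list \<Rightarrow>\<^sub>0 int) set"

definition OPol :: "nat \<Rightarrow> opol ring" where
  "OPol m = free_ring m Quot odd_ideal m"

definition opol_class :: "nat \<Rightarrow> (nat list \<Rightarrow>\<^sub>0 int) \<Rightarrow> opol" where
  "opol_class m p = odd_ideal m +>\<^bsub>free_ring m\<^esub> p"

definition opol_homog :: "nat \<Rightarrow> nat \<Rightarrow> opol set" where
  "opol_homog m k =
     opol_class m ` {p \<in> carrier (free_ring m). \<forall>w \<in> Poly_Mapping.keys p. length w = k}"

text \<open>The map \<open>OPol (Suc m) \<rightarrow> OPol m\<close> killing \<open>x\<^sub>m\<^sub>+\<^sub>1\<close>. All representatives of a coset yield the same
  class, so the union is that class.\<close>

definition free_restr :: "nat \<Rightarrow> (nat list \<Rightarrow>\<^sub>0 int) \<Rightarrow> (nat list \<Rightarrow>\<^sub>0 int)" where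
  "free_restr m = frag_extend (\<lambda>w. if set w \<subseteq> {1..m} then frag_of w else 0)"

definition opol_restr :: "nat \<Rightarrow> opol \<Rightarrow> opol" where
  "opol_restr m C = (\<Union>p\<in>C. opol_class m (free_restr m p))"

definition xt :: "nat \<Rightarrow> nat \<Rightarrow> opol" where
  "xt m i = opol_class m (Poly_Mapping.single [i] ((-1) ^ (i - 1)))"

definition xt_word :: "nat \<Rightarrow> nat list \<Rightarrow> opol" where
  "xt_word m w = foldr (\<lambda>i a. xt m i \<otimes>\<^bsub>OPol m\<^esub> a) w \<one>\<^bsub>OPol m\<^esub>"

section \<open>Odd symmetric functions\<close>

definition odd_complete :: "nat \<Rightarrow> nat \<Rightarrow> opol" where
  "odd_complete m k =
     (\<Oplus>\<^bsub>OPol m\<^esub> w \<in> {w. length w = k \<and> set w \<subseteq> {1..m} \<and> sorted w}. xt_word m w)"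

definition OLam_fin :: "nat \<Rightarrow> opol set" where
  "OLam_fin m = generate_ring (OPol m) {odd_complete m k | k. k \<ge> 1}"

text \<open>The limit is taken in graded rings: it is the direct sum over \<open>k\<close> of the limits of the
  degree \<open>k\<close> parts, so its elements are finite sums of homogeneous compatible families.\<close>

definition olam_homog :: "nat \<Rightarrow> (nat \<Rightarrow> opol) set" where
  "olam_homog k =
     {f. \<forall>m. f m \<in> OLam_fin m \<inter> opol_homog m k \<and> opol_restr m (f (Suc m)) = f m}"

definition OLam :: "(nat \<Rightarrow> opol) ring" where
  "OLam =
     \<lparr>carrier = {f. \<exists>d g. (\<forall>k\<le>d. g k \<in> olam_homog k) \<and>
                         (\<forall>m. f m = (\<Oplus>\<^bsub>OPol m\<^esub> k \<in> {..d}. g k m))},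
      mult = (\<lambda>f g m. f m \<otimes>\<^bsub>OPol m\<^esub> g m),
      one = (\<lambda>m. \<one>\<^bsub>OPol m\<^esub>),
      zero = (\<lambda>m. \<zero>\<^bsub>OPol m\<^esub>),
      add = (\<lambda>f g m. f m \<oplus>\<^bsub>OPol m\<^esub> g m)\<rparr>"

definition odd_schur :: "nat list \<Rightarrow> (nat \<Rightarrow> opol)" where
  "odd_schur lam = (\<lambda>m. add_pow (OPol m) ((-1 :: int) ^ (dN lam + N lam))
     (\<Oplus>\<^bsub>OPol m\<^esub> T \<in> ssyt m lam. xt_word m (row_word lam T)))"

text \<open>\<open>odd_LR mu nu lam\<close> is \<open>c\<^sub>\<mu>\<^sub>\<nu>\<^sup>\<lambda>\<close>, the coefficient of \<open>s\<^sub>\<lambda>\<close> in the expansion of \<open>s\<^sub>\<mu> s\<^sub>\<nu>\<close> in the basis of odd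
  Schur functions.\<close>

definition odd_LR :: "nat list \<Rightarrow> nat list \<Rightarrow> nat list \<Rightarrow> int" where
  "odd_LR mu nu = (THE c.
     finite {al. c al \<noteq> 0} \<and>
     (\<forall>al. c al \<noteq> 0 \<longrightarrow> is_partition al) \<and>
     odd_schur mu \<otimes>\<^bsub>OLam\<^esub> odd_schur nu =
       (\<Oplus>\<^bsub>OLam\<^esub> al \<in> {al. c al \<noteq> 0}. add_pow OLam (c al) (odd_schur al)))"

section \<open>Hives\<close>

text \<open>Points of \<open>V\<close> are extended by 0 outside \<open>0 \<le> i \<le> j \<le> n\<close>; this is also the convention used in
  \<open>Q_hive\<close>.\<close>

definition hive_space :: "nat \<Rightarrow> (nat \<Rightarrow> nat \<Rightarrow> real) set" where
  "hive_space n = {h. \<forall>i j. \<not> (i \<le> j \<and> j \<le> n) \<longrightarrow> h i j = 0}"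

definition hive :: "nat \<Rightarrow> (nat \<Rightarrow> nat \<Rightarrow> real) \<Rightarrow> bool" where
  "hive n h \<longleftrightarrow>
     h \<in> hive_space n \<and> h 0 0 = 0 \<and>
     (\<forall>i j. 1 \<le> i \<and> i < j \<and> j \<le> n \<longrightarrow>
        h i j - h i (j - 1) \<ge> h (i - 1) j - h (i - 1) (j - 1)) \<and>
     (\<forall>i j. 1 \<le> i \<and> i \<le> j \<and> j < n \<longrightarrow>
        h (i - 1) j - h (i - 1) (j - 1) \<ge> h i (j + 1) - h i j) \<and>
     (\<forall>i j. 1 \<le> i \<and> i \<le> j \<and> j < n \<longrightarrow>
        h i j - h (i - 1) j \<ge> h (i + 1) (j + 1) - h i (j + 1))"

definition hives ::
    "nat \<Rightarrow> nat list \<Rightarrow> nat list \<Rightarrow> nat list \<Rightarrow> (nat \<Rightarrow> nat \<Rightarrow> real) set" where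
  "hives n lam mu nu = {h. hive n h \<and>
     (\<forall>j\<in>{1..n}. real (part lam j) = h j j - h (j - 1) (j - 1) \<and>
                 real (part mu j) = h 0 j - h 0 (j - 1) \<and>
                 real (part nu j) = h j n - h (j - 1) n)}"

definition integer_hives ::
    "nat \<Rightarrow> nat list \<Rightarrow> nat list \<Rightarrow> nat list \<Rightarrow> (nat \<Rightarrow> nat \<Rightarrow> int) set" where
  "integer_hives n lam mu nu = {H. (\<lambda>i j. real_of_int (H i j)) \<in> hives n lam mu nu}"

definition Q_hive :: "nat \<Rightarrow> (nat \<Rightarrow> nat \<Rightarrow> int) \<Rightarrow> int" where
  "Q_hive n h =
     (\<Sum>i=1..n. \<Sum>j=i..n.
        h (i - 1) (j - 1) * (h i j - h (i - 1) j - h i (j - 1) + h (i - 1) (j - 1)))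
     - (\<Sum>i=1..n-1. (h i i)\<^sup>2)"

text \<open>\<open>(-1)\<^sup>k\<close> for an integer exponent of either sign.\<close>

definition neg_one_pow :: "int \<Rightarrow> int" where
  "neg_one_pow k = (-1) ^ nat \<bar>k\<bar>"

end

theory Submission
  imports Defs "HOL-Library.Multiset"
begin

text \<open>Sorting a word in anticommuting variables multiplies it by \<open>-1\<close> to the number of its inversions.
Every identity below is therefore an identity of ordinary symmetric functions, proved by a bijection,
together with the verification that the bijection respects signs. Partitions are read as weakly
decreasing sequences of integers (shapes), and tableaux as chains of shapes.

\<^bold>\<open>Pieri rules.\<close> Let \<open>s\<^sub>l\<close> be the unnormalised sum over tableaux and \<open>h\<^sub>k\<close> the complete polynomial. Then
\<open>s\<^sub>l h\<^sub>k\<close> is a sum of \<open>s\<^sub>m\<close> over all horizontal strips \<open>m/l\<close> of size \<open>k\<close>, with signs given by \<open>p_exp\<close>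
(lemma \<open>pieri_right\<close>). This is an induction on the number of variables whose step is the local growth
rule of the Robinson-Schensted-Knuth correspondence. The rule for \<open>h\<^sub>k s\<^sub>l\<close>, with different signs \<open>q_exp\<close>
(lemma \<open>pieri_left\<close>), is deduced from it as follows. Toggling the middle shape of two consecutive
strips exchanges their sizes, and it exchanges the two kinds of signs (lemma \<open>toggle_sign\<close>). So the
operator that adds a strip with signs \<open>q_exp\<close> commutes with all right multiplications by some \<open>h\<^sub>j\<close>.
Since the \<open>h\<^sub>j\<close> generate everything from \<open>1\<close> (theorem \<open>pieri_induct\<close>), such an operator is the left
multiplication by its value at \<open>1\<close>.

\<^bold>\<open>Littlewood-Richardson rule.\<close> The same argument gives the product with \<open>s\<^sub>\<nu>\<close>. A Littlewood-Richardson chain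
leads from \<open>\<mu>\<close> to \<open>\<lambda>\<close> by strips of sizes \<open>\<nu>\<^sub>1, \<nu>\<^sub>2, \<dots>\<close> and satisfies the lattice condition \<open>lr_cond\<close>. Toggling
moves a further strip from the end of a chain to its beginning; this keeps the lattice condition in
both directions (lemmas \<open>lr_cond_toggle_down\<close> and \<open>lr_cond_toggle_up\<close>) and changes the signs from those
of the left Pieri rule at one end to those at the other. Hence the operator sending \<open>s\<^sub>\<mu>\<close> to the signed
sum over the chains from \<open>\<mu>\<close> commutes with all left multiplications by some \<open>h\<^sub>k\<close>. From the empty shape
there is only one chain, so the value at \<open>1\<close> is \<open>s\<^sub>\<nu>\<close> up to a known sign, and the operator is the right
multiplication by \<open>s\<^sub>\<nu>\<close> (theorem \<open>schur_poly_mult\<close>).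

\<^bold>\<open>Hives.\<close> Row \<open>i\<close> of a hive consists of the partial sums of the \<open>i\<close>-th shape of such a chain: the
inequalities (R) and (V) say that consecutive shapes differ by a horizontal strip, and (L) is the
lattice condition. Along a chain the exponent \<open>Q\<close> is the sum of the exponents \<open>b_exp\<close> of its steps.

\<^bold>\<open>Odd symmetric functions.\<close> The quotient ring of odd polynomials is embedded into a concrete ring in which
coefficients of monomials can be read off. There the odd Schur polynomials are linearly independent,
by induction on the number of variables through the highest power of the last variable, so that the
coefficients of the expansion of a product are determined. By the Pieri rule they are polynomials in
the \<open>h\<^sub>k\<close>, hence elements of the ring of odd symmetric functions.\<close>

section \<open>Signs, shapes and horizontal strips\<close>

text \<open>Multiplication by \<open>(-1)\<^sup>k\<close>, as an operation on groups rather than a ring element: signs then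
move to the front of every product by rewriting.\<close>

definition signed :: "int \<Rightarrow> 'a::ab_group_add \<Rightarrow> 'a" where
  "signed k x = (if even k then x else - x)"

lemma signed_0 [simp]: "signed 0 x = x" "signed k 0 = 0"
  by (simp_all add: signed_def)

lemma signed_signed [simp]: "signed a (signed b x) = signed (a + b) x"
  by (auto simp: signed_def)

lemma signed_double [simp]: "signed (a + a) x = x" "signed (a + (a + b)) x = signed b x" "signed (2 * a) x = x"
  by (auto simp: signed_def)

lemma signed_cong: "even (a + b) \<Longrightarrow> signed a x = signed b x"
  by (auto simp: signed_def)

lemma signed_mult [simp]:
  fixes x y :: "'a::ring_1"
  shows "signed k x * y = signed k (x * y)" "x * signed k y = signed k (x * y)"
  by (simp_all add: signed_def)

lemma signed_sum: "signed k (sum f A) = (\<Sum>a\<in>A. signed k (f a))"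
  by (simp add: signed_def sum_negf)

lemma signed_diff: "signed k (x - y) = signed k x - signed k y"
  by (simp add: signed_def)

definition psum :: "(nat \<Rightarrow> int) \<Rightarrow> nat \<Rightarrow> int" where
  "psum f n = (\<Sum>i<n. f i)"

lemma psum_0 [simp]: "psum f 0 = 0"
  and psum_Suc [simp]: "psum f (Suc n) = psum f n + f n"
  by (simp_all add: psum_def)

text \<open>The sum over the support, so that no bound on the number of rows has to be carried along.\<close>

definition total :: "(nat \<Rightarrow> int) \<Rightarrow> int" where
  "total f = (\<Sum>i | f i \<noteq> 0. f i)"

definition bounded_by :: "nat \<Rightarrow> (nat \<Rightarrow> int) \<Rightarrow> bool" where
  "bounded_by n f \<longleftrightarrow> (\<forall>i\<ge>n. f i = 0)"

lemma bounded_by_mono: "bounded_by n f \<Longrightarrow> n \<le> m \<Longrightarrow> bounded_by m f"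
  by (auto simp: bounded_by_def)

lemma total_eq: "bounded_by n f \<Longrightarrow> total f = psum f n"
  unfolding total_def psum_def bounded_by_def
  by (rule sum.mono_neutral_left) (auto simp: not_less[symmetric])

definition shapes :: "(nat \<Rightarrow> int) set" where
  "shapes = {l. (\<forall>i. l (Suc i) \<le> l i) \<and> (\<exists>n. bounded_by n l)}"

lemma shapes_bounded: "l \<in> shapes \<Longrightarrow> \<exists>n. bounded_by n l"
  by (auto simp: shapes_def)

lemma shapes_antimono: "l \<in> shapes \<Longrightarrow> i \<le> j \<Longrightarrow> l j \<le> l i"
  by (rule lift_Suc_antimono_le[of l]) (auto simp: shapes_def)

lemma shapes_nonneg: "l \<in> shapes \<Longrightarrow> 0 \<le> l i"
proof -
  assume l: "l \<in> shapes"
  then obtain n where "bounded_by n l" using shapes_bounded by blast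
  then have "l (max n i) = 0" by (simp add: bounded_by_def)
  with shapes_antimono[OF l, of i "max n i"] show ?thesis by simp
qed

definition hstrip :: "(nat \<Rightarrow> int) \<Rightarrow> (nat \<Rightarrow> int) \<Rightarrow> bool" where
  "hstrip l k \<longleftrightarrow> (\<forall>i. l i \<le> k i \<and> k (Suc i) \<le> l i)"

lemma hstrip_bounded_up:
  assumes "hstrip l k" "bounded_by n l" shows "bounded_by (Suc n) k"
  unfolding bounded_by_def
proof safe
  fix i assume "Suc n \<le> i"
  then obtain i' where i: "i = Suc i'" "n \<le> i'" by (cases i) auto
  have "l i' = 0" "l i = 0" using assms(2) i by (auto simp: bounded_by_def)
  moreover have "l i \<le> k i" "k (Suc i') \<le> l i'" using assms(1) by (auto simp: hstrip_def)
  ultimately show "k i = 0" using i by simp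
qed

lemma hstrip_bounded_down:
  assumes "hstrip l k" "k \<in> shapes" "bounded_by n k" shows "bounded_by n l"
  unfolding bounded_by_def
proof safe
  fix i assume "n \<le> i"
  then have "k i = 0" "k (Suc i) = 0" using assms(3) by (auto simp: bounded_by_def)
  moreover have "l i \<le> k i" "k (Suc i) \<le> l i" using assms(1) by (auto simp: hstrip_def)
  ultimately show "l i = 0" by simp
qed

lemma hstrip_shapes_up: assumes "hstrip l k" "l \<in> shapes" shows "k \<in> shapes"
proof -
  have "k (Suc i) \<le> k i" for i
  proof -
    have "k (Suc i) \<le> l i" "l i \<le> k i" using assms(1) by (simp_all add: hstrip_def)
    then show ?thesis by simp
  qed
  then show ?thesis using hstrip_bounded_up[OF assms(1)] assms(2) by (auto simp: shapes_def)
qed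

lemma hstrip_shapes_down: assumes "hstrip l k" "k \<in> shapes" shows "l \<in> shapes"
proof -
  have "l (Suc i) \<le> l i" for i
  proof -
    have "k (Suc i) \<le> l i" "l (Suc i) \<le> k (Suc i)" using assms(1) by (simp_all add: hstrip_def)
    then show ?thesis by simp
  qed
  then show ?thesis using hstrip_bounded_down[OF assms] assms(2) by (auto simp: shapes_def)
qed

lemma total_nonneg: "l \<in> shapes \<Longrightarrow> 0 \<le> total l"
  unfolding total_def by (rule sum_nonneg) (simp add: shapes_nonneg)

lemma total_mono:
  assumes "l \<in> shapes" "hstrip l k" shows "total l \<le> total k"
proof -
  obtain n where n: "bounded_by n l" using assms shapes_bounded by blast
  have "total l = psum l (Suc n)" by (rule total_eq) (rule bounded_by_mono[OF n], simp)
  also have "\<dots> \<le> psum k (Suc n)"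
    unfolding psum_def by (rule sum_mono) (use assms in \<open>auto simp: hstrip_def\<close>)
  also have "\<dots> = total k" by (rule total_eq[symmetric]) (rule hstrip_bounded_up[OF assms(2) n])
  finally show ?thesis .
qed

lemma shape_le_total: "l \<in> shapes \<Longrightarrow> l i \<le> total l"
proof (cases "l i = 0")
  case True
  then show "l \<in> shapes \<Longrightarrow> l i \<le> total l" by (simp add: total_nonneg)
next
  case False
  assume l: "l \<in> shapes"
  then obtain n where n: "bounded_by n l" using shapes_bounded by blast
  have "{i. l i \<noteq> 0} \<subseteq> {..<n}" using n by (auto simp: bounded_by_def not_le[symmetric])
  then have "finite {i. l i \<noteq> 0}" by (rule finite_subset) simp
  then show "l i \<le> total l" unfolding total_def
    by (intro member_le_sum) (use False l in \<open>auto simp: shapes_nonneg\<close>)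
qed

definition up :: "nat \<Rightarrow> (nat \<Rightarrow> int) \<Rightarrow> (nat \<Rightarrow> int) set" where
  "up k l = {kap. hstrip l kap \<and> total kap = total l + int k}"

definition dn :: "(nat \<Rightarrow> int) \<Rightarrow> (nat \<Rightarrow> int) set" where
  "dn l = {eta. hstrip eta l}"

lemma finite_bounded_seqs: "finite {f :: nat \<Rightarrow> int. (\<forall>i. 0 \<le> f i \<and> f i \<le> b) \<and> bounded_by n f}"
proof -
  have "finite {f. \<forall>i. (i \<in> {..<n} \<longrightarrow> f i \<in> {0..b}) \<and> (i \<notin> {..<n} \<longrightarrow> f i = (0::int))}"
    by (rule finite_set_of_finite_funs) auto
  then show ?thesis
    by (rule rev_finite_subset) (auto simp: bounded_by_def)
qed

lemma finite_dn: assumes "l \<in> shapes" shows "finite (dn l)"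
proof -
  obtain n where n: "bounded_by n l" using assms shapes_bounded by blast
  show ?thesis
  proof (rule finite_subset[OF _ finite_bounded_seqs[of "l 0" n]], safe)
    fix e assume "e \<in> dn l"
    then have e: "hstrip e l" by (simp add: dn_def)
    show "bounded_by n e" by (rule hstrip_bounded_down[OF e assms n])
    fix i
    show "0 \<le> e i" using hstrip_shapes_down[OF e assms] by (rule shapes_nonneg)
    have "e i \<le> l i" using e by (simp add: hstrip_def)
    also have "\<dots> \<le> l 0" using assms by (rule shapes_antimono) simp
    finally show "e i \<le> l 0" .
  qed
qed

lemma up_shapes: "kap \<in> up k l \<Longrightarrow> l \<in> shapes \<Longrightarrow> kap \<in> shapes"
  by (auto simp: up_def intro: hstrip_shapes_up)

lemma dn_shapes: "eta \<in> dn l \<Longrightarrow> l \<in> shapes \<Longrightarrow> eta \<in> shapes"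
  by (auto simp: dn_def intro: hstrip_shapes_down)

lemma finite_up: assumes "l \<in> shapes" shows "finite (up k l)"
proof -
  obtain n where n: "bounded_by n l" using assms shapes_bounded by blast
  show ?thesis
  proof (rule finite_subset[OF _ finite_bounded_seqs[of "total l + int k" "Suc n"]], safe)
    fix e assume u: "e \<in> up k l"
    then have e: "hstrip l e" and t: "total e = total l + int k" by (auto simp: up_def)
    show "bounded_by (Suc n) e" by (rule hstrip_bounded_up[OF e n])
    fix i
    have es: "e \<in> shapes" using up_shapes[OF u assms] .
    show "0 \<le> e i" using es by (rule shapes_nonneg)
    show "e i \<le> total l + int k" using shape_le_total[OF es, of i] t by simp
  qed
qed

text \<open>The three sign exponents. Removing the entries \<open>m\<close> of a tableau of shape \<open>k\<close> leaves a tableau of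
shape \<open>l\<close>; an entry \<open>m\<close> in row \<open>r\<close> precedes the smaller entries of all higher rows in the reading word,
so \<open>b_exp l k\<close> counts the inversions that involve \<open>m\<close>. The exponents \<open>p_exp\<close> and \<open>q_exp\<close> belong to the
right and to the left Pieri rule. Up to the linear statistic in which each box counts its row number,
\<open>p_exp\<close> is \<open>b_exp\<close>; and \<open>q_exp\<close> is \<open>b_exp\<close> up to the change of the second elementary symmetric function of
the rows.\<close>

definition b_exp :: "(nat \<Rightarrow> int) \<Rightarrow> (nat \<Rightarrow> int) \<Rightarrow> int" where
  "b_exp l k = total (\<lambda>r. psum l r * (k r - l r))"

definition p_exp :: "(nat \<Rightarrow> int) \<Rightarrow> (nat \<Rightarrow> int) \<Rightarrow> int" where
  "p_exp l k = total (\<lambda>r. (psum l r + int r) * (k r - l r))"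

definition q_exp :: "(nat \<Rightarrow> int) \<Rightarrow> (nat \<Rightarrow> int) \<Rightarrow> int" where
  "q_exp l k = total (\<lambda>r. (psum k r - psum l r) * k r)"


section \<open>Toggling two consecutive strips\<close>

text \<open>The toggled middle row is \<open>min (l (i - 1)) (ta i) + max (l i) (ta (i + 1)) - k i\<close>, where the
minimum is \<open>ta 0\<close> in the top row: the reflection in the interval of values that the middle shape may take
between \<open>l\<close> and \<open>ta\<close>. Written with \<open>excess\<close>, the partial sums of the toggled shape telescope.\<close>

definition excess :: "(nat \<Rightarrow> int) \<Rightarrow> (nat \<Rightarrow> int) \<Rightarrow> nat \<Rightarrow> int" where
  "excess l ta i = (case i of 0 \<Rightarrow> 0 | Suc i' \<Rightarrow> max 0 (ta i - l i'))"

definition toggle :: "(nat \<Rightarrow> int) \<Rightarrow> (nat \<Rightarrow> int) \<Rightarrow> (nat \<Rightarrow> int) \<Rightarrow> nat \<Rightarrow> int" where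
  "toggle l ta k i = l i + ta i - k i + excess l ta (Suc i) - excess l ta i"

lemma toggle_toggle [simp]: "toggle l ta (toggle l ta k) = k"
  by (rule ext) (simp add: toggle_def)

lemma psum_toggle: "psum (toggle l ta k) n = psum l n + psum ta n - psum k n + excess l ta n"
  by (induction n) (simp_all add: toggle_def excess_def[of l ta 0])

lemma toggle_hstrip:
  assumes "hstrip l k" "hstrip k ta"
  shows "hstrip l (toggle l ta k)" "hstrip (toggle l ta k) ta"
proof -
  have 1: "l i \<le> k i" "k (Suc i) \<le> l i" "k i \<le> ta i" "ta (Suc i) \<le> k i" for i
    using assms by (simp_all add: hstrip_def)
  have e: "excess l ta (Suc i) = max 0 (ta (Suc i) - l i)" "excess l ta 0 = 0" "excess l ta i \<ge> 0" for i
    by (auto simp: excess_def split: nat.split)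
  have 3: "toggle l ta k i \<le> ta i - excess l ta i" for i
    using 1[of i] unfolding toggle_def e(1) by linarith
  have 2: "toggle l ta k i \<ge> l i + excess l ta (Suc i)" for i
  proof (cases i)
    case 0
    then show ?thesis using 1[of i] unfolding toggle_def by (simp add: e)
  next
    case (Suc i')
    show ?thesis using 1[of i] 1[of i'] unfolding toggle_def Suc e(1)[of i'] by linarith
  qed
  show "hstrip l (toggle l ta k)"
    unfolding hstrip_def
  proof (intro allI conjI)
    fix i
    show "l i \<le> toggle l ta k i" using 2[of i] e(3)[of "Suc i"] by linarith
    show "toggle l ta k (Suc i) \<le> l i" using 3[of "Suc i"] unfolding e(1)[of i] by linarith
  qed
  show "hstrip (toggle l ta k) ta"
    unfolding hstrip_def
  proof (intro allI conjI)
    fix i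
    show "toggle l ta k i \<le> ta i" using 3[of i] e(3)[of i] by linarith
    show "ta (Suc i) \<le> toggle l ta k i" using 2[of i] unfolding e(1)[of i] by linarith
  qed
qed

lemma bounded_excess:
  assumes "bounded_by n ta" "l \<in> shapes" shows "bounded_by n (excess l ta)"
  unfolding bounded_by_def excess_def
  using assms(1) shapes_nonneg[OF assms(2)] by (auto simp: bounded_by_def split: nat.split)

lemma toggle_total:
  assumes "l \<in> shapes" "hstrip l k" "hstrip k ta"
  shows "total (toggle l ta k) = total l + total ta - total k"
proof -
  have ks: "k \<in> shapes" and ts: "ta \<in> shapes" using assms hstrip_shapes_up by blast+
  obtain n where n: "bounded_by n ta" using ts shapes_bounded by blast
  have nk: "bounded_by n k" by (rule hstrip_bounded_down[OF assms(3) ts n])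
  have nl: "bounded_by n l" by (rule hstrip_bounded_down[OF assms(2) ks nk])
  have nt: "bounded_by n (toggle l ta k)"
    by (rule hstrip_bounded_down[OF toggle_hstrip(2)[OF assms(2,3)] ts n])
  show ?thesis
    using bounded_excess[OF n assms(1)]
    by (simp add: total_eq[OF n] total_eq[OF nk] total_eq[OF nl] total_eq[OF nt] psum_toggle bounded_by_def)
qed

text \<open>The partial sums of the exponents agree modulo 2 up to a boundary term that vanishes below the last
row. The step uses that \<open>t (t + a + b)\<close> is even for \<open>t = 0\<close> and for \<open>t = a - b\<close>.\<close>

lemma toggle_sign_aux:
  fixes l ta k :: "nat \<Rightarrow> int"
  defines "k' \<equiv> toggle l ta k"
  shows "even (psum (\<lambda>r. (psum l r + int r) * (k r - l r)) n
    + psum (\<lambda>r. (psum ta r - psum k r) * ta r) n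
    + psum (\<lambda>r. (psum k' r - psum l r) * k' r) n
    + psum (\<lambda>r. (psum k' r + int r) * (ta r - k' r)) n
    + (psum l n + int n + ta n) * excess l ta n)"
proof (induction n)
  case 0
  show ?case by (simp add: excess_def)
next
  case (Suc n)
  define t where "t = excess l ta n"
  define t' where "t' = excess l ta (Suc n)"
  have t': "t' = 0 \<or> t' = ta (Suc n) - l n" by (auto simp: t'_def excess_def max_def)
  have k': "k' n = l n + ta n - k n + t' - t" by (simp add: k'_def toggle_def t_def t'_def)
  have pk': "psum k' n = psum l n + psum ta n - psum k n + t"
    by (simp add: k'_def psum_toggle t_def)
  show ?case
    using Suc.IH t' unfolding t_def[symmetric] t'_def[symmetric] psum_Suc k' pk'
    by (elim disjE) (simp_all, argo+)
qed

lemma toggle_sign: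
  assumes "l \<in> shapes" "hstrip l k" "hstrip k ta"
  defines "k' \<equiv> toggle l ta k"
  shows "even (p_exp l k + q_exp k ta + (q_exp l k' + p_exp k' ta))"
proof -
  have ks: "k \<in> shapes" and ts: "ta \<in> shapes" using assms hstrip_shapes_up by blast+
  obtain n where n: "bounded_by n ta" using ts shapes_bounded by blast
  have nk: "bounded_by n k" by (rule hstrip_bounded_down[OF assms(3) ts n])
  have nl: "bounded_by n l" by (rule hstrip_bounded_down[OF assms(2) ks nk])
  have nt: "bounded_by n k'" unfolding k'_def
    by (rule hstrip_bounded_down[OF toggle_hstrip(2)[OF assms(2,3)] ts n])
  note z = n[unfolded bounded_by_def] nk[unfolded bounded_by_def] nl[unfolded bounded_by_def] nt[unfolded bounded_by_def]
  have p1: "p_exp l k = psum (\<lambda>r. (psum l r + int r) * (k r - l r)) n"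
    unfolding p_exp_def by (rule total_eq) (simp add: z bounded_by_def)
  have q1: "q_exp k ta = psum (\<lambda>r. (psum ta r - psum k r) * ta r) n"
    unfolding q_exp_def by (rule total_eq) (simp add: z bounded_by_def)
  have q2: "q_exp l k' = psum (\<lambda>r. (psum k' r - psum l r) * k' r) n"
    unfolding q_exp_def by (rule total_eq) (simp add: z bounded_by_def)
  have p2: "p_exp k' ta = psum (\<lambda>r. (psum k' r + int r) * (ta r - k' r)) n"
    unfolding p_exp_def by (rule total_eq) (simp add: z bounded_by_def)
  have "excess l ta n = 0"
    using bounded_excess[OF n assms(1)] by (simp add: bounded_by_def)
  then show "even (p_exp l k + q_exp k ta + (q_exp l k' + p_exp k' ta))"
    using toggle_sign_aux[of l k n ta, folded k'_def] unfolding p1 q1 q2 p2 by (simp add: add.assoc)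
qed

section \<open>The local growth rule\<close>

text \<open>The local growth rule of the Robinson-Schensted-Knuth correspondence. Between two shapes \<open>l\<close> and \<open>k\<close>,
a common predecessor \<open>eta\<close> together with a number \<open>j\<close> determines a common successor: what row \<open>i\<close> of \<open>eta\<close>
lacks to its maximal value \<open>min (l i) (k i)\<close> is what row \<open>i + 1\<close> of the successor exceeds its minimal value
by, and \<open>j\<close> is the excess in the top row. As for toggling, \<open>slack\<close> makes partial sums telescope.\<close>

definition slack :: "(nat \<Rightarrow> int) \<Rightarrow> (nat \<Rightarrow> int) \<Rightarrow> (nat \<Rightarrow> int) \<Rightarrow> int \<Rightarrow> nat \<Rightarrow> int" where
  "slack l k eta j i = (case i of 0 \<Rightarrow> j | Suc i' \<Rightarrow> min (l i') (k i') - eta i')"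

definition grow :: "(nat \<Rightarrow> int) \<Rightarrow> (nat \<Rightarrow> int) \<Rightarrow> (nat \<Rightarrow> int) \<Rightarrow> int \<Rightarrow> nat \<Rightarrow> int" where
  "grow l k eta j i = l i + k i - eta i - slack l k eta j (Suc i) + slack l k eta j i"

definition shrink :: "(nat \<Rightarrow> int) \<Rightarrow> (nat \<Rightarrow> int) \<Rightarrow> (nat \<Rightarrow> int) \<Rightarrow> nat \<Rightarrow> int" where
  "shrink l k m i = max (l (Suc i)) (k (Suc i)) + min (l i) (k i) - m (Suc i)"

lemma grow_alt: "grow l k eta j i =
    max (l i) (k i) + (case i of 0 \<Rightarrow> j | Suc i' \<Rightarrow> min (l i') (k i') - eta i')"
  by (simp add: grow_def slack_def max_def min_def)

lemma psum_grow: "psum (grow l k eta j) n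
    = psum l n + psum k n - psum eta n + j - slack l k eta j n"
  by (induction n) (simp_all add: grow_def slack_def[of l k eta j 0])

lemma shrink_grow: "shrink l k (grow l k eta j) = eta"
  by (rule ext) (simp add: shrink_def grow_alt)

lemma grow_shrink: "grow l k (shrink l k m) (m 0 - max (l 0) (k 0)) = m"
  by (rule ext) (simp add: shrink_def grow_alt split: nat.split)

lemma grow_hstrip:
  assumes "hstrip eta l" "hstrip eta k" "0 \<le> j"
  shows "hstrip l (grow l k eta j)" "hstrip k (grow l k eta j)"
proof -
  have 1: "eta i \<le> l i" "l (Suc i) \<le> eta i" "eta i \<le> k i" "k (Suc i) \<le> eta i" for i
    using assms(1,2) by (simp_all add: hstrip_def)
  have 2: "max (l i) (k i) \<le> grow l k eta j i" for i
    using 1[of "i - 1"] assms(3) by (auto simp: grow_alt split: nat.split)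
  have 3: "grow l k eta j (Suc i) \<le> min (l i) (k i)" for i
    using 1[of i] by (auto simp: grow_alt max_def min_def)
  show "hstrip l (grow l k eta j)" "hstrip k (grow l k eta j)"
    using 2 3 by (simp_all add: hstrip_def)
qed

lemma shrink_hstrip:
  assumes "hstrip l m" "hstrip k m"
  shows "hstrip (shrink l k m) l" "hstrip (shrink l k m) k"
proof -
  have 1: "l i \<le> m i" "m (Suc i) \<le> l i" "k i \<le> m i" "m (Suc i) \<le> k i" for i
    using assms by (simp_all add: hstrip_def)
  have "shrink l k m i \<le> min (l i) (k i)" "max (l (Suc i)) (k (Suc i)) \<le> shrink l k m i" for i
    using 1[of i] 1[of "Suc i"] by (auto simp: shrink_def max_def min_def)
  then show "hstrip (shrink l k m) l" "hstrip (shrink l k m) k"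
    by (simp_all add: hstrip_def)
qed

lemma grow_bounds:
  assumes "l \<in> shapes" "k \<in> shapes" "hstrip eta l" "hstrip eta k"
  obtains n where "bounded_by n l" "bounded_by n k" "bounded_by n eta"
    "bounded_by n (slack l k eta j)" "bounded_by n (grow l k eta j)"
proof -
  obtain a where a: "bounded_by a l" using assms shapes_bounded by blast
  obtain b where b: "bounded_by b k" using assms shapes_bounded by blast
  define n where "n = Suc (max a b)"
  have le: "max a b \<le> n" unfolding n_def by (rule le_SucI) (rule order_refl)
  have 1: "bounded_by (max a b) l" "bounded_by (max a b) k"
    by (auto intro: bounded_by_mono[OF a] bounded_by_mono[OF b])
  have 2: "bounded_by (max a b) eta" by (rule hstrip_bounded_down[OF assms(3,1) 1(1)])
  have 3: "bounded_by n l" "bounded_by n k" "bounded_by n eta"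
    using 1 2 le by (blast intro: bounded_by_mono)+
  have 4: "bounded_by n (slack l k eta j)"
    using 1 2 by (auto simp: n_def slack_def bounded_by_def split: nat.split)
  then have "bounded_by n (grow l k eta j)"
    using 3 by (simp add: bounded_by_def grow_def)
  with 3 4 show ?thesis by (rule that)
qed

lemma grow_total:
  assumes "l \<in> shapes" "k \<in> shapes" "hstrip eta l" "hstrip eta k"
  shows "total (grow l k eta j) = total l + total k - total eta + j"
proof -
  obtain n where n: "bounded_by n l" "bounded_by n k" "bounded_by n eta"
    "bounded_by n (slack l k eta j)" "bounded_by n (grow l k eta j)"
    using grow_bounds[OF assms] .
  show ?thesis unfolding n(1-3,5)[THEN total_eq] psum_grow
    using n(4) by (simp add: bounded_by_def)
qed

text \<open>As for toggling, with a boundary term that vanishes below the last row. The step uses that row \<open>i\<close> of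
\<open>eta\<close> plus its slack is \<open>l i\<close> or \<open>k i\<close>.\<close>

lemma grow_sign_aux:
  fixes l k eta :: "nat \<Rightarrow> int" and j :: int
  defines "m \<equiv> grow l k eta j"
  shows "even (psum (\<lambda>r. psum eta r * (l r - eta r)) n
    + psum (\<lambda>r. (psum eta r + int r) * (k r - eta r)) n
    + psum (\<lambda>r. (psum l r + int r) * (m r - l r)) n
    + psum (\<lambda>r. psum k r * (m r - k r)) n
    + (psum l n - psum eta n) * (psum k n - psum eta n)
    + (psum l n + psum k n + int n) * slack l k eta j n)"
proof (induction n)
  case 0
  show ?case by simp
next
  case (Suc n)
  define t where "t = slack l k eta j n"
  define t' where "t' = slack l k eta j (Suc n)"
  have t': "t' = l n - eta n \<or> t' = k n - eta n" by (auto simp: t'_def slack_def min_def)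
  have m: "m n = l n + k n - eta n - t' + t" by (simp add: m_def grow_def t_def t'_def)
  show ?case
    using Suc.IH t' unfolding t_def[symmetric] t'_def[symmetric] psum_Suc m
    by (elim disjE) (simp_all, argo+)
qed

lemma grow_sign:
  fixes j :: int
  assumes "l \<in> shapes" "k \<in> shapes" "hstrip eta l" "hstrip eta k"
  defines "m \<equiv> grow l k eta j"
  shows "even (b_exp eta l + (total l - total eta) * (total k - total eta) + p_exp eta k
    + (p_exp l m + b_exp k m))"
proof -
  obtain n where n: "bounded_by n l" "bounded_by n k" "bounded_by n eta"
    "bounded_by n (slack l k eta j)" "bounded_by n m"
    using grow_bounds[OF assms(1-4), of j] unfolding m_def .
  note z = n[unfolded bounded_by_def]
  have b1: "b_exp eta l = psum (\<lambda>r. psum eta r * (l r - eta r)) n"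
    unfolding b_exp_def by (rule total_eq) (simp add: z bounded_by_def)
  have p1: "p_exp eta k = psum (\<lambda>r. (psum eta r + int r) * (k r - eta r)) n"
    unfolding p_exp_def by (rule total_eq) (simp add: z bounded_by_def)
  have p2: "p_exp l m = psum (\<lambda>r. (psum l r + int r) * (m r - l r)) n"
    unfolding p_exp_def by (rule total_eq) (simp add: z bounded_by_def)
  have b2: "b_exp k m = psum (\<lambda>r. psum k r * (m r - k r)) n"
    unfolding b_exp_def by (rule total_eq) (simp add: z bounded_by_def)
  have "slack l k eta j n = 0" using z by simp
  then show "even (b_exp eta l + (total l - total eta) * (total k - total eta) + p_exp eta k
      + (p_exp l m + b_exp k m))"
    using grow_sign_aux[of eta l n k j, folded m_def] unfolding b1 p1 p2 b2 n(1-3)[THEN total_eq]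
    by (simp add: add_ac)
qed

section \<open>Pieri induction\<close>

lemma finite_sum_closed:
  fixes G :: "'a::ring_1 set"
  assumes "0 \<in> G" "\<And>x y. x \<in> G \<Longrightarrow> y \<in> G \<Longrightarrow> x + y \<in> G" "\<And>a. a \<in> A \<Longrightarrow> f a \<in> G"
  shows "sum f A \<in> G"
  using assms(3) by (induction A rule: infinite_finite_induct) (auto intro: assms)

lemma zero_shape [simp]: "(\<lambda>_. 0) \<in> shapes"
  by (auto simp: shapes_def bounded_by_def)

text \<open>The induction behind every later argument. Removing the last row \<open>x\<close> of \<open>l\<close> gives a shape \<open>l'\<close>, and
among the horizontal strips of size \<open>x\<close> on \<open>l'\<close> the shape \<open>l\<close> is the one with the largest entry in that
row. So \<open>D l\<close> is the Pieri sum minus terms that are already known to lie in \<open>G\<close>. With \<open>G = {0}\<close> this proves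
identities, with a subring it proves generation; the signs \<open>s\<close> are arbitrary.\<close>

theorem pieri_induct [consumes 1, case_names G0 Gadd Gneg zero step]:
  fixes D :: "(nat \<Rightarrow> int) \<Rightarrow> 'a::ring_1"
  assumes "l \<in> shapes"
    and G: "0 \<in> G" "\<And>x y. x \<in> G \<Longrightarrow> y \<in> G \<Longrightarrow> x + y \<in> G" "\<And>x. x \<in> G \<Longrightarrow> - x \<in> G"
    and zero: "D (\<lambda>_. 0) \<in> G"
    and step: "\<And>l j. l \<in> shapes \<Longrightarrow> D l \<in> G \<Longrightarrow> (\<Sum>rho\<in>up j l. signed (s l rho) (D rho)) \<in> G"
  shows "D l \<in> G"
proof -
  have signedG: "signed a x \<in> G" if "x \<in> G" for a x
    using that G(3) by (simp add: signed_def)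
  have main: "\<forall>l\<in>shapes. bounded_by n l \<longrightarrow> D l \<in> G" for n
  proof (induction n)
    case 0
    have "l = (\<lambda>_. 0)" if "bounded_by 0 l" for l :: "nat \<Rightarrow> int"
      using that by (auto simp: bounded_by_def)
    with zero show ?case by blast
  next
    case (Suc n)
    have "\<forall>l\<in>shapes. bounded_by (Suc n) l \<and> l n = int x \<longrightarrow> D l \<in> G" for x
    proof (induction x rule: less_induct)
      case (less x)
      show ?case
      proof safe
        fix l assume l: "l \<in> shapes" "bounded_by (Suc n) l" "l n = int x"
        define l' where "l' = l(n := 0)"
        have l's: "l' \<in> shapes" and l'n: "bounded_by n l'"
        proof -
          show "bounded_by n l'" using l(2) by (auto simp: l'_def bounded_by_def)
          moreover have "l' (Suc i) \<le> l' i" for i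
            using shapes_antimono[OF l(1), of i "Suc i"] l(2) shapes_nonneg[OF l(1)]
            by (auto simp: l'_def bounded_by_def)
          ultimately show "l' \<in> shapes" by (auto simp: shapes_def)
        qed
        have "D l' \<in> G" using Suc.IH l's l'n by blast
        then have sum: "(\<Sum>rho\<in>up x l'. signed (s l' rho) (D rho)) \<in> G" using step l's by blast
        have hs: "hstrip l' l"
          unfolding hstrip_def l'_def
          using shapes_antimono[OF l(1), of _ "Suc _"] l(2) l(3) by (auto simp: bounded_by_def)
        have t: "total l = total l' + int x"
        proof -
          have "psum l' n = psum l n" unfolding psum_def by (rule sum.cong) (auto simp: l'_def)
          then show ?thesis using l(3) by (simp add: total_eq[OF l(2)] total_eq[OF l'n])
        qed
        have lup: "l \<in> up x l'" using hs t by (simp add: up_def)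
        have rest: "signed (s l' rho) (D rho) \<in> G" if rho: "rho \<in> up x l' - {l}" for rho
        proof (rule signedG)
          have h: "hstrip l' rho" and tr: "total rho = total l' + int x"
            using rho by (auto simp: up_def)
          have rs: "rho \<in> shapes" using hstrip_shapes_up[OF h l's] .
          have rb: "bounded_by (Suc n) rho" by (rule hstrip_bounded_up[OF h l'n])
          have ge: "l' i \<le> rho i" for i using h by (simp add: hstrip_def)
          have pe: "psum rho n + rho n = psum l' n + int x"
            using tr by (simp add: total_eq[OF rb] total_eq[OF l'n])
          have pm: "psum l' n \<le> psum rho n" unfolding psum_def by (rule sum_mono) (rule ge)
          \<comment> \<open>All strips on the shape without last row have at most the entry x in that row.\<close>
        have "rho n \<noteq> int x"
          proof
            assume e: "rho n = int x"
            then have "(\<Sum>i<n. rho i - l' i) = 0" using pe by (simp add: psum_def sum_subtractf)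
            then have "rho i = l' i" if "i < n" for i
              using that ge by (subst (asm) sum_nonneg_eq_0_iff) auto
            then have "rho i = l i" for i
              using e l rb by (cases i n rule: linorder_cases) (auto simp: l'_def bounded_by_def)
            then have "rho = l" by (rule ext)
            with rho show False by simp
          qed
          with pe pm have lt: "rho n < int x" by linarith
          have "rho n = int (nat (rho n))" using shapes_nonneg[OF rs] by simp
          moreover have "nat (rho n) < x" using lt shapes_nonneg[OF rs, of n] by linarith
          ultimately show "D rho \<in> G" using less.IH rs rb by blast
        qed
        let ?rest = "\<Sum>rho\<in>up x l' - {l}. signed (s l' rho) (D rho)"
        have "?rest \<in> G"
          by (rule finite_sum_closed) (use G rest in auto)
        then have "(\<Sum>rho\<in>up x l'. signed (s l' rho) (D rho)) + - ?rest \<in> G"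
          by (intro G(2)[OF sum] G(3))
        moreover have "(\<Sum>rho\<in>up x l'. signed (s l' rho) (D rho)) = signed (s l' l) (D l) + ?rest"
          by (rule sum.remove[OF finite_up[OF l's] lup])
        ultimately have "signed (s l' l) (D l) \<in> G" by simp
        then have "signed (s l' l) (signed (s l' l) (D l)) \<in> G" by (rule signedG)
        then show "D l \<in> G" by (simp add: signed_def split: if_splits)
      qed
    qed
    then show ?case
      using shapes_nonneg by (metis nonneg_int_cases)
  qed
  then show ?thesis using assms(1) shapes_bounded by blast
qed

section \<open>Odd Schur polynomials and the right Pieri rule\<close>

lemma pow_comm:
  assumes "x * y = signed s (y * x)"
  shows "x ^ a * y = signed (int a * s) (y * (x::'a::ring_1) ^ a)"
proof (induction a)
  case (Suc a)
  have "x ^ Suc a * y = x * (x ^ a * y)" by (simp add: mult.assoc)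
  also have "\<dots> = signed (int a * s) (x * y * x ^ a)" by (simp add: Suc mult.assoc)
  finally show ?case by (simp add: assms mult.assoc algebra_simps)
qed simp

lemma comm_pow:
  assumes "x * y = signed s (y * x)"
  shows "x * y ^ a = signed (int a * s) (y ^ a * (x::'a::ring_1))"
proof (induction a)
  case (Suc a)
  have "x * y ^ Suc a = (x * y ^ a) * y" by (simp add: mult.assoc power_commutes)
  also have "\<dots> = signed (int a * s) (y ^ a * (x * y))" by (simp add: Suc mult.assoc)
  also have "y ^ a * (x * y) = signed s (y ^ Suc a * x)"
    by (simp add: assms) (simp add: mult.assoc[symmetric] power_commutes)
  finally show ?case by (simp add: algebra_simps)
qed simp

locale anticommuting =
  fixes X :: "nat \<Rightarrow> 'a::ring_1"
  assumes anticomm: "i \<noteq> j \<Longrightarrow> X i * X j = - (X j * X i)"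
begin

primrec complete_poly :: "nat \<Rightarrow> nat \<Rightarrow> 'a" where
  "complete_poly 0 k = (if k = 0 then 1 else 0)"
| "complete_poly (Suc m) k = (\<Sum>j\<le>k. complete_poly m (k - j) * X (Suc m) ^ j)"

primrec schur_poly :: "nat \<Rightarrow> (nat \<Rightarrow> int) \<Rightarrow> 'a" where
  "schur_poly 0 l = (if l = (\<lambda>_. 0) then 1 else 0)"
| "schur_poly (Suc m) l = (\<Sum>eta\<in>dn l. signed (b_exp eta l) (schur_poly m eta * X (Suc m) ^ nat (total l - total eta)))"

lemma X_pow: "i \<noteq> j \<Longrightarrow> X i * X j ^ e = signed (int e) (X j ^ e * X i)"
  using comm_pow[of "X i" "X j" 1 e] anticomm[of i j] by (simp add: signed_def)

lemma X_complete_poly: "m < i \<Longrightarrow> X i * complete_poly m k = signed (int k) (complete_poly m k * X i)"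
proof (induction m arbitrary: k)
  case (Suc m)
  have "X i * (complete_poly m (k - j) * X (Suc m) ^ j) = signed (int k) (complete_poly m (k - j) * X (Suc m) ^ j * X i)"
    if "j \<le> k" for j
  proof -
    have "X i * (complete_poly m (k - j) * X (Suc m) ^ j) = (X i * complete_poly m (k - j)) * X (Suc m) ^ j"
      by (simp add: mult.assoc)
    also have "\<dots> = signed (int (k - j)) (complete_poly m (k - j) * (X i * X (Suc m) ^ j))"
      using Suc.IH[of "k - j"] Suc.prems by (simp add: mult.assoc)
    also have "\<dots> = signed (int k) (complete_poly m (k - j) * X (Suc m) ^ j * X i)"
      using X_pow[of i "Suc m" j] Suc.prems that by (simp add: mult.assoc of_nat_diff)
    finally show ?thesis .
  qed
  then show ?case by (simp add: sum_distrib_left sum_distrib_right signed_sum)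
qed auto

text \<open>Split off the last variable \<open>x\<close> from both factors. The left side becomes a sum over a predecessor
\<open>eta\<close> of \<open>l\<close>, a power \<open>j\<close> of \<open>x\<close> from the complete polynomial, and a successor \<open>kap\<close> of \<open>eta\<close>; the right
side becomes a sum over a successor \<open>mu\<close> of \<open>l\<close> and a predecessor \<open>kap\<close> of \<open>mu\<close>. The growth rule matches
the two sums for fixed \<open>kap\<close>.\<close>

lemma pieri_right:
  assumes "l \<in> shapes"
  shows "schur_poly m l * complete_poly m k = (\<Sum>kap\<in>up k l. signed (p_exp l kap) (schur_poly m kap))"
  using assms
proof (induction m arbitrary: l k)
  case 0
  have t0: "total (\<lambda>_. 0) = 0" by (simp add: total_def)
  show ?case
  proof (cases "l = (\<lambda>_. 0) \<and> k = 0")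
    case True
    have "up 0 (\<lambda>_. 0) = {\<lambda>_. 0}"
    proof safe
      fix x :: "nat \<Rightarrow> int" assume x: "x \<in> up 0 (\<lambda>_. 0)"
      then have xs: "x \<in> shapes" by (rule up_shapes) simp
      have "x i = 0" for i using shape_le_total[OF xs, of i] shapes_nonneg[OF xs, of i] x
        by (simp add: up_def t0)
      then show "x = (\<lambda>_. 0)" by (rule ext)
    qed (simp add: up_def hstrip_def)
    then show ?thesis using True by (simp add: p_exp_def t0)
  next
    case False
    have "schur_poly 0 kap = 0" if kap: "kap \<in> up k l" for kap
    proof -
      have "kap \<noteq> (\<lambda>_. 0)"
      proof
        assume z: "kap = (\<lambda>_. 0)"
        then have "l i = 0" for i
          using kap shapes_nonneg[OF 0, of i] by (auto simp: up_def hstrip_def intro: antisym)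
        then have "l = (\<lambda>_. 0)" by (rule ext)
        with kap z t0 have "k = 0" by (simp add: up_def)
        with \<open>l = (\<lambda>_. 0)\<close> False show False by simp
      qed
      then show ?thesis by simp
    qed
    then have "(\<Sum>kap\<in>up k l. signed (p_exp l kap) (schur_poly 0 kap)) = 0"
      by (intro sum.neutral) auto
    with False show ?thesis by auto
  qed
next
  case (Suc m)
  let ?x = "X (Suc m)"
  define g where "g = (\<lambda>(eta, j, kap). signed (b_exp eta l + (total l - total eta) * (total kap - total eta) + p_exp eta kap)
      (schur_poly m kap * ?x ^ (nat (total l - total eta) + j)))"
  define g' where "g' = (\<lambda>(mu, kap). signed (p_exp l mu + b_exp kap mu) (schur_poly m kap * ?x ^ nat (total mu - total kap)))"
  have fd: "finite (dn l)" by (rule finite_dn[OF Suc.prems])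
  have summand: "signed (b_exp eta l) (schur_poly m eta * ?x ^ nat (total l - total eta)) * (complete_poly m (k - j) * ?x ^ j)
      = (\<Sum>kap\<in>up (k - j) eta. g (eta, j, kap))" if eta: "eta \<in> dn l" and j: "j \<le> k" for eta j
  proof -
    have es: "eta \<in> shapes" using eta Suc.prems by (rule dn_shapes)
    have le: "total eta \<le> total l" using eta by (auto simp: dn_def intro: total_mono[OF es])
    define a where "a = nat (total l - total eta)"
    have ia: "int a = total l - total eta" using le by (simp add: a_def)
    define s where "s = int a * int (k - j)"
    have c: "?x ^ a * complete_poly m (k - j) = signed s (complete_poly m (k - j) * ?x ^ a)"
      unfolding s_def by (rule pow_comm) (rule X_complete_poly, simp)
    have "signed (b_exp eta l) (schur_poly m eta * ?x ^ a) * (complete_poly m (k - j) * ?x ^ j)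
        = signed (b_exp eta l) (schur_poly m eta * (?x ^ a * complete_poly m (k - j)) * ?x ^ j)"
      by (simp add: mult.assoc)
    also have "\<dots> = signed (b_exp eta l + s) ((schur_poly m eta * complete_poly m (k - j)) * ?x ^ (a + j))"
      unfolding c by (simp add: mult.assoc power_add)
    also have "\<dots> = (\<Sum>kap\<in>up (k - j) eta. g (eta, j, kap))"
      unfolding Suc.IH[OF es] sum_distrib_right signed_sum
    proof (rule sum.cong[OF refl])
      fix kap assume "kap \<in> up (k - j) eta"
      then have "total kap - total eta = int (k - j)" by (simp add: up_def)
      then show "signed (b_exp eta l + s) (signed (p_exp eta kap) (schur_poly m kap) * ?x ^ (a + j)) = g (eta, j, kap)"
        by (simp add: g_def ia[symmetric] s_def)
    qed
    finally show ?thesis unfolding a_def .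
  qed
  have "schur_poly (Suc m) l * complete_poly (Suc m) k
      = (\<Sum>eta\<in>dn l. \<Sum>j\<le>k. signed (b_exp eta l) (schur_poly m eta * ?x ^ nat (total l - total eta)) * (complete_poly m (k - j) * ?x ^ j))"
    by (simp add: sum_product)
  also have "\<dots> = (\<Sum>eta\<in>dn l. \<Sum>j\<le>k. \<Sum>kap\<in>up (k - j) eta. g (eta, j, kap))"
    by (intro sum.cong refl summand) auto
  also have "\<dots> = (\<Sum>eta\<in>dn l. \<Sum>(j, kap)\<in>(SIGMA j:{..k}. up (k - j) eta). g (eta, j, kap))"
    by (intro sum.cong refl sum.Sigma) (auto intro: finite_up dn_shapes Suc.prems)
  also have "\<dots> = (\<Sum>(eta, j, kap)\<in>(SIGMA eta:dn l. SIGMA j:{..k}. up (k - j) eta). g (eta, j, kap))"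
    by (subst sum.Sigma) (auto intro!: finite_up dn_shapes Suc.prems fd)
  also have "\<dots> = (\<Sum>(mu, kap)\<in>(SIGMA mu:up k l. dn mu). g' (mu, kap))"
  proof (rule sum.reindex_bij_witness[where
        j = "\<lambda>(eta, j, kap). (grow l kap eta (int j), kap)" and
        i = "\<lambda>(mu, kap). (shrink l kap mu, nat (mu 0 - max (l 0) (kap 0)), kap)"], goal_cases)
    case (1 x)
    then show ?case
      by (auto simp: shrink_grow) (simp add: grow_alt)
  next
    case (2 x)
    obtain eta j kap where x: "x = (eta, j, kap)" by (cases x)
    from 2 x have m: "eta \<in> dn l" "j \<le> k" "kap \<in> up (k - j) eta" by auto
    have es: "eta \<in> shapes" using m(1) Suc.prems by (rule dn_shapes)
    have ks: "kap \<in> shapes" using m(3) es by (rule up_shapes)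
    have h: "hstrip eta l" "hstrip eta kap" and t: "total kap = total eta + int (k - j)"
      using m by (auto simp: dn_def up_def)
    show ?case using grow_hstrip[OF h, of "int j"] grow_total[OF Suc.prems ks h, of "int j"] t m(2)
      by (simp add: x up_def dn_def)
  next
    case (3 y)
    obtain mu kap where y: "y = (mu, kap)" by (cases y)
    from 3 y have m: "mu \<in> up k l" "kap \<in> dn mu" by auto
    then have "hstrip l mu" by (simp add: up_def)
    moreover have "hstrip kap mu" using m by (simp add: dn_def)
    ultimately have "max (l 0) (kap 0) \<le> mu 0" by (simp add: hstrip_def)
    then show ?case by (simp add: y grow_shrink)
  next
    case (4 y)
    obtain mu kap where y: "y = (mu, kap)" by (cases y)
    from 4 y have m: "mu \<in> up k l" "kap \<in> dn mu" by auto
    have h: "hstrip l mu" "hstrip kap mu" using m by (auto simp: up_def dn_def)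
    have ms: "mu \<in> shapes" using m(1) Suc.prems by (rule up_shapes)
    have ks: "kap \<in> shapes" using m(2) ms by (rule dn_shapes)
    define eta where "eta = shrink l kap mu"
    have he: "hstrip eta l" "hstrip eta kap" using shrink_hstrip[OF h] by (simp_all add: eta_def)
    have es: "eta \<in> shapes" using hstrip_shapes_down[OF he(1) Suc.prems] .
    define j where "j = nat (mu 0 - max (l 0) (kap 0))"
    have "max (l 0) (kap 0) \<le> mu 0" using h by (simp add: hstrip_def)
    then have ij: "int j = mu 0 - max (l 0) (kap 0)" by (simp add: j_def)
    have "total mu = total l + total kap - total eta + int j"
      using grow_total[OF Suc.prems ks he, of "int j"] by (simp add: ij eta_def grow_shrink)
    then have t: "total kap - total eta = int k - int j" using m(1) by (simp add: up_def)
    moreover have "total eta \<le> total kap" by (rule total_mono[OF es he(2)])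
    ultimately have "j \<le> k" by linarith
    then show ?case using he t unfolding y by (simp add: eta_def[symmetric] j_def[symmetric] dn_def up_def)
  next
    case (5 x)
    obtain eta j kap where x: "x = (eta, j, kap)" by (cases x)
    from 5 x have m: "eta \<in> dn l" "j \<le> k" "kap \<in> up (k - j) eta" by auto
    have es: "eta \<in> shapes" using m(1) Suc.prems by (rule dn_shapes)
    have ks: "kap \<in> shapes" using m(3) es by (rule up_shapes)
    have h: "hstrip eta l" "hstrip eta kap" using m by (auto simp: dn_def up_def)
    have le: "total eta \<le> total l" by (rule total_mono[OF es h(1)])
    have t: "total (grow l kap eta (int j)) - total kap = total l - total eta + int j"
      using grow_total[OF Suc.prems ks h, of "int j"] by simp
    have "nat (total l - total eta) + j = nat (total l - total eta + int j)" using le by simp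
    then show ?case unfolding x g_def g'_def
      by (simp add: t) (rule signed_cong, use grow_sign[OF Suc.prems ks h, of "int j"] in \<open>simp add: add_ac\<close>)
  qed
  also have "\<dots> = (\<Sum>mu\<in>up k l. \<Sum>kap\<in>dn mu. g' (mu, kap))"
    by (subst sum.Sigma) (auto intro!: finite_up finite_dn Suc.prems intro: up_shapes)
  also have "\<dots> = (\<Sum>mu\<in>up k l. signed (p_exp l mu) (schur_poly (Suc m) mu))"
    by (simp add: g'_def signed_sum)
  finally show ?case .
qed

end

section \<open>The left Pieri rule\<close>

lemma toggle_sum:
  assumes "l \<in> shapes"
  shows "(\<Sum>kap\<in>up k l. \<Sum>ta\<in>up j kap. signed (q_exp l kap + p_exp kap ta) (G ta))
       = (\<Sum>rho\<in>up j l. \<Sum>ta\<in>up k rho. signed (p_exp l rho + q_exp rho ta) (G ta))"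
proof -
  have valid: "toggle l ta x \<in> up b l" "ta \<in> up a (toggle l ta x)" if "x \<in> up a l" "ta \<in> up b x" for a b x ta
    using that toggle_hstrip[of l x ta] toggle_total[OF assms, of x ta] by (auto simp: up_def)
  have "(\<Sum>kap\<in>up k l. \<Sum>ta\<in>up j kap. signed (q_exp l kap + p_exp kap ta) (G ta))
      = (\<Sum>(kap, ta)\<in>(SIGMA kap:up k l. up j kap). signed (q_exp l kap + p_exp kap ta) (G ta))"
    by (rule sum.Sigma) (auto intro!: finite_up assms intro: up_shapes)
  also have "\<dots> = (\<Sum>(rho, ta)\<in>(SIGMA rho:up j l. up k rho). signed (p_exp l rho + q_exp rho ta) (G ta))"
  proof (rule sum.reindex_bij_witness[where i = "\<lambda>(x, ta). (toggle l ta x, ta)" and j = "\<lambda>(x, ta). (toggle l ta x, ta)"],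
      goal_cases)
    case (5 a)
    obtain kap ta where a: "a = (kap, ta)" by (cases a)
    with 5 have m: "kap \<in> up k l" "ta \<in> up j kap" by auto
    then have h: "hstrip l kap" "hstrip kap ta" by (auto simp: up_def)
    have "even (p_exp l (toggle l ta kap) + q_exp (toggle l ta kap) ta + (q_exp l kap + p_exp kap ta))"
      using toggle_sign[OF assms toggle_hstrip[OF h]] by simp
    then show ?case unfolding a by (simp add: signed_cong)
  qed (auto simp: valid)
  also have "\<dots> = (\<Sum>rho\<in>up j l. \<Sum>ta\<in>up k rho. signed (p_exp l rho + q_exp rho ta) (G ta))"
    by (rule sum.Sigma[symmetric]) (auto intro!: finite_up assms intro: up_shapes)
  finally show ?thesis .
qed

lemma total_zero [simp]: "total (\<lambda>_. 0) = 0"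
  by (simp add: total_def)

lemma up_zero_row: "kap \<in> up k (\<lambda>_. 0) \<Longrightarrow> r \<noteq> 0 \<Longrightarrow> kap r = 0"
  by (cases r) (auto simp: up_def hstrip_def intro: antisym)

context anticommuting
begin

lemma schur_poly_zero: "schur_poly m (\<lambda>_. 0) = 1"
proof (induction m)
  case (Suc m)
  have "dn (\<lambda>_. 0) = {\<lambda>_. 0}"
  proof (intro equalityI subsetI)
    fix x assume "x \<in> dn (\<lambda>_. 0)"
    then have "x i \<le> 0" "0 \<le> x i" for i by (simp_all add: dn_def hstrip_def)
    then have "x i = 0" for i by (rule antisym)
    then show "x \<in> {\<lambda>_. 0}" by auto
  qed (simp add: dn_def hstrip_def)
  then show ?case using Suc by (simp add: b_exp_def)
qed simp

text \<open>Both sides are multiplied from the right by complete polynomials: the left side obviously allows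
this, the right side by \<open>toggle_sum\<close>. They agree at the empty shape, where the two kinds of signs coincide
because all strips are single rows.\<close>

lemma pieri_left:
  assumes "l \<in> shapes"
  shows "complete_poly m k * schur_poly m l = (\<Sum>kap\<in>up k l. signed (q_exp l kap) (schur_poly m kap))"
proof -
  define D where "D l = complete_poly m k * schur_poly m l - (\<Sum>kap\<in>up k l. signed (q_exp l kap) (schur_poly m kap))" for l
  have "D l \<in> {0}"
    using assms
  proof (induction rule: pieri_induct[where s = p_exp and D = D and G = "{0}"])
    case zero
    have "complete_poly m k = (\<Sum>kap\<in>up k (\<lambda>_. 0). signed (p_exp (\<lambda>_. 0) kap) (schur_poly m kap))"
      using pieri_right[OF zero_shape, of m k] by (simp add: schur_poly_zero)
    also have "\<dots> = (\<Sum>kap\<in>up k (\<lambda>_. 0). signed (q_exp (\<lambda>_. 0) kap) (schur_poly m kap))"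
    proof (intro sum.cong refl)
      fix kap assume kap: "kap \<in> up k (\<lambda>_. 0)"
      have "psum (\<lambda>_. 0) r = 0" for r by (simp add: psum_def)
      moreover have "int r * kap r = 0" "psum kap r * kap r = 0" for r
        by (cases "r = 0"; simp add: up_zero_row[OF kap])+
      then have "(\<lambda>r. int r * kap r) = (\<lambda>_. 0)" "(\<lambda>r. psum kap r * kap r) = (\<lambda>_. 0)" by blast+
      ultimately show "signed (p_exp (\<lambda>_. 0) kap) (schur_poly m kap) = signed (q_exp (\<lambda>_. 0) kap) (schur_poly m kap)"
        by (simp add: p_exp_def q_exp_def)
    qed
    finally show ?case by (simp add: D_def schur_poly_zero)
  next
    case (step l j)
    then have l: "complete_poly m k * schur_poly m l = (\<Sum>kap\<in>up k l. signed (q_exp l kap) (schur_poly m kap))" by (simp add: D_def)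
    have "(\<Sum>rho\<in>up j l. signed (p_exp l rho) (complete_poly m k * schur_poly m rho)) = complete_poly m k * (schur_poly m l * complete_poly m j)"
      unfolding pieri_right[OF step(1)] by (simp add: sum_distrib_left)
    also have "\<dots> = (\<Sum>kap\<in>up k l. signed (q_exp l kap) (schur_poly m kap * complete_poly m j))"
      unfolding mult.assoc[symmetric] l by (simp add: sum_distrib_right)
    also have "\<dots> = (\<Sum>kap\<in>up k l. \<Sum>ta\<in>up j kap. signed (q_exp l kap + p_exp kap ta) (schur_poly m ta))"
      by (intro sum.cong refl) (simp add: pieri_right[OF up_shapes[OF _ step(1)]] signed_sum)
    also have "\<dots> = (\<Sum>rho\<in>up j l. \<Sum>ta\<in>up k rho. signed (p_exp l rho + q_exp rho ta) (schur_poly m ta))"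
      by (rule toggle_sum[OF step(1)])
    also have "\<dots> = (\<Sum>rho\<in>up j l. signed (p_exp l rho) (\<Sum>ta\<in>up k rho. signed (q_exp rho ta) (schur_poly m ta)))"
      by (simp add: signed_sum)
    finally show ?case unfolding D_def by (simp add: signed_diff sum_subtractf)
  qed auto
  then show ?thesis by (simp add: D_def)
qed

end

section \<open>Littlewood-Richardson chains\<close>

text \<open>The number of boxes of \<open>b/a\<close> in the first \<open>j\<close> rows is at least the number of boxes of \<open>c/b\<close> in the
first \<open>j + 1\<close> rows. This is the lattice condition on the reading word of a skew tableau, for two
consecutive letters.\<close>

definition lr_cond :: "(nat \<Rightarrow> int) \<Rightarrow> (nat \<Rightarrow> int) \<Rightarrow> (nat \<Rightarrow> int) \<Rightarrow> bool" where
  "lr_cond a b c \<longleftrightarrow> (\<forall>j. psum c (Suc j) - psum b (Suc j) \<le> psum b j - psum a j)"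

lemma excess_simps: "excess l ta 0 = 0" "excess l ta (Suc i) = max 0 (ta (Suc i) - l i)"
  by (simp_all add: excess_def)

lemma excess_nonneg: "0 \<le> excess l ta i"
  by (simp add: excess_def split: nat.split)

text \<open>In terms of partial sums, toggling is
\<open>Y(j) = max (B(j) + Z(j)) (B(j - 1) + Z(j + 1)) - C(j)\<close>, and the lattice condition is the rhombus inequality
\<open>B(j) + B(j + 1) \<ge> C(j + 1) + A(j)\<close>. Each of the two terms of the maximum for \<open>X\<close> is bounded using one
rhombus inequality of the old triple, with index \<open>j\<close> or \<open>j - 1\<close>, and one term of the maximum for \<open>Y\<close>.\<close>

lemma lr_cond_toggle_down:
  assumes lr: "lr_cond a b c" and y: "y = toggle b z c" and x: "x = toggle a y b"
  shows "lr_cond x y z"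
  unfolding lr_cond_def
proof
  fix j
  have px: "psum x j = psum a j + psum y j - psum b j + excess a y j" by (simp add: x psum_toggle)
  have py: "psum y (Suc j) = psum b (Suc j) + psum z (Suc j) - psum c (Suc j) + excess b z (Suc j)"
    by (simp only: y psum_toggle)
  have lrj: "psum c (Suc j) - psum b (Suc j) \<le> psum b j - psum a j" using lr by (simp only: lr_cond_def)
  have "psum c (Suc j) - psum b (Suc j) - excess b z (Suc j) \<le> psum b j - psum a j - excess a y j"
  proof (cases "excess a y j = 0")
    case True
    then show ?thesis using lrj excess_nonneg[of b z "Suc j"] by linarith
  next
    case False
    then obtain i where i: "j = Suc i" by (cases j) (auto simp: excess_simps)
    have e: "excess a y j = y j - a i" using False unfolding i excess_simps by linarith
    have yj: "y j = b j + z j - c j + excess b z (Suc j) - excess b z j" by (simp only: y toggle_def)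
    have "z j - b i \<le> excess b z j" unfolding i excess_simps by simp
    moreover have "psum c (Suc i) - psum b (Suc i) \<le> psum b i - psum a i" using lr by (simp only: lr_cond_def)
    ultimately show ?thesis unfolding e yj unfolding i psum_Suc by linarith
  qed
  then show "psum z (Suc j) - psum y (Suc j) \<le> psum y j - psum x j" unfolding px py by linarith
qed

lemma lr_cond_toggle_up:
  assumes lr: "lr_cond x y z" and b: "b = toggle a y x" and c: "c = toggle b z y"
  shows "lr_cond a b c"
  unfolding lr_cond_def
proof
  fix j
  have pb: "psum b j = psum a j + psum y j - psum x j + excess a y j" by (simp add: b psum_toggle)
  have pc: "psum c (Suc j) = psum b (Suc j) + psum z (Suc j) - psum y (Suc j) + excess b z (Suc j)"
    by (simp only: c psum_toggle)
  have lrj: "psum z (Suc i) - psum y (Suc i) \<le> psum y i - psum x i" for i using lr by (simp only: lr_cond_def)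
  have "psum z (Suc j) - psum y (Suc j) + excess b z (Suc j) \<le> psum y j - psum x j + excess a y j"
  proof (cases "excess b z (Suc j) = 0")
    case True
    then show ?thesis using lrj[of j] excess_nonneg[of a y j] by linarith
  next
    case False
    then have e: "excess b z (Suc j) = z (Suc j) - b j" unfolding excess_simps by linarith
    have bj: "b j = a j + y j - x j + excess a y (Suc j) - excess a y j" by (simp only: b toggle_def)
    have "y (Suc j) - a j \<le> excess a y (Suc j)" unfolding excess_simps by simp
    then show ?thesis using lrj[of "Suc j"] unfolding e bj psum_Suc by linarith
  qed
  then show "psum c (Suc j) - psum b (Suc j) \<le> psum b j - psum a j" unfolding pb pc by linarith
qed

text \<open>Only the first \<open>n + 1\<close> entries of a chain are meaningful; the others are set to the empty shape to
make chains unique as functions.\<close>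

definition chains :: "nat \<Rightarrow> (nat \<Rightarrow> int) \<Rightarrow> (nat \<Rightarrow> int) \<Rightarrow> (nat \<Rightarrow> nat \<Rightarrow> int) set" where
  "chains n nu mu = {c. c 0 = mu \<and> (\<forall>t<n. c (Suc t) \<in> up (nat (nu t)) (c t)) \<and>
     (\<forall>t. Suc t < n \<longrightarrow> lr_cond (c t) (c (Suc t)) (c (Suc (Suc t)))) \<and> (\<forall>t>n. c t = (\<lambda>_. 0))}"

definition chain_exp :: "nat \<Rightarrow> (nat \<Rightarrow> nat \<Rightarrow> int) \<Rightarrow> int" where
  "chain_exp n c = (\<Sum>t<n. p_exp (c t) (c (Suc t)))"

lemma chains_shapes:
  assumes "c \<in> chains n nu mu" "mu \<in> shapes" "t \<le> n" shows "c t \<in> shapes"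
  using assms(3)
proof (induction t)
  case (Suc t)
  then have "c (Suc t) \<in> up (nat (nu t)) (c t)" using assms(1) by (auto simp: chains_def)
  with Suc show ?case by (auto intro: up_shapes)
qed (use assms in \<open>auto simp: chains_def\<close>)

lemma finite_chains:
  assumes "mu \<in> shapes" shows "finite (chains n nu mu)"
proof (induction n)
  case 0
  have "chains 0 nu mu \<subseteq> {(\<lambda>t. if t = 0 then mu else (\<lambda>_. 0))}" by (auto simp: chains_def)
  then show ?case by (rule finite_subset) simp
next
  case (Suc n)
  have "chains (Suc n) nu mu \<subseteq>
      (\<lambda>(c, x). c(Suc n := x)) ` (SIGMA c:chains n nu mu. up (nat (nu n)) (c n))"
  proof
    fix c assume c: "c \<in> chains (Suc n) nu mu"
    have "c(Suc n := (\<lambda>_. 0)) \<in> chains n nu mu" using c by (auto simp: chains_def)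
    moreover have "c (Suc n) \<in> up (nat (nu n)) ((c(Suc n := (\<lambda>_. 0))) n)"
      using c by (auto simp: chains_def)
    ultimately show "c \<in> (\<lambda>(c, x). c(Suc n := x)) ` (SIGMA c:chains n nu mu. up (nat (nu n)) (c n))"
      by (intro image_eqI[of _ _ "(c(Suc n := (\<lambda>_. 0)), c (Suc n))"]) auto
  qed
  moreover have "finite (SIGMA c:chains n nu mu. up (nat (nu n)) (c n))"
    by (rule finite_SigmaI[OF Suc], rule finite_up, rule chains_shapes[OF _ assms], assumption, simp)
  ultimately show ?case by (blast intro: finite_subset finite_imageI)
qed

section \<open>Sliding a strip through a chain\<close>

text \<open>The chain that results from moving the strip from \<open>c n\<close> to \<open>ta\<close> down through the chain \<open>c\<close>; its
inverse \<open>unslide\<close> starts from the lower end.\<close>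

primrec slide :: "nat \<Rightarrow> (nat \<Rightarrow> nat \<Rightarrow> int) \<Rightarrow> (nat \<Rightarrow> int) \<Rightarrow> nat \<Rightarrow> nat \<Rightarrow> int" where
  "slide 0 c ta = (\<lambda>t. if t = 0 then ta else (\<lambda>_. 0))"
| "slide (Suc n) c ta = (slide n c (toggle (c n) ta (c (Suc n))))(Suc n := ta)"

lemma slide_last [simp]: "slide n c ta n = ta"
  by (cases n) auto

lemma slide_beyond: "n < t \<Longrightarrow> slide n c ta t = (\<lambda>_. 0)"
  by (induction n arbitrary: ta) auto

lemma slide_step: "t < n \<Longrightarrow> slide n c ta t = toggle (c t) (slide n c ta (Suc t)) (c (Suc t))"
proof (induction n arbitrary: ta)
  case (Suc n)
  then show ?case by (cases "t = n") auto
qed simp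

lemma slide_unique:
  assumes "\<And>t. t < n \<Longrightarrow> c' t = toggle (c t) (c' (Suc t)) (c (Suc t))" "\<And>t. n < t \<Longrightarrow> c' t = (\<lambda>_. 0)"
  shows "slide n c (c' n) = c'"
proof -
  have "slide n c (c' n) t = c' t" if "t \<le> n" for t
    using that by (induction t rule: inc_induct) (simp_all add: slide_step assms(1))
  moreover have "slide n c (c' n) t = c' t" if "\<not> t \<le> n" for t
    using that assms(2)[of t] slide_beyond[of n t] by simp
  ultimately show ?thesis by blast
qed

primrec unslide :: "(nat \<Rightarrow> nat \<Rightarrow> int) \<Rightarrow> (nat \<Rightarrow> int) \<Rightarrow> nat \<Rightarrow> nat \<Rightarrow> int" where
  "unslide c' mu 0 = mu"
| "unslide c' mu (Suc t) = toggle (unslide c' mu t) (c' (Suc t)) (c' t)"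

definition cut :: "nat \<Rightarrow> (nat \<Rightarrow> nat \<Rightarrow> int) \<Rightarrow> nat \<Rightarrow> nat \<Rightarrow> int" where
  "cut n c = (\<lambda>t. if t \<le> n then c t else (\<lambda>_. 0))"

lemma toggle_up:
  assumes "l \<in> shapes" "x \<in> up a l" "ta \<in> up b x"
  shows "toggle l ta x \<in> up b l" "ta \<in> up a (toggle l ta x)"
  using assms toggle_hstrip[of l x ta] toggle_total[OF assms(1), of x ta] by (auto simp: up_def)

lemma slide_chain:
  assumes c: "c \<in> chains n nu mu" and mu: "mu \<in> shapes" and ta: "ta \<in> up k (c n)"
  defines "c' \<equiv> slide n c ta"
  shows "t \<le> n \<Longrightarrow> c' t \<in> up k (c t)" and "c' \<in> chains n nu (c' 0)"
    and "even (chain_exp n c + q_exp (c n) ta + (q_exp mu (c' 0) + chain_exp n c'))"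
proof -
  have cs: "c t \<in> shapes" if "t \<le> n" for t using chains_shapes[OF c mu that] .
  have cu: "c (Suc t) \<in> up (nat (nu t)) (c t)" if "t < n" for t using c that by (simp add: chains_def)
  have st: "c' t = toggle (c t) (c' (Suc t)) (c (Suc t))" if "t < n" for t
    unfolding c'_def by (rule slide_step[OF that])
  show u: "c' t \<in> up k (c t)" if "t \<le> n" for t
    using that
  proof (induction t rule: inc_induct)
    case base
    then show ?case using ta by (simp add: c'_def)
  next
    case (step t)
    then show ?case using toggle_up(1)[OF cs cu step(3)] st by simp
  qed
  have u': "c' (Suc t) \<in> up (nat (nu t)) (c' t)" if "t < n" for t
    using toggle_up(2)[OF cs cu u, of t] that st by simp
  show "c' \<in> chains n nu (c' 0)"
    unfolding chains_def
  proof (intro CollectI conjI allI impI)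
    fix t assume "Suc t < n"
    then show "lr_cond (c' t) (c' (Suc t)) (c' (Suc (Suc t)))"
      by (intro lr_cond_toggle_down[OF _ st[of "Suc t"] st[of t]]) (use c in \<open>simp_all add: chains_def\<close>)
  next
    fix t assume "t < n"
    then show "c' (Suc t) \<in> up (nat (nu t)) (c' t)" by (rule u')
  qed (simp_all add: c'_def slide_beyond)
  have "even (chain_exp m c + q_exp (c m) (c' m) + (q_exp mu (c' 0) + chain_exp m c'))" if "m \<le> n" for m
    using that
  proof (induction m)
    case 0
    then show ?case using c by (simp add: chain_exp_def chains_def)
  next
    case (Suc m)
    have "hstrip (c m) (c (Suc m))" "hstrip (c (Suc m)) (c' (Suc m))"
      using cu[of m] u[of "Suc m"] Suc.prems by (auto simp: up_def)
    from toggle_sign[OF cs this] st[of m] Suc.prems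
    have "even (p_exp (c m) (c (Suc m)) + q_exp (c (Suc m)) (c' (Suc m)) +
       (q_exp (c m) (c' m) + p_exp (c' m) (c' (Suc m))))" by simp
    then show ?case using Suc unfolding chain_exp_def by simp argo
  qed
  from this[of n] show "even (chain_exp n c + q_exp (c n) ta + (q_exp mu (c' 0) + chain_exp n c'))"
    by (simp add: c'_def)
qed

lemma unslide_chain:
  assumes c': "c' \<in> chains n nu mu'" and mu: "mu \<in> shapes" and mu': "mu' \<in> up k mu"
  defines "c \<equiv> cut n (unslide c' mu)"
  shows "c \<in> chains n nu mu" "c' n \<in> up k (c n)" "slide n c (c' n) = c'"
proof -
  have c'u: "c' (Suc t) \<in> up (nat (nu t)) (c' t)" if "t < n" for t using c' that by (simp add: chains_def)
  have st: "c (Suc t) = toggle (c t) (c' (Suc t)) (c' t)" if "t < n" for t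
    using that by (simp add: c_def cut_def)
  have c0: "c 0 = mu" by (simp add: c_def cut_def)
  have both: "c t \<in> shapes \<and> c' t \<in> up k (c t) \<and> (t < n \<longrightarrow> c (Suc t) \<in> up (nat (nu t)) (c t))"
    if "t \<le> n" for t
    using that
  proof (induction t)
    case 0
    have "c' 0 = mu'" using c' by (simp add: chains_def)
    then have u0: "c' 0 \<in> up k (c 0)" using mu' by (simp add: c0)
    moreover have "c (Suc 0) \<in> up (nat (nu 0)) (c 0)" if "0 < n"
      using toggle_up(1)[OF _ u0 c'u[OF that]] st[OF that] mu by (simp add: c0)
    ultimately show ?case using mu by (simp add: c0)
  next
    case (Suc t)
    then have IH: "c t \<in> shapes" "c' t \<in> up k (c t)" "c (Suc t) \<in> up (nat (nu t)) (c t)" and tn: "t < n" by auto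
    have s: "c (Suc t) \<in> shapes" using IH up_shapes by blast
    have u: "c' (Suc t) \<in> up k (c (Suc t))"
      using toggle_up(2)[OF IH(1,2) c'u[OF tn]] st[OF tn] by simp
    have "c (Suc (Suc t)) \<in> up (nat (nu (Suc t))) (c (Suc t))" if "Suc t < n"
      using toggle_up(1)[OF s u c'u[OF that]] st[OF that] by simp
    with s u show ?case by blast
  qed
  show "c' n \<in> up k (c n)" using both by simp
  show "slide n c (c' n) = c'"
  proof (rule slide_unique)
    fix t assume "t < n"
    from st[OF this] show "c' t = toggle (c t) (c' (Suc t)) (c (Suc t))" by simp
  next
    fix t assume "n < t"
    then show "c' t = (\<lambda>_. 0)" using c' by (simp add: chains_def)
  qed
  show "c \<in> chains n nu mu"
    unfolding chains_def
  proof (intro CollectI conjI allI impI)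
    fix t assume "Suc t < n"
    then show "lr_cond (c t) (c (Suc t)) (c (Suc (Suc t)))"
      by (intro lr_cond_toggle_up[OF _ st[of t] st[of "Suc t"]]) (use c' in \<open>simp_all add: chains_def\<close>)
  next
    fix t assume "t < n"
    then show "c (Suc t) \<in> up (nat (nu t)) (c t)" using both[of t] by simp
  next
    fix t assume "n < t"
    then show "c t = (\<lambda>_. 0)" by (simp add: c_def cut_def)
  qed (rule c0)
qed

lemma unslide_slide:
  assumes c: "c \<in> chains n nu mu"
  shows "cut n (unslide (slide n c ta) mu) = c"
proof -
  have "unslide (slide n c ta) mu t = c t" if "t \<le> n" for t
    using that
  proof (induction t)
    case (Suc t)
    then have "unslide (slide n c ta) mu (Suc t) = toggle (c t) (slide n c ta (Suc t)) (slide n c ta t)"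
      by simp
    also have "slide n c ta t = toggle (c t) (slide n c ta (Suc t)) (c (Suc t))"
      using Suc.prems by (intro slide_step) simp
    finally show ?case by simp
  qed (use c in \<open>simp add: chains_def\<close>)
  moreover have "c t = (\<lambda>_. 0)" if "\<not> t \<le> n" for t using c that by (simp add: chains_def)
  ultimately show ?thesis by (simp add: cut_def fun_eq_iff)
qed

text \<open>The operator summing over chains commutes with adding a strip with the signs of the left Pieri
rule.\<close>

lemma chain_sum_slide:
  assumes mu: "mu \<in> shapes"
  shows "(\<Sum>c\<in>chains n nu mu. \<Sum>ta\<in>up k (c n). signed (chain_exp n c + q_exp (c n) ta) (G ta))
       = (\<Sum>mu'\<in>up k mu. \<Sum>c'\<in>chains n nu mu'. signed (q_exp mu mu' + chain_exp n c') (G (c' n)))"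
proof -
  have "(\<Sum>c\<in>chains n nu mu. \<Sum>ta\<in>up k (c n). signed (chain_exp n c + q_exp (c n) ta) (G ta))
      = (\<Sum>(c, ta)\<in>(SIGMA c:chains n nu mu. up k (c n)). signed (chain_exp n c + q_exp (c n) ta) (G ta))"
    by (rule sum.Sigma[OF finite_chains[OF mu]]) (blast intro: finite_up chains_shapes[OF _ mu order_refl])
  also have "\<dots> = (\<Sum>(mu', c')\<in>(SIGMA mu':up k mu. chains n nu mu').
      signed (q_exp mu mu' + chain_exp n c') (G (c' n)))"
  proof (rule sum.reindex_bij_witness[where j = "\<lambda>(c, ta). (slide n c ta 0, slide n c ta)" and
        i = "\<lambda>(mu', c'). (cut n (unslide c' mu), c' n)"], goal_cases)
    case (1 a)
    obtain c ta where a: "a = (c, ta)" by (cases a)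
    with 1 have "c \<in> chains n nu mu" by simp
    then show ?case unfolding a by (simp add: unslide_slide)
  next
    case (2 a)
    obtain c ta where a: "a = (c, ta)" by (cases a)
    with 2 have m: "c \<in> chains n nu mu" "ta \<in> up k (c n)" by auto
    have "c 0 = mu" using m(1) by (simp add: chains_def)
    then show ?case unfolding a using slide_chain(1)[OF m(1) mu m(2), of 0] slide_chain(2)[OF m(1) mu m(2)]
      by simp
  next
    case (3 b)
    obtain mu' c' where b: "b = (mu', c')" by (cases b)
    with 3 have m: "mu' \<in> up k mu" "c' \<in> chains n nu mu'" by auto
    have "c' 0 = mu'" using m(2) by (simp add: chains_def)
    then show ?case unfolding b using unslide_chain(3)[OF m(2) mu m(1)] by simp
  next
    case (4 b)
    obtain mu' c' where b: "b = (mu', c')" by (cases b)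
    with 4 have m: "mu' \<in> up k mu" "c' \<in> chains n nu mu'" by auto
    then show ?case unfolding b using unslide_chain(1,2)[OF m(2) mu m(1)] by simp
  next
    case (5 a)
    obtain c ta where a: "a = (c, ta)" by (cases a)
    with 5 have m: "c \<in> chains n nu mu" "ta \<in> up k (c n)" by auto
    show ?case unfolding a using slide_chain(3)[OF m(1) mu m(2)] by (simp add: signed_cong add.commute)
  qed
  also have "\<dots> = (\<Sum>mu'\<in>up k mu. \<Sum>c'\<in>chains n nu mu'. signed (q_exp mu mu' + chain_exp n c') (G (c' n)))"
    by (rule sum.Sigma[symmetric, OF finite_up[OF mu]]) (blast intro: finite_chains up_shapes[OF _ mu])
  finally show ?thesis .
qed

section \<open>The Littlewood-Richardson rule for odd Schur polynomials\<close>

text \<open>The only Littlewood-Richardson chain that starts at the empty shape: its \<open>t\<close>-th shape consists of the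
first \<open>t\<close> rows of \<open>nu\<close>.\<close>

definition stair :: "nat \<Rightarrow> (nat \<Rightarrow> int) \<Rightarrow> nat \<Rightarrow> nat \<Rightarrow> int" where
  "stair n nu t r = (if t \<le> n \<and> r < t then nu r else 0)"

lemma psum_stair: "t \<le> n \<Longrightarrow> psum (stair n nu t) j = psum nu (min t j)"
proof (induction j)
  case (Suc j)
  show ?case
  proof (cases "j < t")
    case True
    then have "min t (Suc j) = Suc j" "min t j = j" by simp_all
    then show ?thesis using Suc True by (simp add: stair_def)
  next
    case False
    then have "min t (Suc j) = t" "min t j = t" by simp_all
    then show ?thesis using Suc False by (simp add: stair_def)
  qed
qed simp

lemma stair_bounded: "bounded_by t (stair n nu t)"
  by (simp add: bounded_by_def stair_def)

lemma total_stair: "t \<le> n \<Longrightarrow> total (stair n nu t) = psum nu t"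
  by (simp add: total_eq[OF stair_bounded] psum_stair)

lemma stair_0: "stair n nu 0 = (\<lambda>_. 0)"
  by (rule ext) (simp add: stair_def)

lemma stair_chain:
  assumes nu: "nu \<in> shapes"
  shows "stair n nu \<in> chains n nu (\<lambda>_. 0)"
  unfolding chains_def
proof (intro CollectI conjI allI impI)
  fix t assume t: "t < n"
  have "hstrip (stair n nu t) (stair n nu (Suc t))"
    unfolding hstrip_def
  proof (intro allI conjI)
    fix i
    show "stair n nu t i \<le> stair n nu (Suc t) i"
      using shapes_nonneg[OF nu] t by (simp add: stair_def)
    show "stair n nu (Suc t) (Suc i) \<le> stair n nu t i"
      using shapes_antimono[OF nu, of i "Suc i"] t by (simp add: stair_def)
  qed
  then show "stair n nu (Suc t) \<in> up (nat (nu t)) (stair n nu t)"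
    using t shapes_nonneg[OF nu, of t] by (simp add: up_def total_stair)
next
  fix t assume t: "Suc t < n"
  have mono: "nu (Suc t) \<le> nu t" using nu by (rule shapes_antimono) simp
  show "lr_cond (stair n nu t) (stair n nu (Suc t)) (stair n nu (Suc (Suc t)))"
    unfolding lr_cond_def
  proof
    fix j
    have p: "psum (stair n nu s) i = psum nu (min s i)" if "s \<le> Suc (Suc t)" for s i
      using that t by (simp add: psum_stair del: psum_Suc)
    show "psum (stair n nu (Suc (Suc t))) (Suc j) - psum (stair n nu (Suc t)) (Suc j)
        \<le> psum (stair n nu (Suc t)) j - psum (stair n nu t) j"
    proof (cases "j \<le> t")
      case True
      then have "min (Suc (Suc t)) (Suc j) = Suc j" "min (Suc t) (Suc j) = Suc j" "min (Suc t) j = j" "min t j = j"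
        by simp_all
      then show ?thesis by (simp add: p del: psum_Suc)
    next
      case False
      then have "min (Suc (Suc t)) (Suc j) = Suc (Suc t)" "min (Suc t) (Suc j) = Suc t" "min (Suc t) j = Suc t" "min t j = t"
        by simp_all
      then have q: "psum (stair n nu (Suc (Suc t))) (Suc j) = psum nu (Suc (Suc t))"
          "psum (stair n nu (Suc t)) (Suc j) = psum nu (Suc t)"
          "psum (stair n nu (Suc t)) j = psum nu (Suc t)" "psum (stair n nu t) j = psum nu t"
        by (simp_all add: p del: psum_Suc)
      show ?thesis unfolding q using mono by simp
    qed
  qed
qed (simp_all add: stair_def fun_eq_iff)

text \<open>By induction \<open>c t\<close> is the stair, so the lattice condition forbids the next strip to have boxes in the
first \<open>t\<close> rows; being a horizontal strip it has none below row \<open>t + 1\<close> either.\<close>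

lemma chain_from_zero:
  assumes nu: "nu \<in> shapes" and c: "c \<in> chains n nu (\<lambda>_. 0)"
  shows "c = stair n nu"
proof -
  have main: "(\<forall>s\<le>t. c s = stair n nu s)" if "t \<le> n" for t
    using that
  proof (induction t)
    case 0
    have "c 0 = stair n nu 0" using c by (simp add: chains_def stair_0)
    then show ?case by simp
  next
    case (Suc t)
    then have IH: "\<And>s. s \<le> t \<Longrightarrow> c s = stair n nu s" and t: "t < n" by auto
    have u: "c (Suc t) \<in> up (nat (nu t)) (c t)" using c t by (simp add: chains_def)
    then have h: "hstrip (c t) (c (Suc t))" and tt: "total (c (Suc t)) = total (c t) + nu t"
      using shapes_nonneg[OF nu, of t] by (simp_all add: up_def)
    have bt: "bounded_by t (c t)" using IH[of t] stair_bounded by simp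
    have bS: "bounded_by (Suc t) (c (Suc t))" by (rule hstrip_bounded_up[OF h bt])
    have ge: "c t i \<le> c (Suc t) i" for i using h by (simp add: hstrip_def)
    have le: "psum (c (Suc t)) t \<le> psum (c t) t"
    proof (cases t)
      case (Suc t')
      have "lr_cond (c t') (c t) (c (Suc t))" using c t Suc by (simp add: chains_def)
      then have "psum (c (Suc t)) (Suc t') - psum (c t) (Suc t') \<le> psum (c t) t' - psum (c t') t'"
        unfolding lr_cond_def by blast
      also have "\<dots> = 0" using IH[of t] IH[of t'] t Suc by (simp add: psum_stair)
      finally show ?thesis using Suc by simp
    qed simp
    have eq: "c (Suc t) i = c t i" if "i < t" for i
    proof -
      have "(\<Sum>i<t. c (Suc t) i - c t i) \<le> 0" using le by (simp add: psum_def sum_subtractf)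
      moreover have "0 \<le> (\<Sum>i<t. c (Suc t) i - c t i)" by (rule sum_nonneg) (simp add: ge)
      ultimately have "(\<Sum>i<t. c (Suc t) i - c t i) = 0" by simp
      then show ?thesis using that ge by (subst (asm) sum_nonneg_eq_0_iff) auto
    qed
    have "psum (c (Suc t)) t = psum (c t) t" unfolding psum_def by (rule sum.cong) (simp_all add: eq)
    then have top: "c (Suc t) t = nu t"
      using tt by (simp add: total_eq[OF bS] total_eq[OF bt])
    have "c (Suc t) i = stair n nu (Suc t) i" for i
    proof (cases i t rule: linorder_cases)
      case less
      then show ?thesis using eq[OF less] IH[of t] t by (simp add: stair_def)
    next
      case equal
      then show ?thesis using top t by (simp add: stair_def)
    next
      case greater
      then show ?thesis using bS by (simp add: bounded_by_def stair_def)
    qed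
    then have "c (Suc t) = stair n nu (Suc t)" by (rule ext)
    then show ?case using IH by (simp add: le_Suc_eq)
  qed
  show ?thesis
  proof (rule ext)
    fix t
    show "c t = stair n nu t"
    proof (cases "t \<le> n")
      case True
      then show ?thesis using main[of n] by simp
    next
      case False
      then show ?thesis using c by (simp add: chains_def fun_eq_iff stair_def)
    qed
  qed
qed

definition stair_exp :: "nat \<Rightarrow> (nat \<Rightarrow> int) \<Rightarrow> int" where
  "stair_exp n nu = (\<Sum>t<n. (psum nu t + int t) * nu t)"

lemma chain_exp_stair: "chain_exp n (stair n nu) = stair_exp n nu"
  unfolding chain_exp_def stair_exp_def
proof (rule sum.cong[OF refl])
  fix t assume "t \<in> {..<n}"
  then have t: "t < n" by simp
  let ?f = "\<lambda>r. (psum (stair n nu t) r + int r) * (stair n nu (Suc t) r - stair n nu t r)"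
  have "p_exp (stair n nu t) (stair n nu (Suc t)) = psum ?f (Suc t)"
    unfolding p_exp_def by (rule total_eq) (simp add: bounded_by_def stair_def)
  also have "psum ?f t = 0" unfolding psum_def by (rule sum.neutral) (use t in \<open>simp add: stair_def\<close>)
  then have "psum ?f (Suc t) = (psum nu t + int t) * nu t"
    using t by (simp add: psum_stair) (simp add: stair_def)
  finally show "p_exp (stair n nu t) (stair n nu (Suc t)) = (psum nu t + int t) * nu t" .
qed

context anticommuting
begin

text \<open>Both sides, as functions of \<open>mu\<close>, allow left multiplication by complete polynomials in the same way:
the left side by \<open>pieri_left\<close> and associativity, the right side by \<open>chain_sum_slide\<close>. They agree at the empty
shape, where the sign of the stair is compensated by \<open>stair_exp\<close>.\<close>

theorem schur_poly_mult:
  assumes mu: "mu \<in> shapes" and nu: "nu \<in> shapes" "bounded_by n nu"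
  shows "schur_poly m mu * schur_poly m nu
    = (\<Sum>c\<in>chains n nu mu. signed (stair_exp n nu + chain_exp n c) (schur_poly m (c n)))"
proof -
  let ?G = "\<lambda>l. signed (stair_exp n nu) (schur_poly m l)"
  define D where "D mu = schur_poly m mu * schur_poly m nu - (\<Sum>c\<in>chains n nu mu. signed (chain_exp n c) (?G (c n)))" for mu
  have "D mu \<in> {0}"
    using mu
  proof (induction rule: pieri_induct[where s = q_exp and D = D and G = "{0}"])
    case zero
    have "stair n nu n = nu" using nu(2) by (auto simp: stair_def bounded_by_def)
    moreover have "chains n nu (\<lambda>_. 0) = {stair n nu}"
      using chain_from_zero[OF nu(1)] stair_chain[OF nu(1)] by blast
    ultimately show ?case by (simp add: D_def schur_poly_zero chain_exp_stair)
  next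
    case (step l k)
    then have l: "schur_poly m l * schur_poly m nu = (\<Sum>c\<in>chains n nu l. signed (chain_exp n c) (?G (c n)))"
      by (simp add: D_def)
    have cs: "c n \<in> shapes" if "c \<in> chains n nu l" for c
      using chains_shapes[OF that step(1)] by simp
    have "(\<Sum>rho\<in>up k l. signed (q_exp l rho) (schur_poly m rho * schur_poly m nu)) = complete_poly m k * (schur_poly m l * schur_poly m nu)"
      unfolding mult.assoc[symmetric] pieri_left[OF step(1)] by (simp add: sum_distrib_right)
    also have "\<dots> = (\<Sum>c\<in>chains n nu l. signed (chain_exp n c + stair_exp n nu) (complete_poly m k * schur_poly m (c n)))"
      unfolding l by (simp add: sum_distrib_left)
    also have "\<dots> = (\<Sum>c\<in>chains n nu l. \<Sum>ta\<in>up k (c n). signed (chain_exp n c + q_exp (c n) ta) (?G ta))"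
      by (rule sum.cong[OF refl]) (simp add: pieri_left[OF cs] signed_sum add_ac)
    also have "\<dots> = (\<Sum>rho\<in>up k l. \<Sum>c\<in>chains n nu rho. signed (q_exp l rho + chain_exp n c) (?G (c n)))"
      by (rule chain_sum_slide[OF step(1)])
    also have "\<dots> = (\<Sum>rho\<in>up k l. signed (q_exp l rho) (\<Sum>c\<in>chains n nu rho. signed (chain_exp n c) (?G (c n))))"
      by (simp add: signed_sum add_ac)
    finally show ?case unfolding D_def by (simp add: signed_diff sum_subtractf)
  qed auto
  then show ?thesis by (simp add: D_def add.commute)
qed

lemma schur_poly_generated:
  assumes "l \<in> shapes" "1 \<in> G" "\<And>x y. x \<in> G \<Longrightarrow> y \<in> G \<Longrightarrow> x + y \<in> G" "\<And>x. x \<in> G \<Longrightarrow> - x \<in> G"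
    "\<And>x k. x \<in> G \<Longrightarrow> x * complete_poly m k \<in> G"
  shows "schur_poly m l \<in> G"
proof -
  have "1 + - 1 \<in> G" using assms(2,3,4) by blast
  then have z: "0 \<in> G" by simp
  show ?thesis
    using assms(1)
  proof (induction rule: pieri_induct[where s = p_exp and D = "schur_poly m" and G = G])
    case (step l j)
    then show ?case using assms(5)[of "schur_poly m l" j] by (simp add: pieri_right)
  qed (use assms z in \<open>auto simp: schur_poly_zero\<close>)
qed

end

section \<open>Linear independence of the odd Schur polynomials\<close>

definition tail :: "(nat \<Rightarrow> int) \<Rightarrow> nat \<Rightarrow> int" where
  "tail l i = l (Suc i)"

lemma tail_dn: "l \<in> shapes \<Longrightarrow> tail l \<in> dn l"
  using shapes_antimono[of l] by (auto simp: dn_def hstrip_def tail_def)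

lemma psum_tail: "psum (tail l) n = psum l (Suc n) - l 0"
  by (induction n) (simp_all add: tail_def)

lemma total_tail:
  assumes "l \<in> shapes" shows "total l - total (tail l) = l 0"
proof -
  obtain n where n: "bounded_by n l" using assms shapes_bounded by blast
  then have "bounded_by n (tail l)" "bounded_by (Suc n) l" by (auto simp: bounded_by_def tail_def)
  then show ?thesis by (simp only: total_eq psum_tail)
qed

text \<open>The largest power of the last variable in the Schur polynomial of \<open>l\<close> is \<open>l 0\<close>, and it is attained
only by removing the strip that leaves \<open>tail l\<close>.\<close>

lemma dn_maximal:
  assumes l: "l \<in> shapes" and eta: "eta \<in> dn l"
  shows "total l - total eta \<le> l 0" and "total l - total eta = l 0 \<Longrightarrow> eta = tail l"
proof -
  obtain n where n: "bounded_by n l" using l shapes_bounded by blast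
  have h: "hstrip eta l" using eta by (simp add: dn_def)
  have be: "bounded_by n eta" by (rule hstrip_bounded_down[OF h l n])
  have bt: "bounded_by n (tail l)" using n by (auto simp: bounded_by_def tail_def)
  have ge: "tail l i \<le> eta i" for i using h by (simp add: hstrip_def tail_def)
  have "psum (tail l) n \<le> psum eta n" unfolding psum_def by (rule sum_mono) (rule ge)
  then show "total l - total eta \<le> l 0" using total_tail[OF l] by (simp add: total_eq[OF be] total_eq[OF bt])
  assume "total l - total eta = l 0"
  then have "psum eta n = psum (tail l) n" using total_tail[OF l] by (simp add: total_eq[OF be] total_eq[OF bt])
  then have "(\<Sum>i<n. eta i - tail l i) = 0" by (simp add: psum_def sum_subtractf)
  then have "eta i = tail l i" if "i < n" for i
    using that ge by (subst (asm) sum_nonneg_eq_0_iff) auto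
  then have "eta i = tail l i" for i
    using be bt by (cases "i < n") (auto simp: bounded_by_def)
  then show "eta = tail l" by (rule ext)
qed

text \<open>Coefficient functionals, axiomatised by how they interact with right multiplication by a variable.
The scalars \<open>cs\<close> stand for the signs of moving a variable past a monomial.\<close>

locale anticommuting_coef = anticommuting X for X :: "nat \<Rightarrow> 'a::ring_1" +
  fixes coef :: "nat multiset \<Rightarrow> 'a \<Rightarrow> rat" and cs :: "nat \<Rightarrow> nat multiset \<Rightarrow> rat"
  assumes coef_add: "coef c (x + y) = coef c x + coef c y"
    and coef_1: "coef c 1 = (if c = {#} then 1 else 0)"
    and coef_X: "coef c (x * X i) = (if i \<in># c then cs i c * coef (c - {#i#}) x else 0)"
    and cs_nonzero: "cs i c \<noteq> 0"
begin

lemma coef_0: "coef c 0 = 0"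
  using coef_add[of c 0 0] by simp

lemma coef_neg: "coef c (- x) = - coef c x"
  using coef_add[of c x "- x"] by (simp add: coef_0)

lemma coef_signed: "coef c (signed k x) = signed k (coef c x)"
  by (simp add: signed_def coef_neg)

lemma coef_sum: "coef c (sum f A) = (\<Sum>a\<in>A. coef c (f a))"
  by (induction A rule: infinite_finite_induct) (simp_all add: coef_0 coef_add)

lemma coef_pow: "\<exists>s. s \<noteq> 0 \<and> (\<forall>x. coef (c + replicate_mset e i) (x * X i ^ e) = s * coef c x)"
proof (induction e)
  case 0
  show ?case by (intro exI[of _ 1]) simp
next
  case (Suc e)
  then obtain s where s: "s \<noteq> 0" "\<And>x. coef (c + replicate_mset e i) (x * X i ^ e) = s * coef c x" by blast
  have "coef (c + replicate_mset (Suc e) i) (x * X i ^ Suc e)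
      = cs i (c + replicate_mset (Suc e) i) * s * coef c x" for x
    unfolding power_Suc2 mult.assoc[symmetric] coef_X using s(2)[of x] by (simp add: mult.assoc)
  then show ?case using s(1) cs_nonzero
    by (intro exI[of _ "cs i (c + replicate_mset (Suc e) i) * s"]) (simp del: power_Suc)
qed

lemma coef_pow_zero: "i \<notin># c \<Longrightarrow> 0 < e \<Longrightarrow> coef c (x * X i ^ e) = 0"
  by (cases e) (simp_all add: power_Suc2 mult.assoc[symmetric] coef_X del: power_Suc)

lemma coef_schur_poly_high: "m < i \<Longrightarrow> i \<in># c \<Longrightarrow> coef c (schur_poly m l) = 0"
proof (induction m arbitrary: c l)
  case 0
  then show ?case by (auto simp: coef_1 coef_0)
next
  case (Suc m)
  have *: "coef c (schur_poly m eta * X (Suc m) ^ e) = 0" if "i \<in># c" for c eta e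
    using that
  proof (induction e arbitrary: c)
    case 0
    then show ?case using Suc.IH Suc.prems by simp
  next
    case (Suc e)
    have "coef (c - {#Suc m#}) (schur_poly m eta * X (Suc m) ^ e) = 0"
      using Suc.prems \<open>Suc m < i\<close> by (intro Suc.IH) (simp add: in_diff_count)
    then show ?case unfolding power_Suc2 mult.assoc[symmetric] coef_X by simp
  qed
  show ?case using *[OF Suc.prems(2)] by (simp add: coef_sum coef_signed)
qed

lemma coef_strip:
  assumes "Suc m \<notin># c"
  obtains s where "s \<noteq> 0" "\<And>eta e'. coef (c + replicate_mset e (Suc m)) (schur_poly m eta * X (Suc m) ^ e')
     = (if e' = e then s * coef c (schur_poly m eta) else 0)"
proof -
  obtain s where s: "s \<noteq> 0" "\<And>x. coef (c + replicate_mset e (Suc m)) (x * X (Suc m) ^ e) = s * coef c x"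
    using coef_pow[of c e "Suc m"] by blast
  have "coef (c + replicate_mset e (Suc m)) (schur_poly m eta * X (Suc m) ^ e') = 0" if ne: "e' \<noteq> e" for eta e'
  proof (cases "e' < e")
    case True
    obtain s' where s': "\<And>x. coef ((c + replicate_mset (e - e') (Suc m)) + replicate_mset e' (Suc m)) (x * X (Suc m) ^ e')
        = s' * coef (c + replicate_mset (e - e') (Suc m)) x"
      using coef_pow[of "c + replicate_mset (e - e') (Suc m)" e' "Suc m"] by blast
    have "(c + replicate_mset (e - e') (Suc m)) + replicate_mset e' (Suc m) = c + replicate_mset e (Suc m)"
      using True by (simp add: multiset_eq_iff)
    moreover have "coef (c + replicate_mset (e - e') (Suc m)) (schur_poly m eta) = 0"
      by (rule coef_schur_poly_high[of m "Suc m"]) (use True in auto)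
    ultimately show ?thesis using s'[of "schur_poly m eta"] by (simp only: mult_zero_right)
  next
    case False
    then have e': "e < e'" using ne by simp
    obtain s' where s': "\<And>x. coef (c + replicate_mset e (Suc m)) (x * X (Suc m) ^ e) = s' * coef c x"
      using coef_pow[of c e "Suc m"] by blast
    have "schur_poly m eta * X (Suc m) ^ e' = (schur_poly m eta * X (Suc m) ^ (e' - e)) * X (Suc m) ^ e"
      using e' by (simp add: mult.assoc flip: power_add)
    then show ?thesis using s' coef_pow_zero[OF assms, of "e' - e"] e' by simp
  qed
  with s show ?thesis using that by simp
qed

lemma coef_schur_poly_Suc:
  assumes "Suc m \<notin># c"
  obtains s where "s \<noteq> 0" "\<And>l. l \<in> shapes \<Longrightarrow> l 0 = int e \<Longrightarrow>
      coef (c + replicate_mset e (Suc m)) (schur_poly (Suc m) l) = s * signed (b_exp (tail l) l) (coef c (schur_poly m (tail l)))"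
    "\<And>l. l \<in> shapes \<Longrightarrow> l 0 < int e \<Longrightarrow> coef (c + replicate_mset e (Suc m)) (schur_poly (Suc m) l) = 0"
proof -
  obtain s where s: "s \<noteq> 0" "\<And>eta e'. coef (c + replicate_mset e (Suc m)) (schur_poly m eta * X (Suc m) ^ e')
     = (if e' = e then s * coef c (schur_poly m eta) else 0)" using coef_strip[OF assms, of e] by blast
  have sum: "coef (c + replicate_mset e (Suc m)) (schur_poly (Suc m) l)
      = (\<Sum>eta\<in>dn l. signed (b_exp eta l) (if nat (total l - total eta) = e then s * coef c (schur_poly m eta) else 0))" for l
    by (simp add: coef_sum coef_signed s(2))
  show ?thesis
  proof (rule that[OF s(1)])
    fix l assume l: "l \<in> shapes" "l 0 = int e"
    have fin: "finite (dn l)" by (rule finite_dn[OF l(1)])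
    have "(\<Sum>eta\<in>dn l. signed (b_exp eta l) (if nat (total l - total eta) = e then s * coef c (schur_poly m eta) else 0))
        = (\<Sum>eta\<in>dn l. if eta = tail l then s * signed (b_exp (tail l) l) (coef c (schur_poly m (tail l))) else 0)"
    proof (rule sum.cong[OF refl])
      fix eta assume eta: "eta \<in> dn l"
      have es: "eta \<in> shapes" using eta l(1) by (rule dn_shapes)
      have "total eta \<le> total l" using eta by (auto simp: dn_def intro: total_mono[OF es])
      then have "nat (total l - total eta) = e \<longleftrightarrow> total l - total eta = l 0" using l(2) by auto
      also have "\<dots> \<longleftrightarrow> eta = tail l" using dn_maximal(2)[OF l(1) eta] total_tail[OF l(1)] by auto
      finally show "signed (b_exp eta l) (if nat (total l - total eta) = e then s * coef c (schur_poly m eta) else 0)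
        = (if eta = tail l then s * signed (b_exp (tail l) l) (coef c (schur_poly m (tail l))) else 0)"
        by simp
    qed
    also have "\<dots> = s * signed (b_exp (tail l) l) (coef c (schur_poly m (tail l)))"
      using fin tail_dn[OF l(1)] by simp
    finally show "coef (c + replicate_mset e (Suc m)) (schur_poly (Suc m) l)
        = s * signed (b_exp (tail l) l) (coef c (schur_poly m (tail l)))" unfolding sum .
  next
    fix l assume l: "l \<in> shapes" "l 0 < int e"
    have "nat (total l - total eta) \<noteq> e" if "eta \<in> dn l" for eta
      using dn_maximal(1)[OF l(1) that] l(2) shapes_nonneg[OF l(1), of 0] by linarith
    then show "coef (c + replicate_mset e (Suc m)) (schur_poly (Suc m) l) = 0"
      unfolding sum by (intro sum.neutral) simp
  qed
qed

text \<open>Among the shapes with nonzero coefficient let \<open>e\<close> be the largest top row. Extracting \<open>X\<^sub>m\<^sub>+\<^sub>1\<^sup>e\<close> kills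
the shapes with a smaller top row and turns the others into their tails in one variable less, and a shape
is determined by its top row and its tail.\<close>

theorem schur_poly_independent:
  assumes "finite S" "\<And>l. l \<in> S \<Longrightarrow> l \<in> shapes \<and> bounded_by m l"
    "\<And>c. (\<Sum>l\<in>S. a l * coef c (schur_poly m l)) = 0" "l \<in> S"
  shows "a l = 0"
  using assms
proof (induction m arbitrary: S a l)
  case 0
  have z: "x = (\<lambda>_. 0)" if "x \<in> S" for x using 0(2)[OF that] by (auto simp: bounded_by_def)
  with 0(4) have "S = {\<lambda>_. 0}" "l = (\<lambda>_. 0)" by blast+
  then show ?case using "0.prems"(3)[of "{#}"] by (simp add: coef_1)
next
  case (Suc m)
  define T where "T = {l \<in> S. a l \<noteq> 0}"
  have T: "finite T" "\<And>l. l \<in> T \<Longrightarrow> l \<in> shapes \<and> bounded_by (Suc m) l \<and> a l \<noteq> 0"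
    using Suc.prems by (auto simp: T_def)
  have Tsum: "(\<Sum>l\<in>T. a l * coef c (schur_poly (Suc m) l)) = 0" for c
    unfolding Suc.prems(3)[of c, symmetric] T_def
    by (rule sum.mono_neutral_left) (use Suc.prems in auto)
  have "T = {}"
  proof (rule ccontr)
    assume "T \<noteq> {}"
    define e where "e = Max ((\<lambda>l. nat (l 0)) ` T)"
    have "e \<in> (\<lambda>l. nat (l 0)) ` T" unfolding e_def using T(1) \<open>T \<noteq> {}\<close> by (intro Max_in) auto
    then obtain l1 where l1: "l1 \<in> T" "nat (l1 0) = e" by auto
    have le: "l 0 \<le> int e" if "l \<in> T" for l
    proof -
      have "nat (l 0) \<le> e" unfolding e_def using T(1) that by (intro Max_ge) auto
      then show ?thesis by simp
    qed
    define T' where "T' = {l \<in> T. l 0 = int e}"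
    have T': "finite T'" "T' \<subseteq> T" using T(1) by (auto simp: T'_def)
    have l1T: "l1 \<in> T'" using l1 T(2)[OF l1(1)] shapes_nonneg[of l1 0] by (auto simp: T'_def)
    have inj: "inj_on tail T'"
    proof (rule inj_onI)
      fix x y assume xy: "x \<in> T'" "y \<in> T'" "tail x = tail y"
      have "x i = y i" for i
        using xy(1,2) fun_cong[OF xy(3), of "i - 1"] by (cases i) (simp_all add: T'_def tail_def)
      then show "x = y" by (rule ext)
    qed
    define untail where "untail = the_inv_into T' tail"
    have untail: "untail (tail l) = l" if "l \<in> T'" for l
      unfolding untail_def using inj that by (rule the_inv_into_f_f)
    define a' where "a' l' = signed (b_exp l' (untail l')) (a (untail l'))" for l'
    have "(\<Sum>l'\<in>tail ` T'. a' l' * coef c (schur_poly m l')) = 0" for c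
    proof (cases "Suc m \<in># c")
      case True
      then show ?thesis by (simp add: coef_schur_poly_high[of m "Suc m"])
    next
      case False
      obtain s where s: "s \<noteq> 0" "\<And>l. l \<in> shapes \<Longrightarrow> l 0 = int e \<Longrightarrow>
          coef (c + replicate_mset e (Suc m)) (schur_poly (Suc m) l) = s * signed (b_exp (tail l) l) (coef c (schur_poly m (tail l)))"
        "\<And>l. l \<in> shapes \<Longrightarrow> l 0 < int e \<Longrightarrow> coef (c + replicate_mset e (Suc m)) (schur_poly (Suc m) l) = 0"
        using coef_schur_poly_Suc[OF False, of e] by blast
      let ?c = "c + replicate_mset e (Suc m)"
      have "0 = (\<Sum>l\<in>T. a l * coef ?c (schur_poly (Suc m) l))" by (rule Tsum[symmetric])
      also have "\<dots> = (\<Sum>l\<in>T'. a l * coef ?c (schur_poly (Suc m) l))"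
      proof (rule sum.mono_neutral_right[OF T(1) T'(2)], intro ballI)
        fix l assume l: "l \<in> T - T'"
        then have "l 0 < int e" using le[of l] by (auto simp: T'_def)
        then show "a l * coef ?c (schur_poly (Suc m) l) = 0" using s(3)[of l] T(2)[of l] l by simp
      qed
      also have "\<dots> = (\<Sum>l\<in>T'. s * (a' (tail l) * coef c (schur_poly m (tail l))))"
      proof (rule sum.cong[OF refl])
        fix l assume l: "l \<in> T'"
        have e: "coef ?c (schur_poly (Suc m) l) = s * signed (b_exp (tail l) l) (coef c (schur_poly m (tail l)))"
          by (rule s(2)) (use l T(2) in \<open>auto simp: T'_def\<close>)
        show "a l * coef ?c (schur_poly (Suc m) l) = s * (a' (tail l) * coef c (schur_poly m (tail l)))"
          unfolding e a'_def untail[OF l] by (simp add: mult.left_commute)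
      qed
      also have "\<dots> = s * (\<Sum>l'\<in>tail ` T'. a' l' * coef c (schur_poly m l'))"
        by (simp add: sum_distrib_left sum.reindex[OF inj])
      finally show ?thesis using s(1) by simp
    qed
    moreover have "l' \<in> shapes \<and> bounded_by m l'" if l': "l' \<in> tail ` T'" for l'
    proof -
      from l' obtain l where l: "l \<in> T'" "l' = tail l" by blast
      then have "l \<in> shapes" "bounded_by (Suc m) l" using T(2) T'(2) by auto
      then show ?thesis using tail_dn[of l] dn_shapes[of "tail l" l] l(2)
        by (simp add: bounded_by_def tail_def)
    qed
    ultimately have "a' (tail l1) = 0"
      using Suc.IH[of "tail ` T'" a' "tail l1"] T'(1) l1T by blast
    then have "a l1 = 0" unfolding a'_def untail[OF l1T] by (simp add: signed_def split: if_splits)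
    then show False using T(2)[OF l1(1)] by simp
  qed
  then show ?case using Suc.prems(4) by (auto simp: T_def)
qed

end

section \<open>Tableaux and words\<close>

definition cells :: "(nat \<Rightarrow> int) \<Rightarrow> (nat \<times> nat) set" where
  "cells l = {(r, c). 1 \<le> r \<and> 1 \<le> c \<and> int c \<le> l (r - 1)}"

definition tableaux :: "nat \<Rightarrow> (nat \<Rightarrow> int) \<Rightarrow> (nat \<Rightarrow> nat \<Rightarrow> nat) set" where
  "tableaux m l = {T.
     (\<forall>r c. (r, c) \<in> cells l \<longrightarrow> 1 \<le> T r c \<and> T r c \<le> m) \<and>
     (\<forall>r c. (r, c) \<notin> cells l \<longrightarrow> T r c = 0) \<and>
     (\<forall>r c c'. (r, c) \<in> cells l \<and> (r, c') \<in> cells l \<and> c < c' \<longrightarrow> T r c \<le> T r c') \<and>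
     (\<forall>r r' c. (r, c) \<in> cells l \<and> (r', c) \<in> cells l \<and> r < r' \<longrightarrow> T r c < T r' c)}"

text \<open>The reading word of the first \<open>R\<close> rows, which lists row \<open>R\<close> first.\<close>

primrec reading_word :: "nat \<Rightarrow> (nat \<Rightarrow> int) \<Rightarrow> (nat \<Rightarrow> nat \<Rightarrow> nat) \<Rightarrow> nat list" where
  "reading_word 0 l T = []"
| "reading_word (Suc R) l T = map (T (Suc R)) [1..<Suc (nat (l R))] @ reading_word R l T"

text \<open>A tableau with entries up to \<open>m + 1\<close> is the tableau of its entries up to \<open>m\<close>, whose shape is given by
\<open>inner\<close>, surrounded by a horizontal strip filled with \<open>m + 1\<close>.\<close>

definition add_strip :: "nat \<Rightarrow> (nat \<Rightarrow> int) \<Rightarrow> (nat \<Rightarrow> int) \<Rightarrow> (nat \<Rightarrow> nat \<Rightarrow> nat) \<Rightarrow> nat \<Rightarrow> nat \<Rightarrow> nat" where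
  "add_strip m l eta T r c = (if (r, c) \<in> cells l - cells eta then Suc m else T r c)"

definition inner :: "nat \<Rightarrow> (nat \<Rightarrow> int) \<Rightarrow> (nat \<Rightarrow> nat \<Rightarrow> nat) \<Rightarrow> nat \<Rightarrow> int" where
  "inner m l T i = int (card {c. (Suc i, c) \<in> cells l \<and> T (Suc i) c \<le> m})"

definition restrict_tab :: "(nat \<Rightarrow> int) \<Rightarrow> (nat \<Rightarrow> nat \<Rightarrow> nat) \<Rightarrow> nat \<Rightarrow> nat \<Rightarrow> nat" where
  "restrict_tab eta T r c = (if (r, c) \<in> cells eta then T r c else 0)"

lemma initial_segment:
  assumes "finite A" "\<And>c. c \<in> A \<Longrightarrow> 1 \<le> c" "\<And>c c'. c \<in> A \<Longrightarrow> 1 \<le> c' \<Longrightarrow> c' \<le> c \<Longrightarrow> c' \<in> A"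
  shows "A = {1..card A}"
proof (cases "A = {}")
  case False
  have "A = {1..Max A}"
  proof (intro equalityI subsetI)
    fix x assume "x \<in> A"
    then show "x \<in> {1..Max A}" using assms(1,2) by simp
  next
    fix x assume "x \<in> {1..Max A}"
    then show "x \<in> A" using assms(3)[OF Max_in[OF assms(1) False], of x] by simp
  qed
  then show ?thesis by (metis card_atLeastAtMost diff_Suc_1)
qed simp

lemma tableaux_inner:
  assumes l: "l \<in> shapes" and T: "T \<in> tableaux (Suc m) l"
  shows "(Suc i, c) \<in> cells l \<Longrightarrow> T (Suc i) c \<le> m \<longleftrightarrow> int c \<le> inner m l T i"
    and "inner m l T \<in> dn l"
    and "cells (inner m l T) = {(r, c) \<in> cells l. T r c \<le> m}"
proof -
  have ent: "1 \<le> T r c" "T r c \<le> Suc m" if "(r, c) \<in> cells l" for r c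
    using T that by (auto simp: tableaux_def)
  have row: "T r c \<le> T r c'" if "(r, c) \<in> cells l" "(r, c') \<in> cells l" "c \<le> c'" for r c c'
    using T that by (cases "c = c'") (auto simp: tableaux_def)
  have col: "T r c < T r' c" if "(r, c) \<in> cells l" "(r', c) \<in> cells l" "r < r'" for r r' c
    using T that by (auto simp: tableaux_def)
  define A where "A i = {c. (Suc i, c) \<in> cells l \<and> T (Suc i) c \<le> m}" for i
  have A: "A i = {1..card (A i)}" for i
  proof (rule initial_segment)
    show "finite (A i)" by (rule finite_subset[of _ "{..nat (l i)}"]) (auto simp: A_def cells_def)
    show "1 \<le> c" if "c \<in> A i" for c using that by (auto simp: A_def cells_def)
    show "c' \<in> A i" if "c \<in> A i" "1 \<le> c'" "c' \<le> c" for c c'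
    proof -
      have c: "(Suc i, c) \<in> cells l" "T (Suc i) c \<le> m" using that by (auto simp: A_def)
      then have c': "(Suc i, c') \<in> cells l" using that by (auto simp: cells_def)
      then have "T (Suc i) c' \<le> m" using row[OF c' c(1) that(3)] c(2) by simp
      with c' show ?thesis by (simp add: A_def)
    qed
  qed
  have inner: "inner m l T i = int (card (A i))" for i by (simp add: inner_def A_def)
  have mem: "c \<in> A i \<longleftrightarrow> 1 \<le> c \<and> int c \<le> inner m l T i" for c i
    using A[of i] inner[of i] by (metis atLeastAtMost_iff of_nat_le_iff)
  show key: "T (Suc i) c \<le> m \<longleftrightarrow> int c \<le> inner m l T i" if "(Suc i, c) \<in> cells l" for i c
  proof -
    have "c \<in> A i \<longleftrightarrow> T (Suc i) c \<le> m" using that by (simp add: A_def)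
    moreover have "1 \<le> c" using that by (simp add: cells_def)
    ultimately show ?thesis using mem[of c i] by blast
  qed
  have le: "inner m l T i \<le> l i" for i
  proof (cases "inner m l T i = 0")
    case True
    then show ?thesis using shapes_nonneg[OF l] by simp
  next
    case False
    then have "card (A i) \<in> A i" using mem[of "card (A i)" i] inner[of i] by simp
    then show ?thesis by (simp add: A_def cells_def inner)
  qed
  have ge: "l (Suc i) \<le> inner m l T i" for i
  proof (cases "l (Suc i) \<le> 0")
    case True
    then show ?thesis using inner[of i] by simp
  next
    case False
    define c where "c = nat (l (Suc i))"
    have c: "1 \<le> c" "int c = l (Suc i)" using False by (auto simp: c_def)
    have c1: "(Suc (Suc i), c) \<in> cells l" using c by (simp add: cells_def)
    have c0: "(Suc i, c) \<in> cells l" using c shapes_antimono[OF l, of i "Suc i"] by (simp add: cells_def)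
    have "T (Suc i) c \<le> m" using col[OF c0 c1] ent(2)[OF c1] by simp
    then show ?thesis using key[OF c0] c by simp
  qed
  show "inner m l T \<in> dn l" using le ge by (simp add: dn_def hstrip_def)
  show "cells (inner m l T) = {(r, c) \<in> cells l. T r c \<le> m}"
  proof (intro equalityI subsetI)
    fix x assume x: "x \<in> cells (inner m l T)"
    obtain r c where rc: "x = (r, c)" by (cases x)
    then obtain i where r: "r = Suc i" using x by (cases r) (auto simp: cells_def)
    have "c \<in> A i" using x rc r mem[of c i] by (simp add: cells_def)
    then show "x \<in> {(r, c) \<in> cells l. T r c \<le> m}" using rc r by (simp add: A_def)
  next
    fix x assume x: "x \<in> {(r, c) \<in> cells l. T r c \<le> m}"
    obtain r c where rc: "x = (r, c)" by (cases x)
    then obtain i where r: "r = Suc i" using x by (cases r) (auto simp: cells_def)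
    have "c \<in> A i" using x rc r by (simp add: A_def)
    then show "x \<in> cells (inner m l T)" using mem[of c i] rc r by (simp add: cells_def)
  qed
qed

lemma cells_strip:
  assumes h: "hstrip eta l" and eta: "eta \<in> shapes"
  shows "cells eta \<subseteq> cells l"
    and "(r', c) \<in> cells l \<Longrightarrow> r < r' \<Longrightarrow> 1 \<le> r \<Longrightarrow> (r, c) \<in> cells eta"
proof -
  have "eta i \<le> l i" for i using h by (simp add: hstrip_def)
  then show "cells eta \<subseteq> cells l" by (force simp: cells_def intro: order_trans)
  assume a: "(r', c) \<in> cells l" "r < r'" "1 \<le> r"
  then obtain i j where ij: "r' = Suc (Suc j)" "r = Suc i" "i \<le> j"
    by (cases r'; cases r; cases "r' - 1") auto
  have "int c \<le> l (Suc j)" using a(1) ij by (simp add: cells_def)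
  also have "\<dots> \<le> eta j" using h by (simp add: hstrip_def)
  also have "\<dots> \<le> eta i" using eta ij(3) by (rule shapes_antimono)
  finally show "(r, c) \<in> cells eta" using a ij by (simp add: cells_def)
qed

lemma cells_eqD:
  assumes "cells a = cells b" "\<And>i. 0 \<le> a i" "\<And>i. 0 \<le> b i" shows "a = b"
proof (rule ext, rule ccontr)
  fix i assume ne: "a i \<noteq> b i"
  define c where "c = nat (max (a i) (b i))"
  have "(Suc i, c) \<in> cells a \<longleftrightarrow> 1 \<le> c \<and> int c \<le> a i" "(Suc i, c) \<in> cells b \<longleftrightarrow> 1 \<le> c \<and> int c \<le> b i"
    by (simp_all add: cells_def)
  moreover have "1 \<le> c" "int c = max (a i) (b i)" using ne assms(2)[of i] assms(3)[of i] by (auto simp: c_def)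
  ultimately show False using ne assms(1) by (auto simp: max_def split: if_splits)
qed

lemma restrict_tab_tableaux:
  assumes l: "l \<in> shapes" and T: "T \<in> tableaux (Suc m) l"
  shows "restrict_tab (inner m l T) T \<in> tableaux m (inner m l T)"
proof -
  have c: "cells (inner m l T) = {(r, c) \<in> cells l. T r c \<le> m}" by (rule tableaux_inner(3)[OF l T])
  have sub: "(r, c) \<in> cells l" "T r c \<le> m" if "(r, c) \<in> cells (inner m l T)" for r c
    using that unfolding c by simp_all
  show ?thesis
    unfolding tableaux_def
  proof (intro CollectI conjI allI impI)
    fix r c assume rc: "(r, c) \<in> cells (inner m l T)"
    show "1 \<le> restrict_tab (inner m l T) T r c" "restrict_tab (inner m l T) T r c \<le> m"
      using T sub[OF rc] rc by (simp_all add: restrict_tab_def tableaux_def)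
  next
    fix r c c' assume a: "(r, c) \<in> cells (inner m l T) \<and> (r, c') \<in> cells (inner m l T) \<and> c < c'"
    then have "T r c \<le> T r c'" using T sub[of r c] sub[of r c'] unfolding tableaux_def by blast
    then show "restrict_tab (inner m l T) T r c \<le> restrict_tab (inner m l T) T r c'"
      using a by (simp add: restrict_tab_def)
  next
    fix r r' c assume a: "(r, c) \<in> cells (inner m l T) \<and> (r', c) \<in> cells (inner m l T) \<and> r < r'"
    then have "T r c < T r' c" using T sub[of r c] sub[of r' c] unfolding tableaux_def by blast
    then show "restrict_tab (inner m l T) T r c < restrict_tab (inner m l T) T r' c"
      using a by (simp add: restrict_tab_def)
  qed (simp add: restrict_tab_def)
qed

lemma add_strip_tableaux:
  assumes l: "l \<in> shapes" and eta: "eta \<in> dn l" and T: "T \<in> tableaux m eta"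
  shows "add_strip m l eta T \<in> tableaux (Suc m) l" "inner m l (add_strip m l eta T) = eta"
    "restrict_tab eta (add_strip m l eta T) = T"
proof -
  have h: "hstrip eta l" using eta by (simp add: dn_def)
  have es: "eta \<in> shapes" by (rule dn_shapes[OF eta l])
  have sub: "cells eta \<subseteq> cells l" by (rule cells_strip(1)[OF h es])
  have ent: "1 \<le> T r c" "T r c \<le> m" if "(r, c) \<in> cells eta" for r c
    using T that by (auto simp: tableaux_def)
  have out: "T r c = 0" if "(r, c) \<notin> cells eta" for r c using T that by (simp add: tableaux_def)
  have row: "T r c \<le> T r c'" if "(r, c) \<in> cells eta" "(r, c') \<in> cells eta" "c < c'" for r c c'
    using T that by (auto simp: tableaux_def)
  have col: "T r c < T r' c" if "(r, c) \<in> cells eta" "(r', c) \<in> cells eta" "r < r'" for r r' c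
    using T that by (auto simp: tableaux_def)
  let ?U = "add_strip m l eta T"
  have U1: "?U r c = T r c" if "(r, c) \<in> cells eta" for r c using that by (simp add: add_strip_def)
  have U2: "?U r c = Suc m" if "(r, c) \<in> cells l" "(r, c) \<notin> cells eta" for r c
    using that by (simp add: add_strip_def)
  have U3: "?U r c \<le> Suc m" for r c
    using ent(2)[of r c] out[of r c] by (cases "(r, c) \<in> cells eta") (auto simp: add_strip_def)
  show tab: "?U \<in> tableaux (Suc m) l"
    unfolding tableaux_def
  proof (intro CollectI conjI allI impI)
    fix r c assume rc: "(r, c) \<in> cells l"
    show "1 \<le> ?U r c" using ent(1)[of r c] U1 U2[OF rc] by (cases "(r, c) \<in> cells eta") auto
    show "?U r c \<le> Suc m" by (rule U3)
  next
    fix r c assume "(r, c) \<notin> cells l"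
    then show "?U r c = 0" using sub out[of r c] by (auto simp: add_strip_def)
  next
    fix r c c' assume a: "(r, c) \<in> cells l \<and> (r, c') \<in> cells l \<and> c < c'"
    show "?U r c \<le> ?U r c'"
    proof (cases "(r, c') \<in> cells eta")
      case True
      then have "(r, c) \<in> cells eta" using a by (auto simp: cells_def)
      with True show ?thesis using row a U1 by simp
    next
      case False
      then show ?thesis using U2 U3 a by simp
    qed
  next
    fix r r' c assume a: "(r, c) \<in> cells l \<and> (r', c) \<in> cells l \<and> r < r'"
    moreover from a have "1 \<le> r" by (simp add: cells_def)
    ultimately have rc: "(r, c) \<in> cells eta" using cells_strip(2)[OF h es] by blast
    show "?U r c < ?U r' c"
    proof (cases "(r', c) \<in> cells eta")
      case True
      then show ?thesis using rc col a U1 by simp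
    next
      case False
      then show ?thesis using U2[of r' c] U1[OF rc] ent(2)[OF rc] a by simp
    qed
  qed
  have "cells (inner m l ?U) = cells eta"
    unfolding tableaux_inner(3)[OF l tab]
  proof (intro equalityI subsetI)
    fix x assume x: "x \<in> {(r, c) \<in> cells l. ?U r c \<le> m}"
    obtain r c where rc: "x = (r, c)" by (cases x)
    then show "x \<in> cells eta" using x U2[of r c] by (cases "(r, c) \<in> cells eta") auto
  next
    fix x assume x: "x \<in> cells eta"
    obtain r c where rc: "x = (r, c)" by (cases x)
    then show "x \<in> {(r, c) \<in> cells l. ?U r c \<le> m}" using x sub U1[of r c] ent(2)[of r c] by auto
  qed
  then show "inner m l ?U = eta"
    by (rule cells_eqD) (simp_all add: inner_def shapes_nonneg[OF es])
  show "restrict_tab eta ?U = T"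
    by (intro ext) (simp add: restrict_tab_def U1 out)
qed

lemma add_restrict:
  assumes l: "l \<in> shapes" and T: "T \<in> tableaux (Suc m) l"
  shows "add_strip m l (inner m l T) (restrict_tab (inner m l T) T) = T"
proof (intro ext)
  fix r c
  have c: "cells (inner m l T) = {(r, c) \<in> cells l. T r c \<le> m}" by (rule tableaux_inner(3)[OF l T])
  have "(r, c) \<in> cells l \<Longrightarrow> T r c \<le> Suc m" "(r, c) \<notin> cells l \<Longrightarrow> T r c = 0"
    using T by (auto simp: tableaux_def)
  then show "add_strip m l (inner m l T) (restrict_tab (inner m l T) T) r c = T r c"
    by (auto simp: add_strip_def restrict_tab_def c)
qed

lemma finite_tableaux: "l \<in> shapes \<Longrightarrow> finite (tableaux m l)"
proof (induction m arbitrary: l)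
  case 0
  have "tableaux 0 l \<subseteq> {\<lambda>_ _. 0}"
  proof
    fix T assume "T \<in> tableaux 0 l"
    then have "T r c = 0" for r c by (cases "(r, c) \<in> cells l") (auto simp: tableaux_def)
    then show "T \<in> {\<lambda>_ _. 0}" by auto
  qed
  then show ?case by (rule finite_subset) simp
next
  case (Suc m)
  have "tableaux (Suc m) l \<subseteq> (\<lambda>(eta, T). add_strip m l eta T) ` (SIGMA eta:dn l. tableaux m eta)"
  proof
    fix T assume T: "T \<in> tableaux (Suc m) l"
    show "T \<in> (\<lambda>(eta, T). add_strip m l eta T) ` (SIGMA eta:dn l. tableaux m eta)"
      using add_restrict[OF Suc.prems T] restrict_tab_tableaux[OF Suc.prems T] tableaux_inner(2)[OF Suc.prems T]
      by (intro image_eqI[of _ _ "(inner m l T, restrict_tab (inner m l T) T)"]) auto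
  qed
  moreover have "finite (SIGMA eta:dn l. tableaux m eta)"
    by (rule finite_SigmaI[OF finite_dn[OF Suc.prems]]) (rule Suc.IH, rule dn_shapes[OF _ Suc.prems])
  ultimately show ?case by (blast intro: finite_subset finite_imageI)
qed

lemma row_add_strip:
  assumes "eta R \<le> l R" "0 \<le> eta R"
  shows "map (add_strip m l eta T (Suc R)) [1..<Suc (nat (l R))]
    = map (T (Suc R)) [1..<Suc (nat (eta R))] @ replicate (nat (l R - eta R)) (Suc m)"
proof -
  have n: "nat (l R) = nat (eta R) + nat (l R - eta R)" using assms by simp
  have s: "[1..<Suc (nat (l R))] = [1..<Suc (nat (eta R))] @ [Suc (nat (eta R))..<Suc (nat (l R))]"
    unfolding n using upt_add_eq_append[of 1 "Suc (nat (eta R))" "nat (l R - eta R)"]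
    by (simp del: upt_Suc)
  have 1: "map (add_strip m l eta T (Suc R)) [1..<Suc (nat (eta R))] = map (T (Suc R)) [1..<Suc (nat (eta R))]"
    by (rule map_cong[OF refl]) (auto simp: add_strip_def cells_def simp del: upt_Suc)
  have "map (add_strip m l eta T (Suc R)) [Suc (nat (eta R))..<Suc (nat (l R))]
      = map (\<lambda>_. Suc m) [Suc (nat (eta R))..<Suc (nat (l R))]"
    by (rule map_cong[OF refl]) (use assms in \<open>auto simp: add_strip_def cells_def simp del: upt_Suc\<close>)
  also have "\<dots> = replicate (nat (l R - eta R)) (Suc m)"
    using n by (simp add: map_replicate_const)
  finally show ?thesis unfolding s map_append 1 by simp
qed

lemma length_reading_word: "(\<And>i. 0 \<le> l i) \<Longrightarrow> int (length (reading_word R l T)) = psum l R"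
  by (induction R) (simp_all del: upt_Suc)

lemma set_reading_word: "T \<in> tableaux m l \<Longrightarrow> set (reading_word R l T) \<subseteq> {1..m}"
proof (induction R)
  case (Suc R)
  have "T (Suc R) c \<in> {1..m}" if "c \<in> set [1..<Suc (nat (l R))]" for c
  proof -
    have "(Suc R, c) \<in> cells l" using that by (auto simp: cells_def)
    then show ?thesis using Suc.prems by (auto simp: tableaux_def)
  qed
  then show ?case using Suc by (auto simp del: upt_Suc)
qed simp

definition sorted_words :: "nat \<Rightarrow> nat \<Rightarrow> nat list set" where
  "sorted_words m k = {w. length w = k \<and> set w \<subseteq> {1..m} \<and> sorted w}"

lemma finite_sorted_words: "finite (sorted_words m k)"
  by (rule finite_subset[OF _ finite_lists_length_eq[of "{1..m}" k]]) (auto simp: sorted_words_def)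

lemma sorted_split:
  "sorted w \<Longrightarrow> set w \<subseteq> {1..Suc m} \<Longrightarrow>
    w = filter (\<lambda>x. x \<noteq> Suc m) w @ replicate (length (filter (\<lambda>x. x = Suc m) w)) (Suc m)"
proof (induction w)
  case (Cons a w)
  show ?case
  proof (cases "a = Suc m")
    case True
    then have "\<forall>x\<in>set w. x = Suc m" using Cons.prems by fastforce
    then have "filter (\<lambda>x. x \<noteq> Suc m) w = []" by simp
    then show ?thesis using Cons True by auto
  qed (use Cons in auto)
qed simp

context anticommuting
begin

definition wprod :: "nat list \<Rightarrow> 'a" where
  "wprod w = prod_list (map X w)"

lemma wprod_simps [simp]: "wprod [] = 1" "wprod (i # w) = X i * wprod w" "wprod (u @ v) = wprod u * wprod v"
  "wprod (replicate e i) = X i ^ e"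
  by (simp_all add: wprod_def prod_list_replicate)

lemma X_wprod: "i \<notin> set w \<Longrightarrow> X i * wprod w = signed (int (length w)) (wprod w * X i)"
proof (induction w)
  case (Cons j w)
  have "X i * wprod (j # w) = - (X j * (X i * wprod w))"
    using Cons.prems anticomm[of i j] by (simp add: mult.assoc[symmetric])
  also have "\<dots> = signed (int (length (j # w))) (wprod (j # w) * X i)"
    using Cons by (simp add: signed_def mult.assoc)
  finally show ?case .
qed simp

text \<open>The letters \<open>m + 1\<close> stand at the end of each row of the reading word. Moving them to the very end, each
passes the smaller letters of all higher rows.\<close>

lemma wprod_add_strip:
  assumes h: "hstrip eta l" and eta: "eta \<in> shapes" and T: "T \<in> tableaux m eta"
  shows "wprod (reading_word R l (add_strip m l eta T))
    = signed (psum (\<lambda>r. psum eta r * (l r - eta r)) R)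
        (wprod (reading_word R eta T) * X (Suc m) ^ nat (psum l R - psum eta R))"
proof (induction R)
  case (Suc R)
  have le: "eta i \<le> l i" for i using h by (simp add: hstrip_def)
  define d where "d = nat (l R - eta R)"
  define e where "e = nat (psum l R - psum eta R)"
  define s where "s = psum (\<lambda>r. psum eta r * (l r - eta r)) R"
  define w where "w = reading_word R eta T"
  have "psum eta R \<le> psum l R" unfolding psum_def by (rule sum_mono) (rule le)
  then have de: "nat (psum l (Suc R) - psum eta (Suc R)) = d + e"
    using le[of R] by (simp add: d_def e_def)
  have "Suc m \<notin> set w" using set_reading_word[OF T, of R] unfolding w_def by auto
  then have "X (Suc m) ^ d * wprod w = signed (int d * int (length w)) (wprod w * X (Suc m) ^ d)"
    by (intro pow_comm X_wprod)
  also have "int d * int (length w) = psum eta R * (l R - eta R)"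
    using le[of R] by (simp add: d_def w_def length_reading_word shapes_nonneg[OF eta])
  finally have c: "X (Suc m) ^ d * wprod w = signed (psum eta R * (l R - eta R)) (wprod w * X (Suc m) ^ d)" .
  let ?a = "wprod (map (T (Suc R)) [1..<Suc (nat (eta R))])"
  have "wprod (reading_word (Suc R) l (add_strip m l eta T)) = ?a * X (Suc m) ^ d * signed s (wprod w * X (Suc m) ^ e)"
    unfolding reading_word.simps row_add_strip[of eta R l m T, OF le shapes_nonneg[OF eta]] wprod_simps Suc.IH
    by (simp add: d_def e_def s_def w_def del: upt_Suc)
  also have "\<dots> = signed s (?a * (X (Suc m) ^ d * wprod w) * X (Suc m) ^ e)"
    by (simp add: mult.assoc)
  also have "\<dots> = signed (s + psum eta R * (l R - eta R)) (?a * wprod w * X (Suc m) ^ (d + e))"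
    unfolding c by (simp add: mult.assoc power_add)
  finally show ?case unfolding de by (simp add: s_def w_def del: upt_Suc)
qed simp

theorem schur_poly_tableaux:
  "l \<in> shapes \<Longrightarrow> bounded_by R l \<Longrightarrow> schur_poly m l = (\<Sum>T\<in>tableaux m l. wprod (reading_word R l T))"
proof (induction m arbitrary: l)
  case 0
  show ?case
  proof (cases "l = (\<lambda>_. 0)")
    case True
    have c: "cells l = {}" by (auto simp: True cells_def)
    have "tableaux 0 l = {\<lambda>_ _. 0}" by (auto simp: tableaux_def c)
    moreover have "reading_word R l T = []" for T by (induction R) (simp_all add: True)
    ultimately show ?thesis using True by simp
  next
    case False
    then obtain i where "l i \<noteq> 0" by auto
    then have "0 < l i" using shapes_nonneg[OF 0(1), of i] by simp
    then have "(Suc i, 1) \<in> cells l" by (simp add: cells_def)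
    then have "tableaux 0 l = {}" by (fastforce simp: tableaux_def)
    with False show ?thesis by simp
  qed
next
  case (Suc m)
  have "schur_poly (Suc m) l = (\<Sum>eta\<in>dn l. \<Sum>T\<in>tableaux m eta. wprod (reading_word R l (add_strip m l eta T)))"
    unfolding schur_poly.simps
  proof (rule sum.cong[OF refl])
    fix eta assume eta: "eta \<in> dn l"
    have h: "hstrip eta l" using eta by (simp add: dn_def)
    have es: "eta \<in> shapes" by (rule dn_shapes[OF eta Suc.prems(1)])
    have be: "bounded_by R eta" by (rule hstrip_bounded_down[OF h Suc.prems])
    have "b_exp eta l = psum (\<lambda>r. psum eta r * (l r - eta r)) R"
      unfolding b_exp_def
      by (rule total_eq) (use be Suc.prems(2) in \<open>simp add: bounded_by_def\<close>)
    then show "signed (b_exp eta l) (schur_poly m eta * X (Suc m) ^ nat (total l - total eta))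
        = (\<Sum>T\<in>tableaux m eta. wprod (reading_word R l (add_strip m l eta T)))"
      unfolding Suc.IH[OF es be] total_eq[OF be] total_eq[OF Suc.prems(2)] sum_distrib_right signed_sum
      by (simp add: wprod_add_strip[OF h es])
  qed
  also have "\<dots> = (\<Sum>(eta, T)\<in>(SIGMA eta:dn l. tableaux m eta). wprod (reading_word R l (add_strip m l eta T)))"
    by (rule sum.Sigma[OF finite_dn[OF Suc.prems(1)]]) (blast intro: finite_tableaux dn_shapes[OF _ Suc.prems(1)])
  also have "\<dots> = (\<Sum>T\<in>tableaux (Suc m) l. wprod (reading_word R l T))"
  proof (rule sum.reindex_bij_witness[where j = "\<lambda>(eta, T). add_strip m l eta T" and
        i = "\<lambda>T. (inner m l T, restrict_tab (inner m l T) T)"], goal_cases)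
    case (1 a)
    then show ?case using add_strip_tableaux[OF Suc.prems(1)] by (cases a) simp
  next
    case (2 a)
    then show ?case using add_strip_tableaux(1)[OF Suc.prems(1)] by (cases a) simp
  next
    case (3 T)
    then show ?case using add_restrict[OF Suc.prems(1)] by simp
  next
    case (4 T)
    then show ?case using restrict_tab_tableaux[OF Suc.prems(1)] tableaux_inner(2)[OF Suc.prems(1)] by simp
  next
    case (5 a)
    then show ?case by (cases a) simp
  qed
  finally show ?case .
qed

theorem complete_poly_words: "complete_poly m k = (\<Sum>w\<in>sorted_words m k. wprod w)"
proof (induction m arbitrary: k)
  case 0
  show ?case
  proof (cases "k = 0")
    case True
    then have "sorted_words 0 k = {[]}" by (auto simp: sorted_words_def)
    with True show ?thesis by simp
  next
    case False
    then have "sorted_words 0 k = {}" by (auto simp: sorted_words_def)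
    with False show ?thesis by simp
  qed
next
  case (Suc m)
  have "complete_poly (Suc m) k = (\<Sum>j\<le>k. \<Sum>w\<in>sorted_words m (k - j). wprod (w @ replicate j (Suc m)))"
    by (simp add: Suc.IH sum_distrib_right)
  also have "\<dots> = (\<Sum>(j, w)\<in>(SIGMA j:{..k}. sorted_words m (k - j)). wprod (w @ replicate j (Suc m)))"
    by (rule sum.Sigma) (simp_all add: finite_sorted_words)
  also have "\<dots> = (\<Sum>w\<in>sorted_words (Suc m) k. wprod w)"
  proof (rule sum.reindex_bij_witness[where j = "\<lambda>(j, w). w @ replicate j (Suc m)" and
        i = "\<lambda>w. (length (filter (\<lambda>x. x = Suc m) w), filter (\<lambda>x. x \<noteq> Suc m) w)"], goal_cases)
    case (1 a)
    obtain j w where a: "a = (j, w)" by (cases a)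
    with 1 have "\<forall>x\<in>set w. x \<noteq> Suc m" by (auto simp: sorted_words_def)
    then have "filter (\<lambda>x. x = Suc m) w = []" "filter (\<lambda>x. x \<noteq> Suc m) w = w" by simp_all
    then show ?case by (simp add: a)
  next
    case (2 a)
    then show ?case by (force simp: sorted_words_def sorted_append)
  next
    case (3 w)
    then show ?case using sorted_split[of w m] by (simp add: sorted_words_def)
  next
    case (4 w)
    have "length (filter (\<lambda>x. x = Suc m) w) + length (filter (\<lambda>x. x \<noteq> Suc m) w) = length w"
      by (rule sum_length_filter_compl)
    then have "length (filter (\<lambda>x. x = Suc m) w) \<le> k" "length (filter (\<lambda>x. x \<noteq> Suc m) w) = k - length (filter (\<lambda>x. x = Suc m) w)"
      using 4 by (simp_all add: sorted_words_def)
    then show ?case using 4 by (force simp: sorted_words_def sorted_wrt_filter)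
  next
    case (5 a)
    then show ?case by (cases a) simp
  qed
  finally show ?case .
qed

end

context anticommuting_coef
begin

lemma coef_diff: "coef c (x - y) = coef c x - coef c y"
  using coef_add[of c x "- y"] by (simp add: coef_neg)

lemma coef_of_int: "coef c (of_int n * x) = of_int n * coef c x"
proof (induction n rule: int_induct[where k = 0])
  case (step1 i)
  then show ?case by (simp add: distrib_right coef_add)
next
  case (step2 i)
  then show ?case by (simp add: left_diff_distrib coef_diff)
qed (simp add: coef_0)

lemma coef_wprod_zero: "mset w \<noteq> c \<Longrightarrow> coef c (wprod w) = 0"
proof (induction w arbitrary: c rule: rev_induct)
  case (snoc i w)
  have "mset w \<noteq> c - {#i#}" if "i \<in># c" using that snoc.prems by auto
  then show ?case using snoc.IH by (simp add: coef_X)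
qed (simp add: coef_1)

lemma coef_wprod_nonzero: "coef (mset w) (wprod w) \<noteq> 0"
  by (induction w rule: rev_induct) (simp_all add: coef_1 coef_X cs_nonzero)

end

section \<open>A concrete ring with anticommuting variables\<close>

text \<open>Signed monomials: a multiset of variables and a sign. They form a monoid in which a product of sorted
monomials is resorted at the cost of the parity of the inversions. In the rational monoid algebra put
\<open>x\<^sub>i = e X\<^sub>i\<close>, where \<open>X\<^sub>i\<close> is the monomial of the variable \<open>i\<close> and \<open>e\<close> is half of the difference of the positive and
the negative unit monomial. Since \<open>e\<close> is a central idempotent on which the negative unit monomial acts
as \<open>-1\<close>, the elements \<open>x\<^sub>i\<close> anticommute. The difference of the
coefficients of a monomial with its two signs is a coefficient functional.\<close>

datatype smon = SM "nat multiset" bool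

definition minv :: "nat multiset \<Rightarrow> nat multiset \<Rightarrow> nat" where
  "minv A B = (\<Sum>i\<in>#A. size (filter_mset (\<lambda>j. j < i) B))"

lemma minv_add: "minv (A + A') B = minv A B + minv A' B" "minv A (B + B') = minv A B + minv A B'"
  by (simp_all add: minv_def sum_mset.distrib)

lemma minv_empty [simp]: "minv {#} B = 0" "minv A {#} = 0"
  by (simp_all add: minv_def)

instantiation smon :: monoid_add
begin

definition zero_smon :: smon where "zero_smon = SM {#} False"

fun plus_smon :: "smon \<Rightarrow> smon \<Rightarrow> smon" where
  "plus_smon (SM A s) (SM B t) = SM (A + B) ((s \<noteq> t) \<noteq> odd (minv A B))"

instance
proof
  fix a b c :: smon
  show "a + b + c = a + (b + c)"
    by (cases a; cases b; cases c) (auto simp: minv_add add.assoc)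
  show "0 + a = a" "a + 0 = a"
    by (cases a; simp add: zero_smon_def)+
qed

end

type_synonym opmodel = "smon \<Rightarrow>\<^sub>0 rat"

definition xvar :: "nat \<Rightarrow> opmodel" where
  "xvar i = Poly_Mapping.single (SM {#i#} False) (1/2) - Poly_Mapping.single (SM {#i#} True) (1/2)"

definition mcoef :: "nat multiset \<Rightarrow> opmodel \<Rightarrow> rat" where
  "mcoef c p = Poly_Mapping.lookup p (SM c False) - Poly_Mapping.lookup p (SM c True)"

lemma single_minus: "Poly_Mapping.single k (- a) = - Poly_Mapping.single k (a :: 'b::ab_group_add)"
  by (rule poly_mapping_eqI) (simp add: lookup_single when_def)

lemma mult_xvar: "Poly_Mapping.single (SM A s) v * xvar i =
    (let t = (s \<noteq> odd (minv A {#i#})) in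
     Poly_Mapping.single (SM (A + {#i#}) t) (v / 2) - Poly_Mapping.single (SM (A + {#i#}) (\<not> t)) (v / 2))"
  by (simp add: xvar_def right_diff_distrib mult_single Let_def)

lemma mcoef_add: "mcoef c (p + q) = mcoef c p + mcoef c q"
  by (simp add: mcoef_def lookup_add)

lemma mcoef_minus: "mcoef c (p - q) = mcoef c p - mcoef c q"
  by (simp add: mcoef_def lookup_minus)

lemma mcoef_single: "mcoef c (Poly_Mapping.single (SM A s) v) = (if A = c then if s then - v else v else 0)"
  by (simp add: mcoef_def lookup_single when_def)

lemma xvar_anticomm:
  assumes "i \<noteq> j" shows "xvar i * xvar j = - (xvar j * xvar i)"
proof -
  have "minv {#i#} {#j#} = (if j < i then 1 else 0)" for i j by (simp add: minv_def)
  then show ?thesis using assms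
    unfolding xvar_def[of i] xvar_def[of j]
    by (auto simp: left_diff_distrib right_diff_distrib mult_single add_mset_commute)
qed

lemma pm_expand: "(p :: 'a \<Rightarrow>\<^sub>0 'b::comm_monoid_add) =
    (\<Sum>k\<in>Poly_Mapping.keys p. Poly_Mapping.single k (Poly_Mapping.lookup p k))"
  by (rule poly_mapping_eqI) (simp add: lookup_sum lookup_single when_def in_keys_iff)

definition msign :: "nat \<Rightarrow> nat multiset \<Rightarrow> rat" where
  "msign i c = (if odd (minv (c - {#i#}) {#i#}) then - 1 else 1)"

lemma mcoef_xvar: "mcoef c (p * xvar i) = (if i \<in># c then msign i c * mcoef (c - {#i#}) p else 0)"
proof -
  have m0: "mcoef c 0 = 0" for c by (simp add: mcoef_def)
  have sum: "mcoef c (sum f S) = (\<Sum>k\<in>S. mcoef c (f k))" for c S and f :: "smon \<Rightarrow> opmodel"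
    by (induction S rule: infinite_finite_induct) (simp_all add: mcoef_add m0)
  have one: "mcoef c (Poly_Mapping.single k v * xvar i)
      = (if i \<in># c then msign i c * mcoef (c - {#i#}) (Poly_Mapping.single k v) else 0)" for k v
  proof (cases k)
    case (SM A s)
    have "add_mset i A = c \<longleftrightarrow> i \<in># c \<and> A = c - {#i#}" by auto
    then show ?thesis unfolding SM mult_xvar
      by (auto simp: Let_def mcoef_minus mcoef_single msign_def)
  qed
  show ?thesis
  proof -
    define q where "q k = Poly_Mapping.single k (Poly_Mapping.lookup p k)" for k
    have p: "p = (\<Sum>k\<in>Poly_Mapping.keys p. q k)" unfolding q_def by (rule pm_expand)
    have "mcoef c (p * xvar i) = mcoef c ((\<Sum>k\<in>Poly_Mapping.keys p. q k) * xvar i)"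
      by (rule arg_cong[OF p, of "\<lambda>z. mcoef c (z * xvar i)"])
    also have "\<dots> = (\<Sum>k\<in>Poly_Mapping.keys p. mcoef c (q k * xvar i))"
      by (simp add: sum_distrib_right sum)
    also have "\<dots> = (if i \<in># c then msign i c * (\<Sum>k\<in>Poly_Mapping.keys p. mcoef (c - {#i#}) (q k)) else 0)"
      by (simp add: q_def one sum_distrib_left)
    also have "(\<Sum>k\<in>Poly_Mapping.keys p. mcoef (c - {#i#}) (q k)) = mcoef (c - {#i#}) p"
      unfolding sum[symmetric] by (rule arg_cong[OF p[symmetric]])
    finally show ?thesis .
  qed
qed

definition xtil :: "nat \<Rightarrow> opmodel" where
  "xtil i = signed (int (i - 1)) (xvar i)"

lemma mcoef_1: "mcoef c 1 = (if c = {#} then 1 else 0)"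
  using mcoef_single[of c "{#}" False 1] by (auto simp: zero_smon_def[symmetric])

interpretation xv: anticommuting_coef xvar mcoef msign
proof
  show "i \<noteq> j \<Longrightarrow> xvar i * xvar j = - (xvar j * xvar i)" for i j by (rule xvar_anticomm)
qed (simp_all add: mcoef_add mcoef_xvar mcoef_1 msign_def)

interpretation xt: anticommuting_coef xtil mcoef "\<lambda>i c. signed (int (i - 1)) (msign i c)"
proof
  show "xtil i * xtil j = - (xtil j * xtil i)" if "i \<noteq> j" for i j
  proof -
    have "signed k (- y) = - signed k y" for k and y :: opmodel by (simp add: signed_def)
    then show ?thesis by (simp add: xtil_def xvar_anticomm[OF that] add.commute)
  qed
  show "mcoef c (x * xtil i) = (if i \<in># c then signed (int (i - 1)) (msign i c) * mcoef (c - {#i#}) x else 0)"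
    for c x i
  proof -
    have "mcoef c (signed k y) = signed k (mcoef c y)" for k y by (simp add: signed_def mcoef_def)
    then show ?thesis by (simp add: xtil_def mcoef_xvar)
  qed
qed (simp_all add: mcoef_add mcoef_1 signed_def msign_def)

section \<open>The free ring and the kernel of evaluation\<close>

definition ev :: "(nat list \<Rightarrow>\<^sub>0 int) \<Rightarrow> opmodel" where
  "ev p = (\<Sum>w\<in>Poly_Mapping.keys p. of_int (Poly_Mapping.lookup p w) * xv.wprod w)"

lemma ev_superset:
  "finite S \<Longrightarrow> Poly_Mapping.keys p \<subseteq> S \<Longrightarrow> ev p = (\<Sum>w\<in>S. of_int (Poly_Mapping.lookup p w) * xv.wprod w)"
  unfolding ev_def by (rule sum.mono_neutral_left) (auto simp: in_keys_iff)

lemma ev_0 [simp]: "ev 0 = 0" by (simp add: ev_def)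

lemma ev_add: "ev (p + q) = ev p + ev q"
proof -
  let ?S = "Poly_Mapping.keys p \<union> Poly_Mapping.keys q"
  have "ev (p + q) = (\<Sum>w\<in>?S. of_int (Poly_Mapping.lookup (p + q) w) * xv.wprod w)"
    by (rule ev_superset) (auto simp: Poly_Mapping.keys_add)
  also have "\<dots> = ev p + ev q"
    using ev_superset[of ?S p] ev_superset[of ?S q] by (simp add: lookup_add distrib_right sum.distrib)
  finally show ?thesis .
qed

lemma ev_minus: "ev (- p) = - ev p"
  using ev_add[of "- p" p] by (simp add: eq_neg_iff_add_eq_0)

lemma ev_diff: "ev (p - q) = ev p - ev q"
  using ev_add[of p "- q"] by (simp add: ev_minus)

lemma ev_signed: "ev (signed k p) = signed k (ev p)"
  by (simp add: signed_def ev_minus)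

lemma ev_sum: "ev (sum f A) = (\<Sum>a\<in>A. ev (f a))"
  by (induction A rule: infinite_finite_induct) (simp_all add: ev_add)

lemma ev_of [simp]: "ev (frag_of w) = xv.wprod w"
  by (simp add: ev_def)

definition cat :: "(nat list \<Rightarrow>\<^sub>0 int) \<Rightarrow> (nat list \<Rightarrow>\<^sub>0 int) \<Rightarrow> (nat list \<Rightarrow>\<^sub>0 int)" where
  "cat p q = frag_extend (\<lambda>u. frag_extend (\<lambda>v. frag_of (u @ v)) q) p"

lemma frag_induct [case_names zero one diff]:
  assumes "P 0" "\<And>x. P (frag_of x)" "\<And>a b. P a \<Longrightarrow> P b \<Longrightarrow> P (a - b)"
  shows "P c"
  by (rule frag_induction[of c UNIV]) (use assms in auto)

lemma frag_extend_fun_diff: "frag_extend (\<lambda>u. f u - g u) p = frag_extend f p - frag_extend g p"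
  by (induction p rule: frag_induct) (simp_all add: frag_extend_diff)

lemma cat_simps [simp]: "cat 0 q = 0" "cat p 0 = 0" "cat (frag_of u) (frag_of v) = frag_of (u @ v)"
  by (simp_all add: cat_def frag_extend_eq_0)

lemma cat_diff: "cat (p - p') q = cat p q - cat p' q" "cat p (q - q') = cat p q - cat p q'"
  by (simp_all add: cat_def frag_extend_diff frag_extend_fun_diff)

lemma cat_minus: "cat (- p) q = - cat p q" "cat p (- q) = - cat p q"
  using cat_diff(1)[of 0 p q] cat_diff(2)[of p 0 q] by simp_all

lemma cat_add: "cat (p + p') q = cat p q + cat p' q" "cat p (q + q') = cat p q + cat p q'"
  using cat_diff(1)[of p "- p'" q] cat_diff(2)[of p q "- q'"] by (simp_all add: cat_minus)

lemma cat_one: "cat (frag_of []) q = q" "cat q (frag_of []) = q"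
  by (induction q rule: frag_induct) (simp_all add: cat_diff)

lemma cat_assoc: "cat (cat p q) r = cat p (cat q r)"
proof (induction p rule: frag_induct)
  case (one u)
  show ?case
  proof (induction q rule: frag_induct)
    case (one v)
    show ?case
      by (induction r rule: frag_induct) (simp_all add: cat_diff)
  qed (simp_all add: cat_diff)
qed (simp_all add: cat_diff)

lemma keys_diff_subset: "Poly_Mapping.keys (a - b) \<subseteq> Poly_Mapping.keys a \<union> Poly_Mapping.keys (b :: 'a \<Rightarrow>\<^sub>0 int)"
  by (auto simp: in_keys_iff lookup_minus)

lemma cat_keys:
  assumes p: "Poly_Mapping.keys p \<subseteq> lists A" and q: "Poly_Mapping.keys q \<subseteq> lists A"
  shows "Poly_Mapping.keys (cat p q) \<subseteq> lists A"
  using p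
proof (induction p rule: frag_induction)
  case (one u)
  show ?case using q
  proof (induction q rule: frag_induction)
    case (one v)
    with \<open>u \<in> lists A\<close> show ?case by simp
  next
    case (diff a b)
    then show ?case unfolding cat_diff by (intro subset_trans[OF keys_diff_subset] Un_least)
  qed simp
next
  case (diff a b)
  then show ?case unfolding cat_diff by (intro subset_trans[OF keys_diff_subset] Un_least)
qed simp

lemma ev_cat: "ev (cat p q) = ev p * ev q"
proof (induction p rule: frag_induct)
  case (one u)
  show ?case
    by (induction q rule: frag_induct)
      (simp_all add: cat_diff ev_diff right_diff_distrib)
qed (simp_all add: cat_diff ev_diff left_diff_distrib)

lemma free_ring_simps:
  "carrier (free_ring m) = {p. Poly_Mapping.keys p \<subseteq> lists {1..m}}"
  "p \<otimes>\<^bsub>free_ring m\<^esub> q = cat p q" "\<one>\<^bsub>free_ring m\<^esub> = frag_of []"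
  "\<zero>\<^bsub>free_ring m\<^esub> = 0" "p \<oplus>\<^bsub>free_ring m\<^esub> q = p + q"
  by (simp_all add: free_ring_def cat_def)

lemma free_ring: "ring (free_ring m)"
proof (rule ringI)
  show "abelian_group (free_ring m)"
  proof (rule abelian_groupI)
    fix x assume x: "x \<in> carrier (free_ring m)"
    have "Poly_Mapping.keys (- x) = Poly_Mapping.keys x" by (auto simp: in_keys_iff)
    with x have "- x \<in> carrier (free_ring m)" unfolding free_ring_simps by simp
    moreover have "- x \<oplus>\<^bsub>free_ring m\<^esub> x = \<zero>\<^bsub>free_ring m\<^esub>" unfolding free_ring_simps by simp
    ultimately show "\<exists>y\<in>carrier (free_ring m). y \<oplus>\<^bsub>free_ring m\<^esub> x = \<zero>\<^bsub>free_ring m\<^esub>" by blast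
  next
    fix x y assume xy: "x \<in> carrier (free_ring m)" "y \<in> carrier (free_ring m)"
    have "Poly_Mapping.keys (x + y) \<subseteq> Poly_Mapping.keys x \<union> Poly_Mapping.keys y"
      by (rule Poly_Mapping.keys_add)
    also have "\<dots> \<subseteq> lists {1..m}" using xy unfolding free_ring_simps by simp
    finally show "x \<oplus>\<^bsub>free_ring m\<^esub> y \<in> carrier (free_ring m)"
      unfolding free_ring_simps by simp
  next
    show "\<zero>\<^bsub>free_ring m\<^esub> \<in> carrier (free_ring m)" by (simp add: free_ring_simps)
  qed (simp_all only: free_ring_simps add.assoc add.commute add.left_commute add_0_left add_0_right)
  show "monoid (free_ring m)"
  proof (rule monoidI)
    fix x y assume "x \<in> carrier (free_ring m)" "y \<in> carrier (free_ring m)"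
    then show "x \<otimes>\<^bsub>free_ring m\<^esub> y \<in> carrier (free_ring m)"
      unfolding free_ring_simps mem_Collect_eq by (rule cat_keys)
  next
    show "\<one>\<^bsub>free_ring m\<^esub> \<in> carrier (free_ring m)" by (simp add: free_ring_simps)
  qed (simp_all only: free_ring_simps cat_assoc cat_one)
qed (simp_all only: free_ring_simps cat_add)

definition model_ring :: "opmodel ring" where
  "model_ring = \<lparr>carrier = UNIV, monoid.mult = (*), one = 1, zero = 0, add = (+)\<rparr>"

lemma model_ring_simps:
  "carrier model_ring = UNIV" "p \<otimes>\<^bsub>model_ring\<^esub> q = p * q" "\<one>\<^bsub>model_ring\<^esub> = 1"
  "\<zero>\<^bsub>model_ring\<^esub> = 0" "p \<oplus>\<^bsub>model_ring\<^esub> q = p + q"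
  by (simp_all add: model_ring_def)

lemma model_ring: "ring model_ring"
proof (rule ringI)
  show "abelian_group model_ring"
  proof (rule abelian_groupI)
    fix x assume "x \<in> carrier model_ring"
    show "\<exists>y\<in>carrier model_ring. y \<oplus>\<^bsub>model_ring\<^esub> x = \<zero>\<^bsub>model_ring\<^esub>"
      by (intro bexI[of _ "- x"]) (simp_all add: model_ring_simps)
  qed (simp_all add: model_ring_simps add_ac)
  show "monoid model_ring"
    by (rule monoidI) (simp_all add: model_ring_simps mult.assoc)
qed (simp_all add: model_ring_simps distrib_left distrib_right)

lemma ev_hom: "ring_hom_ring (free_ring m) model_ring ev"
  by (rule ring_hom_ringI2[OF free_ring model_ring], rule ring_hom_memI)
    (simp_all add: free_ring_simps model_ring_simps ev_cat ev_add)

definition odd_gens :: "nat \<Rightarrow> (nat list \<Rightarrow>\<^sub>0 int) set" where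
  "odd_gens m = {frag_of [i, j] + frag_of [j, i] | i j. i \<in> {1..m} \<and> j \<in> {1..m} \<and> i \<noteq> j}"

lemma odd_ideal_alt: "odd_ideal m = genideal (free_ring m) (odd_gens m)"
  by (simp add: odd_ideal_def odd_gens_def)

lemma frag_of_carrier: "frag_of w \<in> carrier (free_ring m) \<longleftrightarrow> set w \<subseteq> {1..m}"
  by (auto simp: free_ring_simps)

lemma odd_gens_carrier: "odd_gens m \<subseteq> carrier (free_ring m)"
proof
  fix x assume "x \<in> odd_gens m"
  then obtain i j where "x = frag_of [i, j] + frag_of [j, i]" "i \<in> {1..m}" "j \<in> {1..m}"
    unfolding odd_gens_def by blast
  then show "x \<in> carrier (free_ring m)"
    using Poly_Mapping.keys_add[of "frag_of [i, j]" "frag_of [j, i]"]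
    by (auto simp: free_ring_simps)
qed

lemma odd_ideal: "ideal (odd_ideal m) (free_ring m)"
  unfolding odd_ideal_alt by (rule ring.genideal_ideal[OF free_ring odd_gens_carrier])

lemma odd_ideal_kernel: "x \<in> odd_ideal m \<Longrightarrow> ev x = 0"
proof -
  have "odd_ideal m \<subseteq> a_kernel (free_ring m) model_ring ev"
    unfolding odd_ideal_alt
  proof (rule ring.genideal_minimal[OF free_ring ring_hom_ring.kernel_is_ideal[OF ev_hom]])
    show "odd_gens m \<subseteq> a_kernel (free_ring m) model_ring ev"
    proof
      fix x assume x: "x \<in> odd_gens m"
      then obtain i j where "x = frag_of [i, j] + frag_of [j, i]" "i \<noteq> j"
        unfolding odd_gens_def by blast
      then have "ev x = 0" using xvar_anticomm[of i j] by (simp add: ev_add)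
      then show "x \<in> a_kernel (free_ring m) model_ring ev"
        using x odd_gens_carrier by (auto simp: a_kernel_def' model_ring_simps)
    qed
  qed
  then show "x \<in> odd_ideal m \<Longrightarrow> ev x = 0" by (auto simp: a_kernel_def' model_ring_simps)
qed

lemma odd_ideal_closed:
  "0 \<in> odd_ideal m" "x \<in> odd_ideal m \<Longrightarrow> y \<in> odd_ideal m \<Longrightarrow> x + y \<in> odd_ideal m"
  "x \<in> odd_ideal m \<Longrightarrow> - x \<in> odd_ideal m"
  "x \<in> odd_ideal m \<Longrightarrow> set w \<subseteq> {1..m} \<Longrightarrow> cat (frag_of w) x \<in> odd_ideal m"
  "x \<in> odd_ideal m \<Longrightarrow> set w \<subseteq> {1..m} \<Longrightarrow> cat x (frag_of w) \<in> odd_ideal m"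
proof -
  interpret I: ideal "odd_ideal m" "free_ring m" by (rule odd_ideal)
  show "0 \<in> odd_ideal m" using additive_subgroup.zero_closed[OF ideal.axioms(1)[OF odd_ideal[of m]]] unfolding free_ring_simps .
  show "x \<in> odd_ideal m \<Longrightarrow> y \<in> odd_ideal m \<Longrightarrow> x + y \<in> odd_ideal m"
    using additive_subgroup.a_closed[OF ideal.axioms(1)[OF odd_ideal[of m]], of x y] unfolding free_ring_simps .
  show "x \<in> odd_ideal m \<Longrightarrow> set w \<subseteq> {1..m} \<Longrightarrow> cat (frag_of w) x \<in> odd_ideal m"
    using I.I_l_closed[of x "frag_of w"] by (simp add: frag_of_carrier) (simp add: free_ring_simps)
  show "x \<in> odd_ideal m \<Longrightarrow> set w \<subseteq> {1..m} \<Longrightarrow> cat x (frag_of w) \<in> odd_ideal m"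
    using I.I_r_closed[of x "frag_of w"] by (simp add: frag_of_carrier) (simp add: free_ring_simps)
  assume x: "x \<in> odd_ideal m"
  have "- frag_of [] \<in> carrier (free_ring m)" by (simp add: free_ring_simps)
  then have "(- frag_of []) \<otimes>\<^bsub>free_ring m\<^esub> x \<in> odd_ideal m" by (rule I.I_l_closed[OF x])
  then show "- x \<in> odd_ideal m" by (simp only: free_ring_simps cat_minus cat_one)
qed

lemma odd_ideal_signed: "x \<in> odd_ideal m \<Longrightarrow> signed k x \<in> odd_ideal m"
  by (simp add: signed_def odd_ideal_closed)

definition sgn_eq :: "nat \<Rightarrow> nat list \<Rightarrow> nat list \<Rightarrow> bool" where
  "sgn_eq m u v \<longleftrightarrow> (\<exists>k. frag_of u - signed k (frag_of v) \<in> odd_ideal m)"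

lemma sgn_eq_refl: "sgn_eq m u u"
  unfolding sgn_eq_def by (rule exI[of _ 0]) (simp add: odd_ideal_closed)

lemma sgn_eq_trans:
  assumes "sgn_eq m u v" "sgn_eq m v w" shows "sgn_eq m u w"
proof -
  obtain k l where kl: "frag_of u - signed k (frag_of v) \<in> odd_ideal m" "frag_of v - signed l (frag_of w) \<in> odd_ideal m"
    using assms unfolding sgn_eq_def by blast
  have "frag_of u - signed (k + l) (frag_of w)
      = (frag_of u - signed k (frag_of v)) + signed k (frag_of v - signed l (frag_of w))"
    by (simp add: signed_diff)
  also have "\<dots> \<in> odd_ideal m" by (intro odd_ideal_closed odd_ideal_signed kl)
  finally show ?thesis unfolding sgn_eq_def by blast
qed

lemma sgn_eq_Cons:
  assumes "sgn_eq m u v" "a \<in> {1..m}" shows "sgn_eq m (a # u) (a # v)"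
proof -
  obtain k where k: "frag_of u - signed k (frag_of v) \<in> odd_ideal m"
    using assms unfolding sgn_eq_def by blast
  have "cat (frag_of [a]) (frag_of u - signed k (frag_of v)) \<in> odd_ideal m"
    by (rule odd_ideal_closed(4)[OF k]) (use assms(2) in simp)
  also have "cat (frag_of [a]) (frag_of u - signed k (frag_of v)) = frag_of (a # u) - signed k (frag_of (a # v))"
    by (simp add: cat_diff cat_minus signed_def)
  finally show ?thesis unfolding sgn_eq_def by blast
qed

lemma sgn_eq_swap:
  assumes "a \<in> {1..m}" "b \<in> {1..m}" "a \<noteq> b" "set v \<subseteq> {1..m}"
  shows "sgn_eq m (a # b # v) (b # a # v)"
proof -
  have "frag_of [a, b] + frag_of [b, a] \<in> odd_gens m" using assms unfolding odd_gens_def by blast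
  then have "frag_of [a, b] + frag_of [b, a] \<in> odd_ideal m"
    using ring.genideal_self[OF free_ring odd_gens_carrier] unfolding odd_ideal_alt by blast
  then have "cat (frag_of [a, b] + frag_of [b, a]) (frag_of v) \<in> odd_ideal m"
    by (rule odd_ideal_closed(5)) (rule assms(4))
  then have "frag_of (a # b # v) - signed 1 (frag_of (b # a # v)) \<in> odd_ideal m"
    by (simp add: cat_add signed_def)
  then show ?thesis unfolding sgn_eq_def by blast
qed

lemma sgn_eq_sort:
  assumes "set w \<subseteq> {1..m}" shows "sgn_eq m w (sort w)"
  using assms
proof (induction w)
  case Nil
  show ?case by (simp add: sgn_eq_refl)
next
  case (Cons a w)
  have ins: "sgn_eq m (a # v) (insort a v)" if "a \<in> {1..m}" "set v \<subseteq> {1..m}" for v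
    using that
  proof (induction v)
    case (Cons b v)
    show ?case
    proof (cases "a \<le> b")
      case True
      then show ?thesis by (simp add: sgn_eq_refl)
    next
      case False
      have "sgn_eq m (a # b # v) (b # a # v)" by (rule sgn_eq_swap) (use Cons.prems False in auto)
      moreover have "sgn_eq m (b # a # v) (b # insort a v)"
        by (rule sgn_eq_Cons) (use Cons in auto)
      ultimately show ?thesis using False sgn_eq_trans by auto
    qed
  qed (simp add: sgn_eq_refl)
  have "sgn_eq m (a # w) (a # sort w)" by (rule sgn_eq_Cons) (use Cons in auto)
  moreover have "sgn_eq m (a # sort w) (insort a (sort w))" by (rule ins) (use Cons.prems in auto)
  ultimately show ?case using sgn_eq_trans by auto
qed

text \<open>Distinct sorted words have distinct multisets of letters, so the coefficient functionals separate
them.\<close>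

lemma ev_sorted_inj:
  assumes "\<And>w. w \<in> Poly_Mapping.keys q \<Longrightarrow> sorted w" "ev q = 0" shows "q = 0"
proof (rule ccontr)
  assume "q \<noteq> 0"
  then obtain w where w: "w \<in> Poly_Mapping.keys q" by (metis ex_in_conv keys_eq_empty)
  have "0 = mcoef (mset w) (ev q)" using assms(2) by (simp add: mcoef_def)
  also have "\<dots> = (\<Sum>u\<in>Poly_Mapping.keys q. of_int (Poly_Mapping.lookup q u) * mcoef (mset w) (xv.wprod u))"
    unfolding ev_def by (simp add: xv.coef_sum xv.coef_of_int)
  also have "\<dots> = (\<Sum>u\<in>{w}. of_int (Poly_Mapping.lookup q u) * mcoef (mset w) (xv.wprod u))"
  proof (rule sum.mono_neutral_right)
    show "\<forall>u\<in>Poly_Mapping.keys q - {w}. of_int (Poly_Mapping.lookup q u) * mcoef (mset w) (xv.wprod u) = 0"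
    proof
      fix u assume u: "u \<in> Poly_Mapping.keys q - {w}"
      then have "mset u \<noteq> mset w"
        using assms(1)[of u] assms(1)[OF w] properties_for_sort[of u w] sorted_sort_id[of w] by auto
      then show "of_int (Poly_Mapping.lookup q u) * mcoef (mset w) (xv.wprod u) = 0"
        by (simp add: xv.coef_wprod_zero)
    qed
  qed (use w in auto)
  finally show False using xv.coef_wprod_nonzero[of w] w by (simp add: in_keys_iff)
qed

text \<open>Modulo the ideal every word is a signed sorted word, and on combinations of sorted words evaluation is
injective.\<close>

lemma kernel_eq: "a_kernel (free_ring m) model_ring ev = odd_ideal m"
proof (intro equalityI subsetI)
  fix x assume x: "x \<in> odd_ideal m"
  then show "x \<in> a_kernel (free_ring m) model_ring ev"
    using odd_ideal_kernel[OF x] ideal.Icarr[OF odd_ideal x] by (simp add: a_kernel_def' model_ring_simps)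
next
  fix p assume "p \<in> a_kernel (free_ring m) model_ring ev"
  then have p: "Poly_Mapping.keys p \<subseteq> lists {1..m}" "ev p = 0"
    by (auto simp: a_kernel_def' model_ring_simps free_ring_simps)
  have "\<exists>q. p - q \<in> odd_ideal m \<and> (\<forall>w\<in>Poly_Mapping.keys q. sorted w)"
    using p(1)
  proof (induction p rule: frag_induction)
    case zero
    show ?case by (rule exI[of _ 0]) (simp add: odd_ideal_closed)
  next
    case (one w)
    then have "set w \<subseteq> {1..m}" by auto
    from sgn_eq_sort[OF this] obtain k where "frag_of w - signed k (frag_of (sort w)) \<in> odd_ideal m"
      unfolding sgn_eq_def by blast
    moreover have "\<forall>w'\<in>Poly_Mapping.keys (signed k (frag_of (sort w))). sorted w'"
      by (simp add: signed_def)
    ultimately show ?case by blast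
  next
    case (diff a b)
    then obtain qa qb where q: "a - qa \<in> odd_ideal m" "\<forall>w\<in>Poly_Mapping.keys qa. sorted w"
      "b - qb \<in> odd_ideal m" "\<forall>w\<in>Poly_Mapping.keys qb. sorted w" by blast
    have "(a - b) - (qa - qb) = (a - qa) + - (b - qb)" by simp
    also have "\<dots> \<in> odd_ideal m" by (intro odd_ideal_closed q)
    finally show ?case using q keys_diff_subset[of qa qb] by (intro exI[of _ "qa - qb"]) auto
  qed
  then obtain q where q: "p - q \<in> odd_ideal m" "\<And>w. w \<in> Poly_Mapping.keys q \<Longrightarrow> sorted w" by blast
  have "ev q = 0" using odd_ideal_kernel[OF q(1)] p(2) by (simp add: ev_diff)
  then have "q = 0" using ev_sorted_inj q(2) by blast
  then show "p \<in> odd_ideal m" using q(1) by simp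
qed

section \<open>Odd polynomials inside the concrete ring\<close>

text \<open>The embedding of the ring of odd polynomials that evaluation induces on cosets.\<close>

definition to_model :: "opol \<Rightarrow> opmodel" where
  "to_model C = the_elem (ev ` C)"

lemma OPol_alt: "OPol m = free_ring m Quot a_kernel (free_ring m) model_ring ev"
  by (simp add: OPol_def kernel_eq)

lemma OPol_ring: "ring (OPol m)"
  unfolding OPol_def by (rule ideal.quotient_is_ring[OF odd_ideal])

lemma to_model_hom: "to_model \<in> ring_hom (OPol m) model_ring"
  unfolding OPol_alt to_model_def by (rule ring_hom_ring.the_elem_hom[OF ev_hom])

lemma to_model_inj: "C \<in> carrier (OPol m) \<Longrightarrow> D \<in> carrier (OPol m) \<Longrightarrow> to_model C = to_model D \<Longrightarrow> C = D"
  unfolding OPol_alt to_model_def by (rule ring_hom_ring.the_elem_inj[OF ev_hom])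

lemma to_model_simps:
  "C \<in> carrier (OPol m) \<Longrightarrow> D \<in> carrier (OPol m) \<Longrightarrow> to_model (C \<oplus>\<^bsub>OPol m\<^esub> D) = to_model C + to_model D"
  "C \<in> carrier (OPol m) \<Longrightarrow> D \<in> carrier (OPol m) \<Longrightarrow> to_model (C \<otimes>\<^bsub>OPol m\<^esub> D) = to_model C * to_model D"
  "to_model \<one>\<^bsub>OPol m\<^esub> = 1"
  using ring_hom_add[OF to_model_hom[of m]] ring_hom_mult[OF to_model_hom[of m]] ring_hom_one[OF to_model_hom[of m]]
  by (simp_all add: model_ring_simps)

lemma to_model_zero: "to_model \<zero>\<^bsub>OPol m\<^esub> = 0"
proof -
  interpret R: ring "OPol m" by (rule OPol_ring)
  have "to_model (\<zero>\<^bsub>OPol m\<^esub> \<oplus>\<^bsub>OPol m\<^esub> \<zero>\<^bsub>OPol m\<^esub>) = to_model \<zero>\<^bsub>OPol m\<^esub> + to_model \<zero>\<^bsub>OPol m\<^esub>"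
    by (rule to_model_simps) simp_all
  then show ?thesis by simp
qed

text \<open>Sums and multiples in the carrier-based rings are transported along additive maps to a ring given by
a type class. The maps are \<open>to_model\<close> and, for odd symmetric functions, its composition with a component.\<close>

lemma additive_minus:
  fixes phi :: "'a \<Rightarrow> 'b::ab_group_add"
  assumes "abelian_group R" "\<And>x y. x \<in> carrier R \<Longrightarrow> y \<in> carrier R \<Longrightarrow> phi (x \<oplus>\<^bsub>R\<^esub> y) = phi x + phi y"
    "phi \<zero>\<^bsub>R\<^esub> = 0" "x \<in> carrier R"
  shows "phi (\<ominus>\<^bsub>R\<^esub> x) = - phi x"
proof -
  interpret R: abelian_group R by (rule assms(1))
  have "phi (\<ominus>\<^bsub>R\<^esub> x) + phi x = 0"
    using assms(2)[of "\<ominus>\<^bsub>R\<^esub> x" x] assms(3,4) by (simp add: R.l_neg)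
  then show ?thesis by (simp add: eq_neg_iff_add_eq_0)
qed

lemma additive_finsum:
  fixes phi :: "'a \<Rightarrow> 'b::comm_monoid_add"
  assumes "abelian_group R" "\<And>x y. x \<in> carrier R \<Longrightarrow> y \<in> carrier R \<Longrightarrow> phi (x \<oplus>\<^bsub>R\<^esub> y) = phi x + phi y"
    "phi \<zero>\<^bsub>R\<^esub> = 0" "\<And>a. a \<in> A \<Longrightarrow> f a \<in> carrier R"
  shows "phi (finsum R f A) = (\<Sum>a\<in>A. phi (f a))"
proof -
  interpret R: abelian_group R by (rule assms(1))
  show ?thesis
    using assms(4)
  proof (induction A rule: infinite_finite_induct)
    case (insert a A)
    have "finsum R f (insert a A) = f a \<oplus>\<^bsub>R\<^esub> finsum R f A"
      by (rule R.finsum_insert) (use insert in auto)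
    moreover have "finsum R f A \<in> carrier R" by (rule R.finsum_closed) (use insert.prems in auto)
    ultimately show ?case using insert assms(2) by simp
  qed (simp_all add: assms(3))
qed

lemma additive_add_pow:
  fixes phi :: "'a \<Rightarrow> 'b::ring_1" and k :: int
  assumes "abelian_group R" "\<And>x y. x \<in> carrier R \<Longrightarrow> y \<in> carrier R \<Longrightarrow> phi (x \<oplus>\<^bsub>R\<^esub> y) = phi x + phi y"
    "phi \<zero>\<^bsub>R\<^esub> = 0" "x \<in> carrier R"
  shows "phi (add_pow R k x) = of_int k * phi x" and "add_pow R k x \<in> carrier R"
proof -
  interpret R: abelian_group R by (rule assms(1))
  have nat: "add_pow R n x \<in> carrier R \<and> phi (add_pow R n x) = of_nat n * phi x" for n :: nat
  proof (induction n)
    case 0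
    show ?case using assms(3) by simp
  next
    case (Suc n)
    then show ?case using assms(2)[of "add_pow R n x" x] assms(4) by (simp add: algebra_simps)
  qed
  have "phi (add_pow R k x) = of_int k * phi x \<and> add_pow R k x \<in> carrier R"
  proof (cases "0 \<le> k")
    case True
    then show ?thesis using nat[of "nat k"] by (simp add: add_pow_int_ge)
  next
    case False
    then have "add_pow R k x = \<ominus>\<^bsub>R\<^esub> (add_pow R (nat (- k)) x)" by (simp add: add_pow_int_lt)
    then show ?thesis
      using nat[of "nat (- k)"] additive_minus[OF assms(1-3), of "add_pow R (nat (- k)) x"] False by simp
  qed
  then show "phi (add_pow R k x) = of_int k * phi x" "add_pow R k x \<in> carrier R" by simp_all
qed

lemma OPol_group: "abelian_group (OPol m)"
  using OPol_ring by (rule ring.is_abelian_group)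

lemma to_model_finsum:
  "(\<And>a. a \<in> A \<Longrightarrow> f a \<in> carrier (OPol m)) \<Longrightarrow> to_model (finsum (OPol m) f A) = (\<Sum>a\<in>A. to_model (f a))"
  by (rule additive_finsum[OF OPol_group]) (simp_all add: to_model_simps to_model_zero)

lemma to_model_minus: "C \<in> carrier (OPol m) \<Longrightarrow> to_model (\<ominus>\<^bsub>OPol m\<^esub> C) = - to_model C"
  by (rule additive_minus[OF OPol_group]) (simp_all add: to_model_simps to_model_zero)

lemma to_model_add_pow:
  fixes k :: int
  assumes "C \<in> carrier (OPol m)"
  shows "to_model (add_pow (OPol m) k C) = of_int k * to_model C" "add_pow (OPol m) k C \<in> carrier (OPol m)"
  using additive_add_pow[OF OPol_group, of m to_model C k] assms by (simp_all add: to_model_simps to_model_zero)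

lemma class_carrier: "p \<in> carrier (free_ring m) \<Longrightarrow> opol_class m p \<in> carrier (OPol m)"
  unfolding OPol_def opol_class_def
  using ring_hom_closed[OF ideal.rcos_ring_hom[OF odd_ideal]] by simp

lemma to_model_class: "p \<in> carrier (free_ring m) \<Longrightarrow> to_model (opol_class m p) = ev p"
  unfolding opol_class_def to_model_def
  using ring_hom_ring.the_elem_simp[OF ev_hom] by (simp add: kernel_eq)

lemma free_closed:
  "p \<in> carrier (free_ring m) \<Longrightarrow> q \<in> carrier (free_ring m) \<Longrightarrow> p + q \<in> carrier (free_ring m)"
  "p \<in> carrier (free_ring m) \<Longrightarrow> - p \<in> carrier (free_ring m)"
  "p \<in> carrier (free_ring m) \<Longrightarrow> signed k p \<in> carrier (free_ring m)"
  "set w \<subseteq> {1..m} \<Longrightarrow> frag_of w \<in> carrier (free_ring m)"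
  "0 \<in> carrier (free_ring m)"
proof -
  interpret R: ring "free_ring m" by (rule free_ring)
  show "p \<in> carrier (free_ring m) \<Longrightarrow> q \<in> carrier (free_ring m) \<Longrightarrow> p + q \<in> carrier (free_ring m)"
    using R.add.m_closed[of p q] unfolding free_ring_simps(5) .
  have "Poly_Mapping.keys (- p) = Poly_Mapping.keys p" by (auto simp: in_keys_iff)
  then show n: "p \<in> carrier (free_ring m) \<Longrightarrow> - p \<in> carrier (free_ring m)"
    unfolding free_ring_simps by simp
  then show "p \<in> carrier (free_ring m) \<Longrightarrow> signed k p \<in> carrier (free_ring m)" by (simp add: signed_def)
  show "set w \<subseteq> {1..m} \<Longrightarrow> frag_of w \<in> carrier (free_ring m)" by (simp add: frag_of_carrier)
  show "0 \<in> carrier (free_ring m)" by (simp add: free_ring_simps)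
qed

lemma free_sum: "(\<And>a. a \<in> A \<Longrightarrow> f a \<in> carrier (free_ring m)) \<Longrightarrow> sum f A \<in> carrier (free_ring m)"
  by (induction A rule: infinite_finite_induct) (simp_all add: free_closed)

lemma single_sign: "Poly_Mapping.single w ((- 1) ^ n) = signed (int n) (frag_of w)"
  by (simp add: signed_def single_minus minus_one_power_iff)

lemma to_model_xt:
  assumes "i \<in> {1..m}"
  shows "xt m i \<in> carrier (OPol m)" "to_model (xt m i) = xtil i"
proof -
  have c: "signed (int (i - 1)) (frag_of [i]) \<in> carrier (free_ring m)"
    by (intro free_closed) (use assms in simp)
  show "xt m i \<in> carrier (OPol m)" unfolding xt_def single_sign by (rule class_carrier[OF c])
  show "to_model (xt m i) = xtil i"
    unfolding xt_def single_sign to_model_class[OF c] by (simp add: ev_signed xtil_def)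
qed

lemma to_model_xt_word:
  "set w \<subseteq> {1..m} \<Longrightarrow> xt_word m w \<in> carrier (OPol m) \<and> to_model (xt_word m w) = xt.wprod w"
proof (induction w)
  case Nil
  interpret R: ring "OPol m" by (rule OPol_ring)
  show ?case by (simp add: xt_word_def to_model_simps)
next
  case (Cons i w)
  interpret R: ring "OPol m" by (rule OPol_ring)
  have "xt_word m (i # w) = xt m i \<otimes>\<^bsub>OPol m\<^esub> xt_word m w" by (simp add: xt_word_def)
  then show ?case using Cons to_model_xt[of i m] by (simp add: to_model_simps)
qed

lemma odd_complete:
  shows "odd_complete m k \<in> carrier (OPol m)" "to_model (odd_complete m k) = xt.complete_poly m k"
proof -
  interpret R: ring "OPol m" by (rule OPol_ring)
  have w: "xt_word m w \<in> carrier (OPol m)" "to_model (xt_word m w) = xt.wprod w"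
    if "w \<in> {w. length w = k \<and> set w \<subseteq> {1..m} \<and> sorted w}" for w
    using to_model_xt_word[of w m] that by auto
  show "odd_complete m k \<in> carrier (OPol m)"
    unfolding odd_complete_def by (rule R.finsum_closed) (use w in auto)
  have "to_model (odd_complete m k) = (\<Sum>w | length w = k \<and> set w \<subseteq> {1..m} \<and> sorted w. to_model (xt_word m w))"
    unfolding odd_complete_def by (rule to_model_finsum) (use w in auto)
  also have "\<dots> = xt.complete_poly m k"
    unfolding xt.complete_poly_words sorted_words_def by (rule sum.cong) (use w in auto)
  finally show "to_model (odd_complete m k) = xt.complete_poly m k" .
qed

section \<open>Partitions as shapes\<close>

definition shape_of :: "nat list \<Rightarrow> nat \<Rightarrow> int" where
  "shape_of lam i = int (part lam (Suc i))"

lemma shape_of_bounded: "bounded_by (length lam) (shape_of lam)"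
  by (simp add: bounded_by_def shape_of_def Defs.part_def)

lemma shape_of_nonneg: "0 \<le> shape_of lam i"
  by (simp add: shape_of_def)

lemma shape_of_shapes: "is_partition lam \<Longrightarrow> shape_of lam \<in> shapes"
proof -
  assume p: "is_partition lam"
  have "shape_of lam (Suc i) \<le> shape_of lam i" for i
  proof (cases "Suc i < length lam")
    case True
    have "sorted_wrt (\<ge>) lam" using p by (simp add: is_partition_def)
    then have "lam ! Suc i \<le> lam ! i" using sorted_wrt_nth_less[of "(\<ge>)" lam i "Suc i"] True by simp
    then show ?thesis using True by (simp add: shape_of_def Defs.part_def)
  qed (simp add: shape_of_def Defs.part_def)
  then show ?thesis using shape_of_bounded[of lam] by (auto simp: shapes_def)
qed

lemma shape_of_inj:
  assumes "is_partition a" "is_partition b" "shape_of a = shape_of b" shows "a = b"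
proof -
  have pos: "shape_of c i \<noteq> 0 \<longleftrightarrow> i < length c" if "is_partition c" for c i
  proof
    assume "i < length c"
    then have "c ! i \<in> set c" by simp
    then have "c ! i \<noteq> 0" using that unfolding is_partition_def by metis
    then show "shape_of c i \<noteq> 0" using \<open>i < length c\<close> by (simp add: shape_of_def Defs.part_def)
  qed (simp add: shape_of_def Defs.part_def split: if_splits)
  have eq: "i < length a \<longleftrightarrow> i < length b" for i
    using pos[OF assms(1), of i] pos[OF assms(2), of i] unfolding assms(3) by blast
  have len: "length a = length b" using eq[of "length a"] eq[of "length b"] by linarith
  have "a ! i = b ! i" if "i < length a" for i
    using fun_cong[OF assms(3), of i] that len by (simp add: shape_of_def Defs.part_def)
  with len show ?thesis by (rule nth_equalityI)
qed

lemma shape_of_surj: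
  assumes l: "l \<in> shapes" shows "\<exists>lam. is_partition lam \<and> shape_of lam = l"
proof -
  define n where "n = (LEAST n. bounded_by n l)"
  have n: "bounded_by n l" unfolding n_def by (rule LeastI_ex) (rule shapes_bounded[OF l])
  have pos: "0 < l i" if "i < n" for i
  proof (rule ccontr)
    assume "\<not> 0 < l i"
    then have "l j = 0" if "i \<le> j" for j
      using shapes_antimono[OF l that] shapes_nonneg[OF l, of j] by linarith
    then have "bounded_by i l" by (simp add: bounded_by_def)
    then have "n \<le> i" unfolding n_def by (rule Least_le)
    with that show False by simp
  qed
  define lam where "lam = map (\<lambda>i. nat (l i)) [0..<n]"
  have "is_partition lam"
    unfolding is_partition_def
  proof
    show "sorted_wrt (\<ge>) lam"
      unfolding sorted_wrt_iff_nth_less lam_def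
      using shapes_antimono[OF l] by (auto intro!: nat_mono)
    show "0 \<notin> set lam" using pos by (force simp: lam_def)
  qed
  moreover have "shape_of lam = l"
  proof
    fix i
    show "shape_of lam i = l i"
      using n pos[of i] by (cases "i < n") (auto simp: shape_of_def Defs.part_def lam_def bounded_by_def)
  qed
  ultimately show ?thesis by blast
qed

lemma diagram_cells: "diagram lam = cells (shape_of lam)"
proof -
  have "(r, c) \<in> diagram lam \<longleftrightarrow> (r, c) \<in> cells (shape_of lam)" for r c
    by (cases r) (auto simp: diagram_def cells_def shape_of_def Defs.part_def)
  then show ?thesis by auto
qed

lemma ssyt_tableaux: "ssyt m lam = tableaux m (shape_of lam)"
  by (simp add: ssyt_def tableaux_def diagram_cells)

lemma row_word_reading_word: "row_word lam T = reading_word (length lam) (shape_of lam) T"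
proof -
  have "concat (map (\<lambda>r. map (T r) [1..<Suc (part lam r)]) (rev [1..<Suc R])) = reading_word R (shape_of lam) T" for R
    by (induction R) (simp_all add: shape_of_def)
  then show ?thesis by (simp add: row_word_def)
qed

text \<open>A representative of the odd Schur polynomial in the free ring. It makes its degree and its behaviour
under killing the last variable visible.\<close>

definition schur_rep :: "nat \<Rightarrow> nat list \<Rightarrow> (nat list \<Rightarrow>\<^sub>0 int)" where
  "schur_rep m lam = signed (int (dN lam + N lam))
     (\<Sum>T\<in>ssyt m lam. signed (\<Sum>i\<leftarrow>row_word lam T. int (i - 1)) (frag_of (row_word lam T)))"

lemma wprod_xtil: "xt.wprod w = signed (\<Sum>i\<leftarrow>w. int (i - 1)) (xv.wprod w)"
proof (induction w)
  case (Cons i w)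
  then show ?case by (simp add: xtil_def[of i] add.commute)
qed simp

lemma row_word_set: "T \<in> ssyt m lam \<Longrightarrow> set (row_word lam T) \<subseteq> {1..m}"
  unfolding ssyt_tableaux row_word_reading_word by (rule set_reading_word)

lemma schur_rep_carrier: "schur_rep m lam \<in> carrier (free_ring m)"
  unfolding schur_rep_def by (intro free_closed free_sum row_word_set)

lemma ev_schur_rep:
  assumes "is_partition lam"
  shows "ev (schur_rep m lam) = signed (int (dN lam + N lam)) (xt.schur_poly m (shape_of lam))"
  unfolding schur_rep_def ev_signed ev_sum ssyt_tableaux row_word_reading_word ev_of wprod_xtil[symmetric]
    xt.schur_poly_tableaux[OF shape_of_shapes[OF assms] shape_of_bounded] ..

lemma odd_schur_class:
  assumes "is_partition lam"
  shows "odd_schur lam m = opol_class m (schur_rep m lam)"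
proof -
  interpret R: ring "OPol m" by (rule OPol_ring)
  have w: "xt_word m (row_word lam T) \<in> carrier (OPol m)" "to_model (xt_word m (row_word lam T)) = xt.wprod (row_word lam T)"
    if "T \<in> ssyt m lam" for T
    using to_model_xt_word[OF row_word_set[OF that]] by auto
  let ?S = "\<Oplus>\<^bsub>OPol m\<^esub> T \<in> ssyt m lam. xt_word m (row_word lam T)"
  have c: "?S \<in> carrier (OPol m)" by (rule R.finsum_closed) (use w in auto)
  have "to_model ?S = (\<Sum>T\<in>ssyt m lam. to_model (xt_word m (row_word lam T)))" by (rule to_model_finsum) (rule w)
  also have "\<dots> = xt.schur_poly m (shape_of lam)"
    unfolding xt.schur_poly_tableaux[OF shape_of_shapes[OF assms] shape_of_bounded] ssyt_tableaux[symmetric] row_word_reading_word[symmetric]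
    by (rule sum.cong[OF refl]) (rule w)
  finally have P: "to_model ?S = xt.schur_poly m (shape_of lam)" .
  show ?thesis
  proof (rule to_model_inj)
    show "odd_schur lam m \<in> carrier (OPol m)" unfolding odd_schur_def by (rule to_model_add_pow(2)[OF c])
    show "opol_class m (schur_rep m lam) \<in> carrier (OPol m)" by (rule class_carrier[OF schur_rep_carrier])
    show "to_model (odd_schur lam m) = to_model (opol_class m (schur_rep m lam))"
      unfolding odd_schur_def to_model_add_pow(1)[OF c] to_model_class[OF schur_rep_carrier] ev_schur_rep[OF assms] P
      by (simp add: signed_def minus_one_power_iff)
  qed
qed

lemma odd_schur_carrier: "is_partition lam \<Longrightarrow> odd_schur lam m \<in> carrier (OPol m)"
  unfolding odd_schur_class by (rule class_carrier[OF schur_rep_carrier])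

lemma to_model_schur: "is_partition lam \<Longrightarrow> to_model (odd_schur lam m) = signed (int (dN lam + N lam)) (xt.schur_poly m (shape_of lam))"
  unfolding odd_schur_class by (simp add: to_model_class[OF schur_rep_carrier] ev_schur_rep)

section \<open>Killing the last variable\<close>

lemma free_restr_simps:
  "free_restr m (p + q) = free_restr m p + free_restr m q"
  "free_restr m (p - q) = free_restr m p - free_restr m q"
  "free_restr m (- p) = - free_restr m p"
  "free_restr m (signed k p) = signed k (free_restr m p)"
  "free_restr m 0 = 0"
  "free_restr m (frag_of w) = (if set w \<subseteq> {1..m} then frag_of w else 0)"
  by (simp_all add: free_restr_def frag_extend_add frag_extend_diff frag_extend_minus signed_def)

lemma free_restr_sum: "free_restr m (sum f A) = (\<Sum>a\<in>A. free_restr m (f a))"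
  by (induction A rule: infinite_finite_induct) (simp_all add: free_restr_simps)

lemma free_restr_carrier: "free_restr m p \<in> carrier (free_ring m)"
proof (induction p rule: frag_induct)
  case (diff a b)
  then show ?case using free_closed(1)[of "free_restr m a" m "- free_restr m b"] free_closed(2)[of "free_restr m b" m]
    by (simp add: free_restr_simps)
qed (simp_all add: free_restr_simps free_closed)

lemma free_restr_cat: "free_restr m (cat p q) = cat (free_restr m p) (free_restr m q)"
proof (induction p rule: frag_induct)
  case (one u)
  show ?case
    by (induction q rule: frag_induct) (auto simp: free_restr_simps cat_diff)
qed (simp_all add: free_restr_simps cat_diff)

lemma free_restr_hom: "ring_hom_ring (free_ring (Suc m)) (free_ring m) (free_restr m)"
  by (rule ring_hom_ringI2[OF free_ring free_ring], rule ring_hom_memI)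
    (simp_all only: free_restr_carrier free_ring_simps(2,3,5) free_restr_cat free_restr_simps list.set empty_subsetI if_True)

lemma free_restr_ideal: "x \<in> odd_ideal (Suc m) \<Longrightarrow> free_restr m x \<in> odd_ideal m"
proof -
  let ?J = "{r \<in> carrier (free_ring (Suc m)). free_restr m r \<in> odd_ideal m}"
  have "odd_ideal (Suc m) \<subseteq> ?J"
    unfolding odd_ideal_alt[of "Suc m"]
  proof (rule ring.genideal_minimal[OF free_ring ring_hom_ring.ideal_vimage[OF free_restr_hom odd_ideal]])
    show "odd_gens (Suc m) \<subseteq> ?J"
    proof
      fix x assume x: "x \<in> odd_gens (Suc m)"
      then obtain i j where ij: "x = frag_of [i, j] + frag_of [j, i]" "i \<in> {1..Suc m}" "j \<in> {1..Suc m}" "i \<noteq> j"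
        unfolding odd_gens_def by blast
      have "free_restr m x \<in> odd_ideal m"
      proof (cases "i \<le> m \<and> j \<le> m")
        case True
        then have "x \<in> odd_gens m" unfolding odd_gens_def ij(1) using ij by force
        then have "x \<in> odd_ideal m"
          using ring.genideal_self[OF free_ring odd_gens_carrier] unfolding odd_ideal_alt by blast
        moreover have "free_restr m x = x" using True ij by (simp add: free_restr_simps)
        ultimately show ?thesis by simp
      next
        case False
        then have "free_restr m x = 0" using ij by (auto simp: free_restr_simps)
        then show ?thesis by (simp add: odd_ideal_closed)
      qed
      then show "x \<in> ?J" using x odd_gens_carrier by blast
    qed
  qed
  then show "x \<in> odd_ideal (Suc m) \<Longrightarrow> free_restr m x \<in> odd_ideal m" by blast
qed

lemma class_eqI:
  assumes "p \<in> carrier (free_ring m)" "q \<in> carrier (free_ring m)" "p - q \<in> odd_ideal m"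
  shows "opol_class m p = opol_class m q"
proof (rule to_model_inj[OF class_carrier class_carrier])
  show "to_model (opol_class m p) = to_model (opol_class m q)"
    using odd_ideal_kernel[OF assms(3)] by (simp add: to_model_class assms ev_diff)
qed (use assms in auto)

lemma class_coset: "opol_class m p = (\<Union>h\<in>odd_ideal m. {h \<oplus>\<^bsub>free_ring m\<^esub> p})"
  unfolding opol_class_def by (rule a_r_coset_def'[THEN meta_eq_to_obj_eq])

lemma class_mem: "q \<in> opol_class m p \<longleftrightarrow> (\<exists>h\<in>odd_ideal m. q = h + p)"
  unfolding class_coset free_ring_simps(5) UN_iff singleton_iff ..

lemma opol_restr_class:
  assumes p: "p \<in> carrier (free_ring (Suc m))"
  shows "opol_restr m (opol_class (Suc m) p) = opol_class m (free_restr m p)"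
proof -
  have const: "opol_class m (free_restr m q) = opol_class m (free_restr m p)" if q: "q \<in> opol_class (Suc m) p" for q
  proof -
    obtain h where h: "h \<in> odd_ideal (Suc m)" "q = h + p" using q unfolding class_mem by blast
    show ?thesis
    proof (rule class_eqI[OF free_restr_carrier free_restr_carrier])
      show "free_restr m q - free_restr m p \<in> odd_ideal m"
        using free_restr_ideal[OF h(1)] unfolding h(2) free_restr_simps by simp
    qed
  qed
  have "p \<in> opol_class (Suc m) p" unfolding class_mem by (rule bexI[of _ 0]) (simp_all only: odd_ideal_closed(1) add_0_left)
  then show ?thesis unfolding opol_restr_def by (rule UN_constant_eq) (rule ballI, rule const)
qed

lemma ssyt_change_bound:
  assumes T: "T \<in> ssyt m lam" and le: "\<And>r c. (r, c) \<in> diagram lam \<Longrightarrow> T r c \<le> m'"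
  shows "T \<in> ssyt m' lam"
proof -
  have "1 \<le> T r c" if "(r, c) \<in> diagram lam" for r c
    using T that unfolding ssyt_def mem_Collect_eq by (elim conjE) simp
  with le have "\<forall>r c. (r, c) \<in> diagram lam \<longrightarrow> 1 \<le> T r c \<and> T r c \<le> m'" by simp
  with T show ?thesis
    unfolding ssyt_def mem_Collect_eq by (elim conjE, intro conjI)
qed

lemma ssyt_restrict:
  "{T \<in> ssyt (Suc m) lam. set (row_word lam T) \<subseteq> {1..m}} = ssyt m lam"
proof (intro equalityI subsetI)
  fix T assume T: "T \<in> ssyt m lam"
  have "T \<in> ssyt (Suc m) lam"
  proof (rule ssyt_change_bound[OF T])
    fix r c assume "(r, c) \<in> diagram lam"
    then have "T r c \<le> m" using T unfolding ssyt_def mem_Collect_eq by (elim conjE) simp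
    then show "T r c \<le> Suc m" by simp
  qed
  then show "T \<in> {T \<in> ssyt (Suc m) lam. set (row_word lam T) \<subseteq> {1..m}}" using row_word_set[OF T] by simp
next
  fix T assume "T \<in> {T \<in> ssyt (Suc m) lam. set (row_word lam T) \<subseteq> {1..m}}"
  then have T: "T \<in> ssyt (Suc m) lam" and sub: "set (row_word lam T) \<subseteq> {1..m}" by simp_all
  show "T \<in> ssyt m lam"
  proof (rule ssyt_change_bound[OF T])
    fix r c assume "(r, c) \<in> diagram lam"
    then have d: "1 \<le> r" "r \<le> length lam" "1 \<le> c" "c \<le> part lam r" unfolding diagram_def by simp_all
    have r: "r \<in> set (rev [1..<Suc (length lam)])" and c: "c \<in> set [1..<Suc (part lam r)]"
      using d by (simp_all only: set_rev set_upt atLeastLessThan_iff less_Suc_eq_le conj_assoc simp_thms)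
    have "T r c \<in> set (map (T r) [1..<Suc (part lam r)])"
      unfolding set_map using c by (rule imageI)
    moreover have "map (T r) [1..<Suc (part lam r)]
        \<in> set (map (\<lambda>r. map (T r) [1..<Suc (part lam r)]) (rev [1..<Suc (length lam)]))"
      unfolding set_map using r by (rule imageI)
    ultimately have "T r c \<in> set (row_word lam T)"
      unfolding row_word_def set_concat by (intro UnionI) (rule imageI)
    then have "T r c \<in> {1..m}" using sub by (rule rev_subsetD)
    then show "T r c \<le> m" by simp
  qed
qed

lemma schur_rep_restr:
  assumes p: "is_partition lam"
  shows "free_restr m (schur_rep (Suc m) lam) = schur_rep m lam"
proof -
  have fin: "finite (ssyt (Suc m) lam)" unfolding ssyt_tableaux by (rule finite_tableaux[OF shape_of_shapes[OF p]])
  define f where "f T = signed (\<Sum>i\<leftarrow>row_word lam T. int (i - 1)) (frag_of (row_word lam T))" for T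
  have restr: "free_restr m (f T) = (if set (row_word lam T) \<subseteq> {1..m} then f T else 0)" for T
  proof (cases "set (row_word lam T) \<subseteq> {1..m}")
    case True
    then show ?thesis unfolding f_def free_restr_simps(4,6) by (simp only: if_True)
  next
    case False
    then show ?thesis unfolding f_def free_restr_simps(4,6) by (simp only: if_False signed_0)
  qed
  have "(\<Sum>T\<in>ssyt (Suc m) lam. free_restr m (f T)) = (\<Sum>T\<in>{T \<in> ssyt (Suc m) lam. set (row_word lam T) \<subseteq> {1..m}}. f T)"
    unfolding restr by (rule sum.inter_filter[OF fin, symmetric])
  then have "free_restr m (\<Sum>T\<in>ssyt (Suc m) lam. f T) = (\<Sum>T\<in>ssyt m lam. f T)"
    unfolding ssyt_restrict free_restr_sum .
  then have "free_restr m (signed (int (dN lam + N lam)) (\<Sum>T\<in>ssyt (Suc m) lam. f T))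
      = signed (int (dN lam + N lam)) (\<Sum>T\<in>ssyt m lam. f T)"
    unfolding free_restr_simps(4) by (rule arg_cong)
  then show ?thesis unfolding schur_rep_def f_def .
qed

section \<open>Hives\<close>

lemma integer_hives_iff:
  "H \<in> integer_hives n lam mu nu \<longleftrightarrow>
    (\<forall>i j. \<not> (i \<le> j \<and> j \<le> n) \<longrightarrow> H i j = 0) \<and> H 0 0 = 0 \<and>
    (\<forall>i j. 1 \<le> i \<and> i < j \<and> j \<le> n \<longrightarrow> H (i - 1) j - H (i - 1) (j - 1) \<le> H i j - H i (j - 1)) \<and>
    (\<forall>i j. 1 \<le> i \<and> i \<le> j \<and> j < n \<longrightarrow> H i (j + 1) - H i j \<le> H (i - 1) j - H (i - 1) (j - 1)) \<and>
    (\<forall>i j. 1 \<le> i \<and> i \<le> j \<and> j < n \<longrightarrow> H (i + 1) (j + 1) - H i (j + 1) \<le> H i j - H (i - 1) j) \<and>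
    (\<forall>j\<in>{1..n}. int (part lam j) = H j j - H (j - 1) (j - 1) \<and>
                int (part mu j) = H 0 j - H 0 (j - 1) \<and>
                int (part nu j) = H j n - H (j - 1) n)"
proof -
  have le: "real_of_int a - real_of_int b \<le> real_of_int c - real_of_int d \<longleftrightarrow> a - b \<le> c - d" for a b c d
    by linarith
  have eq: "real k = real_of_int a - real_of_int b \<longleftrightarrow> int k = a - b" for k a b
    by linarith
  show ?thesis
    unfolding integer_hives_def hives_def hive_def hive_space_def mem_Collect_eq le eq
    by (simp only: of_int_eq_0_iff conj_assoc)
qed

definition hive_of :: "nat \<Rightarrow> (nat \<Rightarrow> nat \<Rightarrow> int) \<Rightarrow> nat \<Rightarrow> nat \<Rightarrow> int" where
  "hive_of n c i j = (if i \<le> j \<and> j \<le> n then psum (c i) j else 0)"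

definition chain_of :: "nat \<Rightarrow> (nat \<Rightarrow> int) \<Rightarrow> (nat \<Rightarrow> nat \<Rightarrow> int) \<Rightarrow> nat \<Rightarrow> nat \<Rightarrow> int" where
  "chain_of n l H t r =
    (if t \<le> n then if r < t then l r else if r < n then H t (Suc r) - H t r else 0 else 0)"

text \<open>From chains to hives: row \<open>i\<close> of the hive consists of the partial sums of the \<open>i\<close>-th shape. The lattice
condition implies that the \<open>t\<close>-th strip has no boxes in the first \<open>t - 1\<close> rows, so the first \<open>t\<close> rows of
\<open>c t\<close> are already those of the last shape and can be left out of the hive.\<close>

locale lr_chain =
  fixes n :: nat and c :: "nat \<Rightarrow> nat \<Rightarrow> int" and mu nu l :: "nat \<Rightarrow> int"
  assumes chain: "c \<in> chains n nu mu" and end_: "c n = l"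
    and mu: "mu \<in> shapes" and bl: "bounded_by n l" and nu: "\<And>i. 0 \<le> nu i"
begin

lemma c_shapes: "t \<le> n \<Longrightarrow> c t \<in> shapes"
  by (rule chains_shapes[OF chain mu])

lemma c_strip: "t < n \<Longrightarrow> hstrip (c t) (c (Suc t))"
  and c_total: "t < n \<Longrightarrow> total (c (Suc t)) = total (c t) + nu t"
  using chain nu[of t] by (auto simp: chains_def up_def)

lemma c_le: "t < n \<Longrightarrow> c t r \<le> c (Suc t) r"
  using c_strip[of t] by (simp add: hstrip_def)

lemma c_bounded: "t \<le> n \<Longrightarrow> bounded_by n (c t)"
proof (induction t rule: inc_induct)
  case base
  show ?case using bl end_ by simp
next
  case (step t)
  have "c (Suc t) \<in> shapes" by (rule c_shapes) (use step in simp)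
  then show ?case using step hstrip_bounded_down[OF c_strip] by blast
qed

lemma psum_low_step: "t < n \<Longrightarrow> j \<le> t \<Longrightarrow> psum (c (Suc t)) j = psum (c t) j"
proof (induction t arbitrary: j)
  case (Suc t)
  show ?case
  proof (cases j)
    case (Suc i)
    have "lr_cond (c t) (c (Suc t)) (c (Suc (Suc t)))"
      using chain Suc.prems by (simp add: chains_def)
    then have "psum (c (Suc (Suc t))) (Suc i) - psum (c (Suc t)) (Suc i) \<le> psum (c (Suc t)) i - psum (c t) i"
      unfolding lr_cond_def by blast
    also have "psum (c (Suc t)) i - psum (c t) i = 0" using Suc.IH[of i] Suc.prems Suc by simp
    finally have "psum (c (Suc (Suc t))) j \<le> psum (c (Suc t)) j" using Suc by simp
    moreover have "psum (c (Suc t)) j \<le> psum (c (Suc (Suc t))) j"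
      unfolding psum_def by (rule sum_mono) (rule c_le[OF Suc.prems(1)])
    ultimately show ?thesis by simp
  qed simp
qed simp

lemma psum_low: "t \<le> n \<Longrightarrow> j \<le> t \<Longrightarrow> psum (c t) j = psum l j"
proof (induction t rule: inc_induct)
  case (step t)
  then show ?case using psum_low_step[of t j] by simp
qed (simp add: end_)

lemma c_low: "t \<le> n \<Longrightarrow> r < t \<Longrightarrow> c t r = l r"
  using psum_low[of t r] psum_low[of t "Suc r"] by simp

lemma hive_of_eq: "i \<le> j \<Longrightarrow> j \<le> n \<Longrightarrow> hive_of n c i j = psum (c i) j"
  by (simp add: hive_of_def)

lemma chain_of_hive_of: "chain_of n l (hive_of n c) = c"
proof (intro ext)
  fix t r
  consider "n < t" | "t \<le> n" "r < t" | "t \<le> n" "t \<le> r" "r < n" | "t \<le> n" "n \<le> r" "t \<le> r" by linarith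
  then show "chain_of n l (hive_of n c) t r = c t r"
  proof cases
    case 1
    then show ?thesis using chain by (simp add: chain_of_def chains_def)
  next
    case 2
    then show ?thesis by (simp add: chain_of_def c_low)
  next
    case 3
    then show ?thesis by (simp add: chain_of_def hive_of_eq)
  next
    case 4
    then show ?thesis using c_bounded[of t] by (simp add: chain_of_def bounded_by_def)
  qed
qed

text \<open>The summand for \<open>(i, j)\<close> is a partial sum of the shape \<open>i - 1\<close> times the number of boxes that the next strip
has in row \<open>j\<close>. On the diagonal the convention \<open>h\<^sub>i\<^sub>,\<^sub>i\<^sub>-\<^sub>1 = 0\<close> adds a square, which the last sum of
\<open>Q_hive\<close> removes.\<close>

lemma Q_hive_of: "Q_hive n (hive_of n c) = (\<Sum>t<n. b_exp (c t) (c (Suc t)))"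
proof -
  let ?H = "hive_of n c"
  have row: "(\<Sum>j=Suc t..n. ?H t (j - 1) * (?H (Suc t) j - ?H t j - ?H (Suc t) (j - 1) + ?H t (j - 1)))
      = b_exp (c t) (c (Suc t)) + (?H t t)\<^sup>2" if t: "t < n" for t
  proof -
    define g where "g r = psum (c t) r * (c (Suc t) r - c t r)" for r
    have img: "{Suc t..n} = Suc ` {t..<n}"
      by (simp only: image_Suc_atLeastLessThan atLeastLessThanSuc_atLeastAtMost)
    have "(\<Sum>j=Suc t..n. ?H t (j - 1) * (?H (Suc t) j - ?H t j - ?H (Suc t) (j - 1) + ?H t (j - 1)))
        = (\<Sum>r\<in>{t..<n}. ?H t r * (?H (Suc t) (Suc r) - ?H t (Suc r) - ?H (Suc t) r + ?H t r))"
      unfolding img by (subst sum.reindex) simp_all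
    also have "\<dots> = (\<Sum>r\<in>{t..<n}. g r + (if r = t then (?H t t)\<^sup>2 else 0))"
    proof (rule sum.cong[OF refl])
      fix r assume r: "r \<in> {t..<n}"
      show "?H t r * (?H (Suc t) (Suc r) - ?H t (Suc r) - ?H (Suc t) r + ?H t r)
          = g r + (if r = t then (?H t t)\<^sup>2 else 0)"
      proof (cases "r = t")
        case True
        have e: "psum (c (Suc t)) t = psum (c t) t" by (rule psum_low_step[OF t]) simp
        have z: "?H (Suc t) t = 0" by (simp add: hive_of_def)
        have h: "?H t t = psum (c t) t" "?H t (Suc t) = psum (c t) (Suc t)"
            "?H (Suc t) (Suc t) = psum (c (Suc t)) (Suc t)"
          using t by (simp_all only: hive_of_eq le_refl le_SucI Suc_leI less_imp_le)
        show ?thesis unfolding True z h g_def psum_Suc e by (simp add: algebra_simps power2_eq_square)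
      next
        case False
        then have "?H t r = psum (c t) r" "?H t (Suc r) = psum (c t) (Suc r)"
            "?H (Suc t) (Suc r) = psum (c (Suc t)) (Suc r)" "?H (Suc t) r = psum (c (Suc t)) r"
          using r by (simp_all only: hive_of_def atLeastLessThan_iff) simp_all
        then show ?thesis using False by (simp add: g_def)
      qed
    qed
    also have "\<dots> = sum g {t..<n} + (?H t t)\<^sup>2" using t by (simp add: sum.distrib)
    also have "sum g {t..<n} = sum g {..<n}"
    proof (rule sum.mono_neutral_left)
      show "\<forall>i\<in>{..<n} - {t..<n}. g i = 0"
        using t c_low[of t] c_low[of "Suc t"] by (auto simp: g_def)
    qed auto
    also have "sum g {..<n} = b_exp (c t) (c (Suc t))"
    proof -
      have "bounded_by n g"
        using c_bounded[of t] c_bounded[of "Suc t"] t by (simp add: bounded_by_def g_def)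
      then have "total g = psum g n" by (rule total_eq)
      then show ?thesis unfolding b_exp_def g_def psum_def by simp
    qed
    finally show ?thesis .
  qed
  have "(\<Sum>i=1..n. \<Sum>j=i..n. ?H (i - 1) (j - 1) * (?H i j - ?H (i - 1) j - ?H i (j - 1) + ?H (i - 1) (j - 1)))
      = (\<Sum>t<n. \<Sum>j=Suc t..n. ?H t (j - 1) * (?H (Suc t) j - ?H t j - ?H (Suc t) (j - 1) + ?H t (j - 1)))"
    unfolding One_nat_def sum.atLeast1_atMost_eq by simp
  also have "\<dots> = (\<Sum>t<n. b_exp (c t) (c (Suc t)) + (?H t t)\<^sup>2)"
    by (rule sum.cong[OF refl]) (rule row, simp)
  also have "\<dots> = (\<Sum>t<n. b_exp (c t) (c (Suc t))) + (\<Sum>t<n. (?H t t)\<^sup>2)" by (rule sum.distrib)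
  also have "(\<Sum>t<n. (?H t t)\<^sup>2) = (\<Sum>i=1..n-1. (?H i i)\<^sup>2)"
  proof (rule sum.mono_neutral_right)
    show "\<forall>i\<in>{..<n} - {1..n - 1}. (?H i i)\<^sup>2 = 0"
    proof
      fix i assume "i \<in> {..<n} - {1..n - 1}"
      then have "i = 0" by auto
      then show "(?H i i)\<^sup>2 = 0" by (simp add: hive_of_def)
    qed
  qed auto
  finally show ?thesis unfolding Q_hive_def by simp
qed

lemma hive_of_integer:
  assumes lam: "l = shape_of lam" and mu': "mu = shape_of mu'" and nu': "nu = shape_of nu'"
  shows "hive_of n c \<in> integer_hives n lam mu' nu'"
  unfolding integer_hives_iff
proof (intro conjI allI impI ballI)
  fix i j assume "\<not> (i \<le> j \<and> j \<le> n)"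
  then show "hive_of n c i j = 0" by (simp only: hive_of_def if_False)
next
  show "hive_of n c 0 0 = 0" by (simp add: hive_of_def)
next
  fix i j assume a: "1 \<le> i \<and> i < j \<and> j \<le> n"
  then obtain i' j' where ij: "i = Suc i'" "j = Suc j'" by (cases i; cases j) auto
  show "hive_of n c (i - 1) j - hive_of n c (i - 1) (j - 1) \<le> hive_of n c i j - hive_of n c i (j - 1)"
    using a ij c_le[of i' j'] by (simp add: hive_of_eq)
next
  fix i j assume a: "1 \<le> i \<and> i \<le> j \<and> j < n"
  then obtain i' j' where ij: "i = Suc i'" "j = Suc j'" by (cases i; cases j) auto
  have "c (Suc i') (Suc j') \<le> c i' j'" using c_strip[of i'] a ij by (simp add: hstrip_def)
  then show "hive_of n c i (j + 1) - hive_of n c i j \<le> hive_of n c (i - 1) j - hive_of n c (i - 1) (j - 1)"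
    using a ij by (simp add: hive_of_eq)
next
  fix i j assume a: "1 \<le> i \<and> i \<le> j \<and> j < n"
  then obtain i' where ij: "i = Suc i'" by (cases i) auto
  have "lr_cond (c i') (c (Suc i')) (c (Suc (Suc i')))" using chain a ij by (simp add: chains_def)
  then have "psum (c (Suc (Suc i'))) (Suc j) - psum (c (Suc i')) (Suc j) \<le> psum (c (Suc i')) j - psum (c i') j"
    unfolding lr_cond_def by blast
  then show "hive_of n c (i + 1) (j + 1) - hive_of n c i (j + 1) \<le> hive_of n c i j - hive_of n c (i - 1) j"
    using a ij by (simp add: hive_of_eq del: psum_Suc)
next
  fix j assume j: "j \<in> {1..n}"
  then obtain j' where j': "j = Suc j'" by (cases j) auto
  show "int (part lam j) = hive_of n c j j - hive_of n c (j - 1) (j - 1)"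
    using j j' psum_low[of "Suc j'" "Suc j'"] psum_low[of j' j'] lam
    by (simp add: hive_of_eq shape_of_def del: psum_Suc) (simp add: shape_of_def)
  have "c 0 = mu" using chain by (simp add: chains_def)
  then show "int (part mu' j) = hive_of n c 0 j - hive_of n c 0 (j - 1)"
    using j j' mu' by (simp add: hive_of_eq shape_of_def)
  have "psum (c (Suc j')) n = psum (c j') n + nu j'"
    using c_total[of j'] j j' total_eq[OF c_bounded, of "Suc j'"] total_eq[OF c_bounded, of j'] by simp
  then show "int (part nu' j) = hive_of n c j n - hive_of n c (j - 1) n"
    using j j' nu' by (simp add: hive_of_eq shape_of_def)
qed

end

text \<open>From hives to chains: the rows that the hive leaves out are those of the last shape.\<close>

locale int_hive =
  fixes n :: nat and H :: "nat \<Rightarrow> nat \<Rightarrow> int" and lam mu nu :: "nat list"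
  assumes hive: "H \<in> integer_hives n lam mu nu"
    and lam: "is_partition lam" "length lam \<le> n" and mu: "is_partition mu" "length mu \<le> n"
    and nu: "is_partition nu" "length nu \<le> n"
begin

abbreviation c where "c \<equiv> chain_of n (shape_of lam) H"

lemma H0: "\<not> (i \<le> j \<and> j \<le> n) \<Longrightarrow> H i j = 0" "H 0 0 = 0"
  and HR: "i < j \<Longrightarrow> j < n \<Longrightarrow> H i (Suc j) - H i j \<le> H (Suc i) (Suc j) - H (Suc i) j"
  and HV: "i \<le> j \<Longrightarrow> Suc j < n \<Longrightarrow> H (Suc i) (Suc (Suc j)) - H (Suc i) (Suc j) \<le> H i (Suc j) - H i j"
  and HL: "i < j \<Longrightarrow> j < n \<Longrightarrow> H (Suc (Suc i)) (Suc j) - H (Suc i) (Suc j) \<le> H (Suc i) j - H i j"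
  and Hlam: "j < n \<Longrightarrow> shape_of lam j = H (Suc j) (Suc j) - H j j"
  and Hmu: "j < n \<Longrightarrow> shape_of mu j = H 0 (Suc j) - H 0 j"
  and Hnu: "j < n \<Longrightarrow> shape_of nu j = H (Suc j) n - H j n"
proof -
  note h = hive[unfolded integer_hives_iff]
  show "\<not> (i \<le> j \<and> j \<le> n) \<Longrightarrow> H i j = 0" using h by blast
  show "H 0 0 = 0" using h by blast
  have "\<forall>i j. 1 \<le> i \<and> i < j \<and> j \<le> n \<longrightarrow> H (i - 1) j - H (i - 1) (j - 1) \<le> H i j - H i (j - 1)" using h by blast
  from this[rule_format, of "Suc i" "Suc j"]
  show "i < j \<Longrightarrow> j < n \<Longrightarrow> H i (Suc j) - H i j \<le> H (Suc i) (Suc j) - H (Suc i) j" by simp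
  have "\<forall>i j. 1 \<le> i \<and> i \<le> j \<and> j < n \<longrightarrow> H i (j + 1) - H i j \<le> H (i - 1) j - H (i - 1) (j - 1)" using h by blast
  from this[rule_format, of "Suc i" "Suc j"]
  show "i \<le> j \<Longrightarrow> Suc j < n \<Longrightarrow> H (Suc i) (Suc (Suc j)) - H (Suc i) (Suc j) \<le> H i (Suc j) - H i j" by simp
  have "\<forall>i j. 1 \<le> i \<and> i \<le> j \<and> j < n \<longrightarrow> H (i + 1) (j + 1) - H i (j + 1) \<le> H i j - H (i - 1) j" using h by blast
  from this[rule_format, of "Suc i" j]
  show "i < j \<Longrightarrow> j < n \<Longrightarrow> H (Suc (Suc i)) (Suc j) - H (Suc i) (Suc j) \<le> H (Suc i) j - H i j" by simp
  have "\<forall>j\<in>{1..n}. int (part lam j) = H j j - H (j - 1) (j - 1) \<and>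
                int (part mu j) = H 0 j - H 0 (j - 1) \<and> int (part nu j) = H j n - H (j - 1) n" using h by blast
  from bspec[OF this, of "Suc j"]
  show "j < n \<Longrightarrow> shape_of lam j = H (Suc j) (Suc j) - H j j" "j < n \<Longrightarrow> shape_of mu j = H 0 (Suc j) - H 0 j"
    "j < n \<Longrightarrow> shape_of nu j = H (Suc j) n - H j n" by (simp_all add: shape_of_def)
qed

lemma bounded: "bounded_by n (shape_of lam)" "bounded_by n (shape_of mu)" "bounded_by n (shape_of nu)"
  using bounded_by_mono[OF shape_of_bounded lam(2)] bounded_by_mono[OF shape_of_bounded mu(2)]
    bounded_by_mono[OF shape_of_bounded nu(2)] .

lemma psum_lam: "j \<le> n \<Longrightarrow> psum (shape_of lam) j = H j j"
proof (induction j)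
  case (Suc j)
  then show ?case using Hlam[of j] by simp
qed (simp add: H0)

lemma c_simps:
  "t \<le> n \<Longrightarrow> r < t \<Longrightarrow> c t r = shape_of lam r"
  "t \<le> r \<Longrightarrow> r < n \<Longrightarrow> c t r = H t (Suc r) - H t r"
  "n \<le> r \<Longrightarrow> c t r = 0"
  using bounded(1) by (auto simp: chain_of_def bounded_by_def)

lemma psum_c_low: "t \<le> n \<Longrightarrow> j \<le> t \<Longrightarrow> psum (c t) j = psum (shape_of lam) j"
  unfolding psum_def by (rule sum.cong) (simp_all add: c_simps)

lemma psum_c: "t \<le> j \<Longrightarrow> j \<le> n \<Longrightarrow> psum (c t) j = H t j"
proof (induction j rule: dec_induct)
  case base
  then show ?case using psum_c_low[of t t] psum_lam[of t] by simp
next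
  case (step j)
  then show ?case by (simp add: c_simps)
qed

lemma c_bounded: "bounded_by n (c t)"
  by (simp add: bounded_by_def c_simps)

lemma total_c: "t \<le> n \<Longrightarrow> total (c t) = H t n"
  by (simp add: total_eq[OF c_bounded] psum_c)

text \<open>The inequality (R) is not imposed on the diagonal. There it follows from (L), which bounds the
difference from below by \<open>\<nu>\<^sub>n\<close>.\<close>

lemma diag: "t < n \<Longrightarrow> H t (Suc t) \<le> H (Suc t) (Suc t)"
proof -
  have "0 \<le> H (Suc t) (Suc t) - H t (Suc t)" if "t \<le> n - 1" "0 < n" for t
    using that(1)
  proof (induction t rule: inc_induct)
    case base
    then show ?case using Hnu[of "n - 1"] shape_of_nonneg[of nu "n - 1"] that(2) by simp
  next
    case (step t)
    then have "Suc t < n" by linarith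
    then show ?case using HL[of t "Suc t"] step.IH by linarith
  qed
  from this[of t] show "t < n \<Longrightarrow> H t (Suc t) \<le> H (Suc t) (Suc t)" by simp
qed

lemma c_le: "t < n \<Longrightarrow> c t r \<le> c (Suc t) r"
proof -
  assume t: "t < n"
  consider "r < t" | "r = t" | "t < r" "r < n" | "n \<le> r" by linarith
  then show ?thesis
  proof cases
    case 1
    then show ?thesis using t by (simp add: c_simps)
  next
    case 2
    then show ?thesis using t diag[OF t] Hlam[OF t] by (simp add: c_simps)
  next
    case 3
    then show ?thesis using HR[of t r] by (simp add: c_simps)
  next
    case 4
    then show ?thesis by (simp add: c_simps)
  qed
qed

lemma c_zero: "c 0 = shape_of mu"
proof
  fix r
  show "c 0 r = shape_of mu r"
    using bounded(2) by (cases "r < n") (simp_all add: c_simps Hmu bounded_by_def)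
qed

lemma c_last: "c n = shape_of lam"
proof
  fix r
  show "c n r = shape_of lam r"
    using bounded(1) by (cases "r < n") (simp_all add: c_simps bounded_by_def)
qed

lemma c_nonneg: "t \<le> n \<Longrightarrow> 0 \<le> c t r"
proof (induction t)
  case 0
  show ?case by (simp add: c_zero shape_of_nonneg)
next
  case (Suc t)
  then show ?case using c_le[of t r] by simp
qed

lemma c_strip: "t < n \<Longrightarrow> hstrip (c t) (c (Suc t))"
proof -
  assume t: "t < n"
  have "c (Suc t) (Suc r) \<le> c t r" for r
  proof -
    consider "n \<le> Suc r" | "r < t" "Suc r < n" | "t \<le> r" "Suc r < n" by linarith
    then show ?thesis
    proof cases
      case 1
      then show ?thesis using c_nonneg[of t r] t by (simp add: c_simps)
    next
      case 2
      then show ?thesis using t shapes_antimono[OF shape_of_shapes[OF lam(1)], of r "Suc r"] by (simp add: c_simps)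
    next
      case 3
      then show ?thesis using HV[of t r] by (simp add: c_simps)
    qed
  qed
  then show ?thesis using c_le[OF t] by (simp add: hstrip_def)
qed

lemma c_lr: assumes t: "Suc t < n" shows "lr_cond (c t) (c (Suc t)) (c (Suc (Suc t)))"
  unfolding lr_cond_def
proof
  fix j
  consider "j \<le> t" | "t < j" "j < n" | "n \<le> j" by linarith
  then show "psum (c (Suc (Suc t))) (Suc j) - psum (c (Suc t)) (Suc j) \<le> psum (c (Suc t)) j - psum (c t) j"
  proof cases
    case 1
    then show ?thesis using t by (simp add: psum_c_low del: psum_Suc)
  next
    case 2
    then show ?thesis using t HL[of t j] by (simp add: psum_c del: psum_Suc)
  next
    case 3
    have big: "psum (c s) i = total (c s)" if "n \<le> i" for s i
      using total_eq[OF bounded_by_mono[OF c_bounded that], of s] by simp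
    have "shape_of nu (Suc t) \<le> shape_of nu t" by (rule shapes_antimono[OF shape_of_shapes[OF nu(1)]]) simp
    then show ?thesis using 3 t Hnu[of t] Hnu[of "Suc t"] by (simp add: big total_c del: psum_Suc)
  qed
qed

lemma chain_of_chains: "c \<in> chains n (shape_of nu) (shape_of mu)"
  unfolding chains_def
proof (intro CollectI conjI allI impI)
  show "c 0 = shape_of mu" by (rule c_zero)
next
  fix t assume t: "t < n"
  then show "c (Suc t) \<in> up (nat (shape_of nu t)) (c t)"
    using c_strip[OF t] Hnu[OF t] shape_of_nonneg[of nu t] by (simp add: up_def total_c)
next
  fix t assume "Suc t < n"
  then show "lr_cond (c t) (c (Suc t)) (c (Suc (Suc t)))" by (rule c_lr)
next
  fix t assume "n < t"
  then show "c t = (\<lambda>_. 0)" by (simp add: chain_of_def fun_eq_iff)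
qed

lemma hive_of_chain_of: "hive_of n c = H"
proof (intro ext)
  fix i j
  show "hive_of n c i j = H i j"
  proof (cases "i \<le> j \<and> j \<le> n")
    case True
    then show ?thesis by (simp add: hive_of_def psum_c)
  next
    case False
    then show ?thesis using H0(1)[OF False] by (auto simp: hive_of_def)
  qed
qed

end

theorem hive_chain_sum:
  assumes lam: "is_partition lam" "length lam \<le> n" and mu: "is_partition mu" "length mu \<le> n"
    and nu: "is_partition nu" "length nu \<le> n"
  shows "(\<Sum>H\<in>integer_hives n lam mu nu. neg_one_pow (Q_hive n H))
    = (\<Sum>c\<in>{c \<in> chains n (shape_of nu) (shape_of mu). c n = shape_of lam}. signed (\<Sum>t<n. b_exp (c t) (c (Suc t))) 1)"
proof (rule sum.reindex_bij_witness[where j = "chain_of n (shape_of lam)" and i = "hive_of n"], goal_cases)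
  case (1 H)
  then interpret int_hive n H lam mu nu by unfold_locales (use assms in auto)
  show ?case by (rule hive_of_chain_of)
next
  case (2 H)
  then interpret int_hive n H lam mu nu by unfold_locales (use assms in auto)
  show ?case using chain_of_chains c_last by simp
next
  case (3 c)
  then interpret lr_chain n c "shape_of mu" "shape_of nu" "shape_of lam"
    by unfold_locales (use assms shape_of_shapes bounded_by_mono[OF shape_of_bounded] shape_of_nonneg in auto)
  show ?case by (rule chain_of_hive_of)
next
  case (4 c)
  then interpret lr_chain n c "shape_of mu" "shape_of nu" "shape_of lam"
    by unfold_locales (use assms shape_of_shapes bounded_by_mono[OF shape_of_bounded] shape_of_nonneg in auto)
  show ?case by (rule hive_of_integer) simp_all
next
  case (5 H)
  then interpret h: int_hive n H lam mu nu by unfold_locales (use assms in auto)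
  interpret lr_chain n "chain_of n (shape_of lam) H" "shape_of mu" "shape_of nu" "shape_of lam"
    by unfold_locales (use h.chain_of_chains h.c_last assms shape_of_shapes bounded_by_mono[OF shape_of_bounded] shape_of_nonneg in auto)
  show ?case using Q_hive_of unfolding h.hive_of_chain_of
    by (simp add: neg_one_pow_def signed_def minus_one_power_iff even_nat_iff)
qed

section \<open>The statistics of a shape\<close>

lemma diagram_Sigma: "diagram lam = (SIGMA r:{1..length lam}. {1..part lam r})"
  by (auto simp: diagram_def)

lemma sum_part: "(\<Sum>i\<in>{1..r}. int (part lam i)) = psum (shape_of lam) r"
  unfolding One_nat_def sum.atLeast1_atMost_eq by (simp add: psum_def shape_of_def)

lemma sum_diagram: "(\<Sum>B\<in>diagram lam. int (f (fst B))) = psum (\<lambda>r. shape_of lam r * int (f (Suc r))) (length lam)"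
proof -
  have "(\<Sum>B\<in>diagram lam. int (f (fst B))) = (\<Sum>r\<in>{1..length lam}. \<Sum>c\<in>{1..part lam r}. int (f r))"
    unfolding diagram_Sigma by (subst sum.Sigma) (simp_all add: case_prod_unfold)
  also have "\<dots> = (\<Sum>r\<in>{1..length lam}. int (part lam r) * int (f r))" by simp
  also have "\<dots> = psum (\<lambda>r. shape_of lam r * int (f (Suc r))) (length lam)"
    unfolding One_nat_def sum.atLeast1_atMost_eq by (simp add: psum_def shape_of_def)
  finally show ?thesis .
qed

lemma N_shape_of: "int (N lam) = psum (\<lambda>r. psum (shape_of lam) r * shape_of lam r) (length lam)"
proof -
  define f where "f r = card {C \<in> diagram lam. fst C < r}" for r
  have f: "int (f (Suc r)) = psum (shape_of lam) r" if "r < length lam" for r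
  proof -
    have "{C \<in> diagram lam. fst C < Suc r} = (SIGMA i:{1..r}. {1..part lam i})"
      using that unfolding diagram_Sigma by auto
    then have "f (Suc r) = (\<Sum>i\<in>{1..r}. part lam i)" unfolding f_def by simp
    then show ?thesis using sum_part[of lam r] by simp
  qed
  have "int (N lam) = (\<Sum>B\<in>diagram lam. int (f (fst B)))" by (simp add: N_def f_def)
  also have "\<dots> = psum (\<lambda>r. shape_of lam r * int (f (Suc r))) (length lam)" by (rule sum_diagram)
  also have "\<dots> = psum (\<lambda>r. psum (shape_of lam) r * shape_of lam r) (length lam)"
    unfolding psum_def[of _ "length lam"] by (rule sum.cong) (simp_all add: f)
  finally show ?thesis .
qed

lemma dN_shape_of:
  assumes p: "is_partition lam"
  shows "int (dN lam) = psum (\<lambda>r. int r * shape_of lam r) (length lam)"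
proof -
  have col: "card {C \<in> diagram lam. snd C = snd B \<and> fst C < fst B} = fst B - 1" if B: "B \<in> diagram lam" for B
  proof -
    obtain r c where rc: "B = (r, c)" by (cases B)
    have b: "1 \<le> r" "r \<le> length lam" "1 \<le> c" "c \<le> part lam r" using B rc by (simp_all add: diagram_def)
    have up: "c \<le> part lam i" if "1 \<le> i" "i < r" for i
    proof -
      have "shape_of lam (r - 1) \<le> shape_of lam (i - 1)" by (rule shapes_antimono[OF shape_of_shapes[OF p]]) (use that in simp)
      then have "part lam r \<le> part lam i" using that b by (simp add: shape_of_def)
      with b show ?thesis by simp
    qed
    have "{C \<in> diagram lam. snd C = snd B \<and> fst C < fst B} = (\<lambda>i. (i, c)) ` {1..<r}"
    proof (intro equalityI subsetI)
      fix C assume "C \<in> (\<lambda>i. (i, c)) ` {1..<r}"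
      then obtain i where i: "C = (i, c)" "1 \<le> i" "i < r" by auto
      then show "C \<in> {C \<in> diagram lam. snd C = snd B \<and> fst C < fst B}"
        using up[OF i(2,3)] b rc by (simp add: diagram_def)
    next
      fix C assume "C \<in> {C \<in> diagram lam. snd C = snd B \<and> fst C < fst B}"
      then show "C \<in> (\<lambda>i. (i, c)) ` {1..<r}" using rc
        by (cases C) (simp add: diagram_def)
    qed
    then show ?thesis using rc by (simp add: card_image inj_on_def)
  qed
  define f where "f r = r - 1" for r :: nat
  have "int (dN lam) = (\<Sum>B\<in>diagram lam. int (f (fst B)))"
    unfolding dN_def of_nat_sum by (rule sum.cong[OF refl]) (simp add: col f_def)
  also have "\<dots> = psum (\<lambda>r. shape_of lam r * int (f (Suc r))) (length lam)" by (rule sum_diagram)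
  also have "\<dots> = psum (\<lambda>r. int r * shape_of lam r) (length lam)" by (simp add: f_def mult.commute)
  finally show ?thesis .
qed

lemma psum_extend:
  assumes "\<And>r. m \<le> r \<Longrightarrow> g r = 0" "m \<le> n" shows "psum g n = psum g m"
proof -
  have "bounded_by m g" "bounded_by n g" using assms by (simp_all add: bounded_by_def)
  then show ?thesis using total_eq by metis
qed

lemma stair_exp_shape_of:
  assumes "is_partition nu" "length nu \<le> n"
  shows "stair_exp n (shape_of nu) = int (N nu + dN nu)"
proof -
  have z: "shape_of nu r = 0" if "length nu \<le> r" for r using shape_of_bounded[of nu] that by (simp add: bounded_by_def)
  have "stair_exp n (shape_of nu) = psum (\<lambda>t. psum (shape_of nu) t * shape_of nu t) n + psum (\<lambda>t. int t * shape_of nu t) n"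
    unfolding stair_exp_def psum_def[of _ n] by (simp add: distrib_right sum.distrib)
  also have "psum (\<lambda>t. psum (shape_of nu) t * shape_of nu t) n = int (N nu)"
    unfolding N_shape_of by (rule psum_extend) (simp_all add: z assms)
  also have "psum (\<lambda>t. int t * shape_of nu t) n = int (dN nu)"
    unfolding dN_shape_of[OF assms(1)] by (rule psum_extend) (simp_all add: z assms)
  finally show ?thesis by simp
qed

text \<open>For a partition this is \<open>dN\<close>. It separates \<open>p_exp\<close> from \<open>b_exp\<close>, and its differences telescope along a
chain.\<close>

definition leg_sum :: "(nat \<Rightarrow> int) \<Rightarrow> int" where
  "leg_sum l = total (\<lambda>r. int r * l r)"

lemma leg_sum_shape_of: "is_partition lam \<Longrightarrow> leg_sum (shape_of lam) = int (dN lam)"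
  unfolding leg_sum_def dN_shape_of
  by (rule total_eq) (use shape_of_bounded[of lam] in \<open>simp add: bounded_by_def\<close>)

lemma p_exp_split:
  assumes "l \<in> shapes" "hstrip l k"
  shows "p_exp l k = b_exp l k + leg_sum k - leg_sum l"
proof -
  have ks: "k \<in> shapes" using assms hstrip_shapes_up by blast
  obtain n where n: "bounded_by n k" using ks shapes_bounded by blast
  have nl: "bounded_by n l" by (rule hstrip_bounded_down[OF assms(2) ks n])
  note z = n[unfolded bounded_by_def] nl[unfolded bounded_by_def]
  have e: "p_exp l k = psum (\<lambda>r. (psum l r + int r) * (k r - l r)) n"
    "b_exp l k = psum (\<lambda>r. psum l r * (k r - l r)) n"
    "leg_sum k = psum (\<lambda>r. int r * k r) n" "leg_sum l = psum (\<lambda>r. int r * l r) n"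
    unfolding p_exp_def b_exp_def leg_sum_def by (rule total_eq; simp add: z bounded_by_def)+
  show ?thesis unfolding e psum_def[of _ n]
    by (simp add: algebra_simps sum.distrib sum_subtractf)
qed

definition b_sum :: "nat \<Rightarrow> (nat \<Rightarrow> nat \<Rightarrow> int) \<Rightarrow> int" where
  "b_sum n c = (\<Sum>t<n. b_exp (c t) (c (Suc t)))"

lemma chain_exp_split:
  assumes c: "c \<in> chains n nu mu" and mu: "mu \<in> shapes"
  shows "chain_exp n c = b_sum n c + leg_sum (c n) - leg_sum mu"
proof -
  have "(\<Sum>t<m. p_exp (c t) (c (Suc t))) = (\<Sum>t<m. b_exp (c t) (c (Suc t))) + leg_sum (c m) - leg_sum mu"
    if "m \<le> n" for m
    using that
  proof (induction m)
    case 0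
    then show ?case using c by (simp add: chains_def)
  next
    case (Suc m)
    have "c m \<in> shapes" using chains_shapes[OF c mu] Suc.prems by simp
    moreover have "hstrip (c m) (c (Suc m))" using c Suc.prems by (simp add: chains_def up_def)
    ultimately show ?case using Suc by (simp add: p_exp_split)
  qed
  then show ?thesis unfolding chain_exp_def b_sum_def by simp
qed

section \<open>The expansion of a product\<close>

text \<open>The right side of the theorem with chains in place of hives, extended by 0 to all lists. The number
\<open>n\<close> is the number of steps of the chains, a bound for the length of \<open>nu\<close>; the expansion of a product also
contains partitions with more than \<open>n\<close> parts.\<close>

definition lr_coeff :: "nat \<Rightarrow> nat list \<Rightarrow> nat list \<Rightarrow> nat list \<Rightarrow> int" where
  "lr_coeff n mu nu lam = (if is_partition lam
     then signed (int (N mu + N lam)) (\<Sum>c\<in>{c \<in> chains n (shape_of nu) (shape_of mu). c n = shape_of lam}. signed (b_sum n c) 1)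
     else 0)"

definition partition_of :: "(nat \<Rightarrow> int) \<Rightarrow> nat list" where
  "partition_of l = (SOME lam. is_partition lam \<and> shape_of lam = l)"

lemma partition_of: "l \<in> shapes \<Longrightarrow> is_partition (partition_of l)" "l \<in> shapes \<Longrightarrow> shape_of (partition_of l) = l"
  using someI_ex[OF shape_of_surj] unfolding partition_of_def by blast+

lemma partition_of_shape_of: "is_partition lam \<Longrightarrow> partition_of (shape_of lam) = lam"
  using partition_of[OF shape_of_shapes] shape_of_inj by blast

lemma signed_of_int: "signed k x = of_int (signed k 1) * (x :: 'a::ring_1)"
  by (simp add: signed_def)

lemma lr_coeff_support:
  assumes mu: "is_partition mu"
  shows "finite {al. lr_coeff n mu nu al \<noteq> 0}"
    and "{al. lr_coeff n mu nu al \<noteq> 0} \<subseteq> (\<lambda>c. partition_of (c n)) ` chains n (shape_of nu) (shape_of mu)"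
proof -
  show sub: "{al. lr_coeff n mu nu al \<noteq> 0} \<subseteq> (\<lambda>c. partition_of (c n)) ` chains n (shape_of nu) (shape_of mu)"
  proof
    fix al assume "al \<in> {al. lr_coeff n mu nu al \<noteq> 0}"
    then have al: "is_partition al" by (auto simp: lr_coeff_def split: if_splits)
    have "{c \<in> chains n (shape_of nu) (shape_of mu). c n = shape_of al} \<noteq> {}"
    proof
      assume "{c \<in> chains n (shape_of nu) (shape_of mu). c n = shape_of al} = {}"
      then have "lr_coeff n mu nu al = 0" unfolding lr_coeff_def by (simp only: sum.empty signed_0 if_cancel)
      with \<open>al \<in> {al. lr_coeff n mu nu al \<noteq> 0}\<close> show False by simp
    qed
    then obtain c where c: "c \<in> chains n (shape_of nu) (shape_of mu)" "c n = shape_of al" by blast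
    then have "al = partition_of (c n)" using partition_of_shape_of[OF al] by simp
    with c(1) show "al \<in> (\<lambda>c. partition_of (c n)) ` chains n (shape_of nu) (shape_of mu)" by blast
  qed
  show "finite {al. lr_coeff n mu nu al \<noteq> 0}"
    by (rule finite_subset[OF sub finite_imageI[OF finite_chains[OF shape_of_shapes[OF mu]]]])
qed

theorem schur_product:
  assumes mu: "is_partition mu" and nu: "is_partition nu" "length nu \<le> n"
  shows "to_model (odd_schur mu m) * to_model (odd_schur nu m)
    = (\<Sum>al\<in>{al. lr_coeff n mu nu al \<noteq> 0}. of_int (lr_coeff n mu nu al) * to_model (odd_schur al m))"
proof -
  let ?C = "chains n (shape_of nu) (shape_of mu)"
  have fin: "finite ?C" by (rule finite_chains[OF shape_of_shapes[OF mu]])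
  have end_shape: "c n \<in> shapes" if "c \<in> ?C" for c using chains_shapes[OF that shape_of_shapes[OF mu]] by simp
  define T where "T = (\<lambda>c. partition_of (c n)) ` ?C"
  define h where "h c = signed (int (N mu) + int (N (partition_of (c n))) + b_sum n c) (to_model (odd_schur (partition_of (c n)) m))" for c
  have bn: "bounded_by n (shape_of nu)" by (rule bounded_by_mono[OF shape_of_bounded nu(2)])
  have "to_model (odd_schur mu m) * to_model (odd_schur nu m)
      = signed (int (dN mu + N mu) + int (dN nu + N nu)) (xt.schur_poly m (shape_of mu) * xt.schur_poly m (shape_of nu))"
    by (simp add: to_model_schur mu nu(1) add.commute)
  also have "\<dots> = (\<Sum>c\<in>?C. h c)"
    unfolding xt.schur_poly_mult[OF shape_of_shapes[OF mu] shape_of_shapes[OF nu(1)] bn] signed_sum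
  proof (rule sum.cong[OF refl])
    fix c assume c: "c \<in> ?C"
    define lam where "lam = partition_of (c n)"
    have lam: "is_partition lam" "shape_of lam = c n" unfolding lam_def using partition_of[OF end_shape[OF c]] by auto
    have ch: "chain_exp n c = b_sum n c + int (dN lam) - int (dN mu)"
      using chain_exp_split[OF c shape_of_shapes[OF mu]] leg_sum_shape_of[OF lam(1)] leg_sum_shape_of[OF mu] lam(2) by simp
    have "h c = signed (int (N mu) + int (N lam) + b_sum n c + (int (dN lam) + int (N lam))) (xt.schur_poly m (c n))"
      unfolding h_def lam_def[symmetric] to_model_schur[OF lam(1)] lam(2) by simp
    moreover have "even ((int (dN mu + N mu) + int (dN nu + N nu)) + (int (N nu + dN nu) + chain_exp n c)
        + (int (N mu) + int (N lam) + b_sum n c + (int (dN lam) + int (N lam))))"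
      unfolding ch by simp
    ultimately show "signed (int (dN mu + N mu) + int (dN nu + N nu))
        (signed (stair_exp n (shape_of nu) + chain_exp n c) (xt.schur_poly m (c n))) = h c"
      unfolding stair_exp_shape_of[OF nu] signed_signed by (simp only: signed_cong)
  qed
  also have "\<dots> = (\<Sum>al\<in>T. \<Sum>c\<in>{c \<in> ?C. partition_of (c n) = al}. h c)"
    by (rule sum.group[symmetric]) (use fin in \<open>auto simp: T_def\<close>)
  also have "\<dots> = (\<Sum>al\<in>T. of_int (lr_coeff n mu nu al) * to_model (odd_schur al m))"
  proof (rule sum.cong[OF refl])
    fix al assume "al \<in> T"
    then have al: "is_partition al" unfolding T_def using partition_of(1)[OF end_shape] by auto
    have set: "{c \<in> ?C. partition_of (c n) = al} = {c \<in> ?C. c n = shape_of al}"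
      using partition_of(2)[OF end_shape] partition_of_shape_of[OF al] by auto
    have "(\<Sum>c\<in>{c \<in> ?C. partition_of (c n) = al}. h c)
        = (\<Sum>c\<in>{c \<in> ?C. c n = shape_of al}. of_int (signed (int (N mu + N al)) (signed (b_sum n c) 1)) * to_model (odd_schur al m))"
      unfolding set
    proof (rule sum.cong[OF refl])
      fix c assume "c \<in> {c \<in> ?C. c n = shape_of al}"
      then have "partition_of (c n) = al" using partition_of_shape_of[OF al] by simp
      then show "h c = of_int (signed (int (N mu + N al)) (signed (b_sum n c) 1)) * to_model (odd_schur al m)"
        unfolding h_def signed_signed signed_of_int[symmetric] by simp
    qed
    also have "\<dots> = of_int (lr_coeff n mu nu al) * to_model (odd_schur al m)"
      unfolding lr_coeff_def signed_sum using al by (simp only: if_True of_int_sum sum_distrib_right)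
    finally show "(\<Sum>c\<in>{c \<in> ?C. partition_of (c n) = al}. h c) = of_int (lr_coeff n mu nu al) * to_model (odd_schur al m)" .
  qed
  also have "\<dots> = (\<Sum>al\<in>{al. lr_coeff n mu nu al \<noteq> 0}. of_int (lr_coeff n mu nu al) * to_model (odd_schur al m))"
  proof (rule sum.mono_neutral_right)
    show "finite T" unfolding T_def using fin by simp
    show "{al. lr_coeff n mu nu al \<noteq> 0} \<subseteq> T" unfolding T_def by (rule lr_coeff_support(2)[OF mu])
  qed auto
  finally show ?thesis .
qed

text \<open>All the partitions involved have at most \<open>m\<close> parts for the \<open>m\<close> chosen here, so that their Schur
polynomials in \<open>m\<close> variables are independent.\<close>

theorem schur_independent:
  assumes S: "finite S" "\<And>al. al \<in> S \<Longrightarrow> is_partition al"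
    and zero: "\<And>m. (\<Sum>al\<in>S. of_int (d al) * to_model (odd_schur al m)) = 0" and al: "al \<in> S"
  shows "d al = (0 :: int)"
proof -
  \<comment> \<open>Enough variables for all partitions in S.\<close>
  define m where "m = Max (length ` S)"
  have len: "length b \<le> m" if "b \<in> S" for b unfolding m_def using S(1) that by simp
  define a where "a l = signed (int (dN (partition_of l) + N (partition_of l))) (rat_of_int (d (partition_of l)))" for l
  have inj: "inj_on shape_of S" using S(2) shape_of_inj by (auto intro: inj_onI)
  have "a (shape_of al) = 0"
  proof (rule xt.schur_poly_independent[of "shape_of ` S" m])
    show "finite (shape_of ` S)" using S(1) by simp
    show "l \<in> shapes \<and> bounded_by m l" if "l \<in> shape_of ` S" for l
      using that S(2) shape_of_shapes bounded_by_mono[OF shape_of_bounded len] by auto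
    show "shape_of al \<in> shape_of ` S" using al by simp
    fix c
    have "0 = mcoef c (\<Sum>b\<in>S. of_int (d b) * to_model (odd_schur b m))" unfolding zero by (simp add: xt.coef_0)
    also have "\<dots> = (\<Sum>b\<in>S. a (shape_of b) * mcoef c (xt.schur_poly m (shape_of b)))"
      unfolding xt.coef_sum xt.coef_of_int
      by (rule sum.cong[OF refl]) (simp add: to_model_schur S(2) xt.coef_signed a_def partition_of_shape_of)
    also have "\<dots> = (\<Sum>l\<in>shape_of ` S. a l * mcoef c (xt.schur_poly m l))" by (simp add: sum.reindex[OF inj])
    finally show "(\<Sum>l\<in>shape_of ` S. a l * mcoef c (xt.schur_poly m l)) = 0" by simp
  qed
  then have "signed (int (dN al + N al)) (rat_of_int (d al)) = 0" by (simp only: a_def partition_of_shape_of[OF S(2)[OF al]])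
  then show ?thesis by (simp add: signed_def split: if_splits)
qed

section \<open>The ring of odd symmetric functions\<close>

lemma complete_subset: "{odd_complete m k | k. k \<ge> 1} \<subseteq> carrier (OPol m)"
  using odd_complete(1) by blast

lemma OLam_fin_carrier: "C \<in> OLam_fin m \<Longrightarrow> C \<in> carrier (OPol m)"
  unfolding OLam_fin_def by (rule ring.generate_ring_in_carrier[OF OPol_ring complete_subset])

text \<open>Membership in a generated subring is transported to the model, where the Pieri induction applies.\<close>

lemma schur_OLam_fin:
  assumes p: "is_partition lam" shows "odd_schur lam m \<in> OLam_fin m"
proof -
  let ?G = "to_model ` OLam_fin m"
  interpret R: ring "OPol m" by (rule OPol_ring)
  have neg: "- x \<in> ?G" if x: "x \<in> ?G" for x
  proof -
    obtain C where C: "C \<in> OLam_fin m" "x = to_model C" using x by blast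
    have "\<ominus>\<^bsub>OPol m\<^esub> C \<in> OLam_fin m" using C(1) unfolding OLam_fin_def by (rule generate_ring.a_inv)
    then show ?thesis using to_model_minus[OF OLam_fin_carrier[OF C(1)]] C(2) by (intro image_eqI[of _ _ "\<ominus>\<^bsub>OPol m\<^esub> C"]) simp_all
  qed
  have "xt.schur_poly m (shape_of lam) \<in> ?G"
  proof (rule xt.schur_poly_generated[OF shape_of_shapes[OF p]])
    have "\<one>\<^bsub>OPol m\<^esub> \<in> OLam_fin m" unfolding OLam_fin_def by (rule generate_ring.one)
    then show "1 \<in> ?G" by (intro image_eqI[of _ _ "\<one>\<^bsub>OPol m\<^esub>"]) (simp_all add: to_model_simps)
  next
    fix x y assume "x \<in> ?G" "y \<in> ?G"
    then obtain C D where CD: "C \<in> OLam_fin m" "x = to_model C" "D \<in> OLam_fin m" "y = to_model D" by blast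
    have "C \<oplus>\<^bsub>OPol m\<^esub> D \<in> OLam_fin m" using CD unfolding OLam_fin_def by (intro generate_ring.eng_add)
    then show "x + y \<in> ?G" using to_model_simps(1)[OF OLam_fin_carrier OLam_fin_carrier, OF CD(1,3)] CD(2,4)
      by (intro image_eqI[of _ _ "C \<oplus>\<^bsub>OPol m\<^esub> D"]) simp_all
  next
    fix x k assume x: "x \<in> ?G"
    show "x * xt.complete_poly m k \<in> ?G"
    proof (cases "k = 0")
      case True
      have "sorted_words m 0 = {[]}" by (auto simp: sorted_words_def)
      then have "xt.complete_poly m 0 = 1" unfolding xt.complete_poly_words by simp
      then show ?thesis using x True by simp
    next
      case False
      obtain C where C: "C \<in> OLam_fin m" "x = to_model C" using x by blast
      have "odd_complete m k \<in> OLam_fin m"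
        unfolding OLam_fin_def by (rule generate_ring.incl) (use False in auto)
      then have "C \<otimes>\<^bsub>OPol m\<^esub> odd_complete m k \<in> OLam_fin m"
        using C unfolding OLam_fin_def by (intro generate_ring.eng_mult)
      then show ?thesis
        using to_model_simps(2)[OF OLam_fin_carrier[OF C(1)] odd_complete(1)[of m k]] C(2) odd_complete(2)[of m k]
        by (intro image_eqI[of _ _ "C \<otimes>\<^bsub>OPol m\<^esub> odd_complete m k"]) simp_all
    qed
  qed (rule neg)
  then have "to_model (odd_schur lam m) \<in> ?G" unfolding to_model_schur[OF p] using neg by (simp add: signed_def)
  then obtain C where C: "C \<in> OLam_fin m" "to_model (odd_schur lam m) = to_model C" by blast
  then have "odd_schur lam m = C" using to_model_inj[OF odd_schur_carrier[OF p] OLam_fin_carrier] by blast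
  with C(1) show ?thesis by simp
qed

definition hom_words :: "nat \<Rightarrow> nat \<Rightarrow> (nat list \<Rightarrow>\<^sub>0 int) set" where
  "hom_words m k = {p \<in> carrier (free_ring m). \<forall>w \<in> Poly_Mapping.keys p. length w = k}"

lemma hom_words_closed:
  "p \<in> hom_words m k \<Longrightarrow> q \<in> hom_words m k \<Longrightarrow> p + q \<in> hom_words m k"
  "p \<in> hom_words m k \<Longrightarrow> - p \<in> hom_words m k" "0 \<in> hom_words m k"
proof -
  assume pq: "p \<in> hom_words m k" "q \<in> hom_words m k"
  have "Poly_Mapping.keys (p + q) \<subseteq> Poly_Mapping.keys p \<union> Poly_Mapping.keys q" by (rule Poly_Mapping.keys_add)
  then show "p + q \<in> hom_words m k" using pq free_closed(1)[of p m q] unfolding hom_words_def by blast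
next
  have "Poly_Mapping.keys (- p) = Poly_Mapping.keys p" by (auto simp: in_keys_iff)
  then show "p \<in> hom_words m k \<Longrightarrow> - p \<in> hom_words m k" using free_closed(2)[of p m] by (simp add: hom_words_def)
  show "0 \<in> hom_words m k" by (simp add: hom_words_def free_closed)
qed

lemma hom_words_signed: "p \<in> hom_words m k \<Longrightarrow> signed s p \<in> hom_words m k"
  by (simp add: signed_def hom_words_closed)

lemma hom_words_sum: "(\<And>a. a \<in> A \<Longrightarrow> f a \<in> hom_words m k) \<Longrightarrow> sum f A \<in> hom_words m k"
  by (induction A rule: infinite_finite_induct) (simp_all add: hom_words_closed)

lemma opol_homog_alt: "opol_homog m k = opol_class m ` hom_words m k"
  by (simp add: opol_homog_def hom_words_def)

lemma hom_words_carrier: "p \<in> hom_words m k \<Longrightarrow> p \<in> carrier (free_ring m)"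
  by (simp add: hom_words_def)

lemma class_add: "p \<in> carrier (free_ring m) \<Longrightarrow> q \<in> carrier (free_ring m) \<Longrightarrow>
    opol_class m p \<oplus>\<^bsub>OPol m\<^esub> opol_class m q = opol_class m (p + q)"
proof (rule to_model_inj[of _ m])
  assume a: "p \<in> carrier (free_ring m)" "q \<in> carrier (free_ring m)"
  interpret R: ring "OPol m" by (rule OPol_ring)
  show "opol_class m p \<oplus>\<^bsub>OPol m\<^esub> opol_class m q \<in> carrier (OPol m)" using a by (simp add: class_carrier)
  show "opol_class m (p + q) \<in> carrier (OPol m)" using a by (simp add: class_carrier free_closed)
  show "to_model (opol_class m p \<oplus>\<^bsub>OPol m\<^esub> opol_class m q) = to_model (opol_class m (p + q))"
    using a by (simp add: to_model_simps class_carrier to_model_class free_closed ev_add)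
qed

lemma class_minus: "p \<in> carrier (free_ring m) \<Longrightarrow> \<ominus>\<^bsub>OPol m\<^esub> opol_class m p = opol_class m (- p)"
proof (rule to_model_inj[of _ m])
  assume a: "p \<in> carrier (free_ring m)"
  interpret R: ring "OPol m" by (rule OPol_ring)
  show "\<ominus>\<^bsub>OPol m\<^esub> opol_class m p \<in> carrier (OPol m)" using a by (simp add: class_carrier)
  show "opol_class m (- p) \<in> carrier (OPol m)" using a by (simp add: class_carrier free_closed)
  show "to_model (\<ominus>\<^bsub>OPol m\<^esub> opol_class m p) = to_model (opol_class m (- p))"
    using a by (simp add: to_model_minus class_carrier to_model_class free_closed ev_minus)
qed

lemma class_zero: "\<zero>\<^bsub>OPol m\<^esub> = opol_class m 0"
proof (rule to_model_inj[of _ m])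
  interpret R: ring "OPol m" by (rule OPol_ring)
  show "\<zero>\<^bsub>OPol m\<^esub> \<in> carrier (OPol m)" by simp
qed (simp_all add: class_carrier free_closed to_model_class to_model_zero)

lemma olam_homog_carrier: "f \<in> olam_homog k \<Longrightarrow> f m \<in> carrier (OPol m)"
  unfolding olam_homog_def using OLam_fin_carrier by blast

lemma olam_homog_closed:
  "f \<in> olam_homog k \<Longrightarrow> g \<in> olam_homog k \<Longrightarrow> (\<lambda>m. f m \<oplus>\<^bsub>OPol m\<^esub> g m) \<in> olam_homog k"
  "f \<in> olam_homog k \<Longrightarrow> (\<lambda>m. \<ominus>\<^bsub>OPol m\<^esub> f m) \<in> olam_homog k"
  "(\<lambda>m. \<zero>\<^bsub>OPol m\<^esub>) \<in> olam_homog k"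
proof -
  have rep: "\<exists>p. \<forall>m. p m \<in> hom_words m k \<and> f m = opol_class m (p m)" if "f \<in> olam_homog k" for f
  proof -
    have "\<forall>m. \<exists>p. p \<in> hom_words m k \<and> f m = opol_class m p"
      using that unfolding olam_homog_def opol_homog_alt by blast
    then show ?thesis by (rule choice)
  qed
  show "(\<lambda>m. f m \<oplus>\<^bsub>OPol m\<^esub> g m) \<in> olam_homog k" if f: "f \<in> olam_homog k" and g: "g \<in> olam_homog k"
  proof -
    obtain p q where p: "\<And>m. p m \<in> hom_words m k" "\<And>m. f m = opol_class m (p m)"
      and q: "\<And>m. q m \<in> hom_words m k" "\<And>m. g m = opol_class m (q m)"
      using rep[OF f] rep[OF g] by blast
    note c = hom_words_carrier[OF p(1)] hom_words_carrier[OF q(1)]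
    have sum: "f m \<oplus>\<^bsub>OPol m\<^esub> g m = opol_class m (p m + q m)" for m
      unfolding p(2) q(2) by (rule class_add[OF c])
    show ?thesis
      unfolding olam_homog_def
    proof (intro CollectI allI conjI IntI)
      fix m
      have "f m \<in> OLam_fin m" "g m \<in> OLam_fin m" using f g unfolding olam_homog_def by blast+
      then show "f m \<oplus>\<^bsub>OPol m\<^esub> g m \<in> OLam_fin m" unfolding OLam_fin_def by (rule generate_ring.eng_add)
      show "f m \<oplus>\<^bsub>OPol m\<^esub> g m \<in> opol_homog m k"
        unfolding sum opol_homog_alt by (intro imageI hom_words_closed p q)
      have r: "opol_restr m (f (Suc m)) = f m" "opol_restr m (g (Suc m)) = g m"
        using f g unfolding olam_homog_def by blast+
      have "opol_restr m (f (Suc m) \<oplus>\<^bsub>OPol (Suc m)\<^esub> g (Suc m))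
          = opol_class m (free_restr m (p (Suc m)) + free_restr m (q (Suc m)))"
        unfolding sum opol_restr_class[OF free_closed(1)[OF c]] free_restr_simps(1) ..
      also have "\<dots> = opol_restr m (f (Suc m)) \<oplus>\<^bsub>OPol m\<^esub> opol_restr m (g (Suc m))"
        unfolding p(2) q(2) opol_restr_class[OF c(1)] opol_restr_class[OF c(2)]
        by (rule class_add[OF free_restr_carrier free_restr_carrier, symmetric])
      finally show "opol_restr m (f (Suc m) \<oplus>\<^bsub>OPol (Suc m)\<^esub> g (Suc m)) = f m \<oplus>\<^bsub>OPol m\<^esub> g m"
        unfolding r .
    qed
  qed
  show "(\<lambda>m. \<ominus>\<^bsub>OPol m\<^esub> f m) \<in> olam_homog k" if f: "f \<in> olam_homog k"
  proof -
    obtain p where p: "\<And>m. p m \<in> hom_words m k" "\<And>m. f m = opol_class m (p m)" using rep[OF f] by blast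
    note c = hom_words_carrier[OF p(1)]
    have neg: "\<ominus>\<^bsub>OPol m\<^esub> f m = opol_class m (- p m)" for m unfolding p(2) by (rule class_minus[OF c])
    show ?thesis
      unfolding olam_homog_def
    proof (intro CollectI allI conjI IntI)
      fix m
      have "f m \<in> OLam_fin m" using f unfolding olam_homog_def by blast
      then show "\<ominus>\<^bsub>OPol m\<^esub> f m \<in> OLam_fin m" unfolding OLam_fin_def by (rule generate_ring.a_inv)
      show "\<ominus>\<^bsub>OPol m\<^esub> f m \<in> opol_homog m k"
        unfolding neg opol_homog_alt by (intro imageI hom_words_closed p)
      have r: "opol_restr m (f (Suc m)) = f m" using f unfolding olam_homog_def by blast
      have "opol_restr m (\<ominus>\<^bsub>OPol (Suc m)\<^esub> f (Suc m)) = opol_class m (- free_restr m (p (Suc m)))"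
        unfolding neg opol_restr_class[OF free_closed(2)[OF c]] free_restr_simps(3) ..
      also have "\<dots> = \<ominus>\<^bsub>OPol m\<^esub> opol_restr m (f (Suc m))"
        unfolding p(2) opol_restr_class[OF c] by (rule class_minus[OF free_restr_carrier, symmetric])
      finally show "opol_restr m (\<ominus>\<^bsub>OPol (Suc m)\<^esub> f (Suc m)) = \<ominus>\<^bsub>OPol m\<^esub> f m" unfolding r .
    qed
  qed
  show "(\<lambda>m. \<zero>\<^bsub>OPol m\<^esub>) \<in> olam_homog k"
    unfolding olam_homog_def
  proof (intro CollectI allI conjI IntI)
    fix m
    show "\<zero>\<^bsub>OPol m\<^esub> \<in> OLam_fin m" unfolding OLam_fin_def by (rule ring.zero_in_generate[OF OPol_ring])
    show "\<zero>\<^bsub>OPol m\<^esub> \<in> opol_homog m k" unfolding class_zero opol_homog_alt by (intro imageI hom_words_closed)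
    show "opol_restr m \<zero>\<^bsub>OPol (Suc m)\<^esub> = \<zero>\<^bsub>OPol m\<^esub>"
      unfolding class_zero opol_restr_class[OF free_closed(5)] free_restr_simps(5) ..
  qed
qed

lemma OLam_simps:
  "f \<oplus>\<^bsub>OLam\<^esub> g = (\<lambda>m. f m \<oplus>\<^bsub>OPol m\<^esub> g m)" "\<zero>\<^bsub>OLam\<^esub> = (\<lambda>m. \<zero>\<^bsub>OPol m\<^esub>)"
  "f \<otimes>\<^bsub>OLam\<^esub> g = (\<lambda>m. f m \<otimes>\<^bsub>OPol m\<^esub> g m)"
  by (simp_all add: OLam_def)

lemma OLam_carrier: "f \<in> carrier OLam \<longleftrightarrow> (\<exists>d g. (\<forall>k\<le>d. g k \<in> olam_homog k) \<and>
    (\<forall>m. f m = (\<Oplus>\<^bsub>OPol m\<^esub> k \<in> {..d}. g k m)))"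
  by (simp add: OLam_def)

lemma OLam_component: "f \<in> carrier OLam \<Longrightarrow> f m \<in> carrier (OPol m)"
proof -
  assume "f \<in> carrier OLam"
  then obtain d g where g: "\<And>k. k \<le> d \<Longrightarrow> g k \<in> olam_homog k" "f m = (\<Oplus>\<^bsub>OPol m\<^esub> k \<in> {..d}. g k m)"
    unfolding OLam_carrier by blast
  interpret R: ring "OPol m" by (rule OPol_ring)
  show ?thesis unfolding g(2) by (rule R.finsum_closed) (use olam_homog_carrier[OF g(1)] in auto)
qed

lemma OLam_homog: "f \<in> olam_homog k \<Longrightarrow> f \<in> carrier OLam"
proof -
  assume f: "f \<in> olam_homog k"
  define g where "g j = (if j = k then f else (\<lambda>m. \<zero>\<^bsub>OPol m\<^esub>))" for j
  have g: "g j \<in> olam_homog j" for j using f olam_homog_closed(3) by (simp add: g_def)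
  have "f m = (\<Oplus>\<^bsub>OPol m\<^esub> j \<in> {..k}. g j m)" for m
  proof (rule to_model_inj[OF olam_homog_carrier[OF f]])
    interpret R: ring "OPol m" by (rule OPol_ring)
    show "(\<Oplus>\<^bsub>OPol m\<^esub> j \<in> {..k}. g j m) \<in> carrier (OPol m)"
      by (rule R.finsum_closed) (use olam_homog_carrier[OF g] in auto)
    have "to_model (\<Oplus>\<^bsub>OPol m\<^esub> j \<in> {..k}. g j m) = (\<Sum>j\<le>k. to_model (g j m))"
      by (rule to_model_finsum) (rule olam_homog_carrier[OF g])
    also have "\<dots> = (\<Sum>j\<le>k. if j = k then to_model (f m) else 0)"
      by (rule sum.cong[OF refl]) (simp add: g_def to_model_zero)
    finally show "to_model (f m) = to_model (\<Oplus>\<^bsub>OPol m\<^esub> j \<in> {..k}. g j m)" by simp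
  qed
  with g show ?thesis unfolding OLam_carrier by blast
qed

lemma OLam_add:
  assumes f: "f \<in> carrier OLam" and f': "f' \<in> carrier OLam"
  shows "(\<lambda>m. f m \<oplus>\<^bsub>OPol m\<^esub> f' m) \<in> carrier OLam"
proof -
  obtain d g where g: "\<And>k. k \<le> d \<Longrightarrow> g k \<in> olam_homog k" "\<And>m. f m = (\<Oplus>\<^bsub>OPol m\<^esub> k \<in> {..d}. g k m)"
    using f unfolding OLam_carrier by blast
  obtain d' g' where g': "\<And>k. k \<le> d' \<Longrightarrow> g' k \<in> olam_homog k" "\<And>m. f' m = (\<Oplus>\<^bsub>OPol m\<^esub> k \<in> {..d'}. g' k m)"
    using f' unfolding OLam_carrier by blast
  define z where "z = (\<lambda>m. \<zero>\<^bsub>OPol m\<^esub>)"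
  define a where "a k = (if k \<le> d then g k else z)" for k
  define a' where "a' k = (if k \<le> d' then g' k else z)" for k
  have a: "a k \<in> olam_homog k" "a' k \<in> olam_homog k" for k
    using g(1) g'(1) olam_homog_closed(3) by (simp_all add: a_def a'_def z_def)
  define G where "G k = (\<lambda>m. a k m \<oplus>\<^bsub>OPol m\<^esub> a' k m)" for k
  have G: "G k \<in> olam_homog k" for k unfolding G_def by (rule olam_homog_closed(1)[OF a])
  have "f m \<oplus>\<^bsub>OPol m\<^esub> f' m = (\<Oplus>\<^bsub>OPol m\<^esub> k \<in> {..max d d'}. G k m)" for m
  proof (rule to_model_inj[of _ m])
    interpret R: ring "OPol m" by (rule OPol_ring)
    show "f m \<oplus>\<^bsub>OPol m\<^esub> f' m \<in> carrier (OPol m)"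
      using OLam_component[OF f, of m] OLam_component[OF f', of m] by simp
    show "(\<Oplus>\<^bsub>OPol m\<^esub> k \<in> {..max d d'}. G k m) \<in> carrier (OPol m)"
      by (rule R.finsum_closed) (use olam_homog_carrier[OF G] in auto)
    have pad: "(\<Sum>k\<le>e. to_model (b k m)) = (\<Sum>k\<le>max d d'. to_model ((if k \<le> e then b k else z) m))"
      if "e \<le> max d d'" for e and b :: "nat \<Rightarrow> nat \<Rightarrow> opol"
      using that by (intro sum.mono_neutral_cong_left) (auto simp: z_def to_model_zero)
    have "to_model (f m) = (\<Sum>k\<le>d. to_model (g k m))"
      unfolding g(2) by (rule to_model_finsum) (use olam_homog_carrier[OF g(1)] in auto)
    also have "\<dots> = (\<Sum>k\<le>max d d'. to_model (a k m))" unfolding a_def by (rule pad) simp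
    finally have 1: "to_model (f m) = (\<Sum>k\<le>max d d'. to_model (a k m))" .
    have "to_model (f' m) = (\<Sum>k\<le>d'. to_model (g' k m))"
      unfolding g'(2) by (rule to_model_finsum) (use olam_homog_carrier[OF g'(1)] in auto)
    also have "\<dots> = (\<Sum>k\<le>max d d'. to_model (a' k m))" unfolding a'_def by (rule pad) simp
    finally have 2: "to_model (f' m) = (\<Sum>k\<le>max d d'. to_model (a' k m))" .
    have "to_model (\<Oplus>\<^bsub>OPol m\<^esub> k \<in> {..max d d'}. G k m) = (\<Sum>k\<le>max d d'. to_model (G k m))"
      by (rule to_model_finsum) (rule olam_homog_carrier[OF G])
    also have "\<dots> = (\<Sum>k\<le>max d d'. to_model (a k m) + to_model (a' k m))"
      by (rule sum.cong[OF refl]) (unfold G_def, rule to_model_simps(1)[OF olam_homog_carrier[OF a(1)] olam_homog_carrier[OF a(2)]])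
    finally show "to_model (f m \<oplus>\<^bsub>OPol m\<^esub> f' m) = to_model (\<Oplus>\<^bsub>OPol m\<^esub> k \<in> {..max d d'}. G k m)"
      unfolding to_model_simps(1)[OF OLam_component[OF f] OLam_component[OF f']] 1 2 by (simp add: sum.distrib)
  qed
  with G show ?thesis unfolding OLam_carrier by blast
qed

lemma OLam_minus:
  assumes f: "f \<in> carrier OLam" shows "(\<lambda>m. \<ominus>\<^bsub>OPol m\<^esub> f m) \<in> carrier OLam"
proof -
  obtain d g where g: "\<And>k. k \<le> d \<Longrightarrow> g k \<in> olam_homog k" "\<And>m. f m = (\<Oplus>\<^bsub>OPol m\<^esub> k \<in> {..d}. g k m)"
    using f unfolding OLam_carrier by blast
  define G where "G k = (\<lambda>m. \<ominus>\<^bsub>OPol m\<^esub> g k m)" for k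
  have G: "G k \<in> olam_homog k" if "k \<le> d" for k unfolding G_def by (rule olam_homog_closed(2)[OF g(1)[OF that]])
  have "\<ominus>\<^bsub>OPol m\<^esub> f m = (\<Oplus>\<^bsub>OPol m\<^esub> k \<in> {..d}. G k m)" for m
  proof (rule to_model_inj[of _ m])
    interpret R: ring "OPol m" by (rule OPol_ring)
    show "\<ominus>\<^bsub>OPol m\<^esub> f m \<in> carrier (OPol m)" using OLam_component[OF f, of m] by simp
    show "(\<Oplus>\<^bsub>OPol m\<^esub> k \<in> {..d}. G k m) \<in> carrier (OPol m)"
      by (rule R.finsum_closed) (use olam_homog_carrier[OF G] in auto)
    have "to_model (f m) = (\<Sum>k\<le>d. to_model (g k m))"
      unfolding g(2) by (rule to_model_finsum) (use olam_homog_carrier[OF g(1)] in auto)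
    moreover have "to_model (\<Oplus>\<^bsub>OPol m\<^esub> k \<in> {..d}. G k m) = (\<Sum>k\<le>d. to_model (G k m))"
      by (rule to_model_finsum) (use olam_homog_carrier[OF G] in auto)
    moreover have "(\<Sum>k\<le>d. to_model (G k m)) = (\<Sum>k\<le>d. - to_model (g k m))"
      unfolding G_def by (rule sum.cong[OF refl], rule to_model_minus, rule olam_homog_carrier[OF g(1)]) simp
    ultimately show "to_model (\<ominus>\<^bsub>OPol m\<^esub> f m) = to_model (\<Oplus>\<^bsub>OPol m\<^esub> k \<in> {..d}. G k m)"
      unfolding to_model_minus[OF OLam_component[OF f]] by (simp add: sum_negf)
  qed
  with G show ?thesis unfolding OLam_carrier by blast
qed

lemma OLam_group: "abelian_group OLam"
proof (rule abelian_groupI)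
  fix x y assume "x \<in> carrier OLam" "y \<in> carrier OLam"
  then show "x \<oplus>\<^bsub>OLam\<^esub> y \<in> carrier OLam" unfolding OLam_simps by (rule OLam_add)
next
  show "\<zero>\<^bsub>OLam\<^esub> \<in> carrier OLam" unfolding OLam_simps by (rule OLam_homog[OF olam_homog_closed(3)])
next
  fix x y z assume c: "x \<in> carrier OLam" "y \<in> carrier OLam" "z \<in> carrier OLam"
  have "x m \<oplus>\<^bsub>OPol m\<^esub> y m \<oplus>\<^bsub>OPol m\<^esub> z m = x m \<oplus>\<^bsub>OPol m\<^esub> (y m \<oplus>\<^bsub>OPol m\<^esub> z m)" for m
    by (rule abelian_groupE(3)[OF OPol_group]) (rule OLam_component, rule c)+
  then show "x \<oplus>\<^bsub>OLam\<^esub> y \<oplus>\<^bsub>OLam\<^esub> z = x \<oplus>\<^bsub>OLam\<^esub> (y \<oplus>\<^bsub>OLam\<^esub> z)" unfolding OLam_simps by (rule ext)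
next
  fix x y assume c: "x \<in> carrier OLam" "y \<in> carrier OLam"
  have "x m \<oplus>\<^bsub>OPol m\<^esub> y m = y m \<oplus>\<^bsub>OPol m\<^esub> x m" for m
    by (rule abelian_groupE(4)[OF OPol_group]) (rule OLam_component, rule c)+
  then show "x \<oplus>\<^bsub>OLam\<^esub> y = y \<oplus>\<^bsub>OLam\<^esub> x" unfolding OLam_simps by (rule ext)
next
  fix x assume c: "x \<in> carrier OLam"
  have "\<zero>\<^bsub>OPol m\<^esub> \<oplus>\<^bsub>OPol m\<^esub> x m = x m" for m
    by (rule abelian_groupE(5)[OF OPol_group]) (rule OLam_component, rule c)
  then show "\<zero>\<^bsub>OLam\<^esub> \<oplus>\<^bsub>OLam\<^esub> x = x" unfolding OLam_simps by (intro ext)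
  have "\<ominus>\<^bsub>OPol m\<^esub> x m \<oplus>\<^bsub>OPol m\<^esub> x m = \<zero>\<^bsub>OPol m\<^esub>" for m
    by (rule abelian_group.l_neg[OF OPol_group]) (rule OLam_component, rule c)
  then have "(\<lambda>m. \<ominus>\<^bsub>OPol m\<^esub> x m) \<oplus>\<^bsub>OLam\<^esub> x = \<zero>\<^bsub>OLam\<^esub>" unfolding OLam_simps by (rule ext)
  then show "\<exists>y\<in>carrier OLam. y \<oplus>\<^bsub>OLam\<^esub> x = \<zero>\<^bsub>OLam\<^esub>" using OLam_minus[OF c] by blast
qed

lemma length_row_word: "T \<in> ssyt m lam \<Longrightarrow> int (length (row_word lam T)) = psum (shape_of lam) (length lam)"
  unfolding row_word_reading_word by (rule length_reading_word) (rule shape_of_nonneg)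

lemma schur_carrier:
  assumes p: "is_partition lam" shows "odd_schur lam \<in> carrier OLam"
proof (rule OLam_homog)
  define k where "k = nat (psum (shape_of lam) (length lam))"
  have "schur_rep m lam \<in> hom_words m k" for m
    unfolding schur_rep_def
  proof (intro hom_words_signed hom_words_sum)
    fix T assume T: "T \<in> ssyt m lam"
    have "length (row_word lam T) = k" using length_row_word[OF T] by (simp add: k_def)
    then show "frag_of (row_word lam T) \<in> hom_words m k"
      using free_closed(4)[OF row_word_set[OF T]] by (simp add: hom_words_def)
  qed
  then show "odd_schur lam \<in> olam_homog k"
    unfolding olam_homog_def
    by (intro CollectI allI conjI IntI schur_OLam_fin[OF p])
      (simp_all add: odd_schur_class[OF p] opol_homog_alt opol_restr_class[OF schur_rep_carrier] schur_rep_restr[OF p])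
qed

definition expands :: "nat list \<Rightarrow> nat list \<Rightarrow> (nat list \<Rightarrow> int) \<Rightarrow> bool" where
  "expands mu nu c \<longleftrightarrow> finite {al. c al \<noteq> 0} \<and> (\<forall>al. c al \<noteq> 0 \<longrightarrow> is_partition al) \<and>
     odd_schur mu \<otimes>\<^bsub>OLam\<^esub> odd_schur nu =
       (\<Oplus>\<^bsub>OLam\<^esub> al \<in> {al. c al \<noteq> 0}. add_pow OLam (c al) (odd_schur al))"

lemma odd_LR_alt: "odd_LR mu nu = (THE c. expands mu nu c)"
  unfolding odd_LR_def expands_def ..

lemma to_model_comp_add: "x \<in> carrier OLam \<Longrightarrow> y \<in> carrier OLam \<Longrightarrow> to_model ((x \<oplus>\<^bsub>OLam\<^esub> y) m) = to_model (x m) + to_model (y m)"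
  unfolding OLam_simps by (rule to_model_simps(1)) (rule OLam_component, assumption)+

lemma to_model_comp_zero: "to_model (\<zero>\<^bsub>OLam\<^esub> m) = 0"
  unfolding OLam_simps by (rule to_model_zero)

lemma expansion_component:
  assumes "\<And>al. c al \<noteq> 0 \<Longrightarrow> is_partition al"
  shows "(\<Oplus>\<^bsub>OLam\<^esub> al \<in> {al. c al \<noteq> 0}. add_pow OLam (c al) (odd_schur al)) m \<in> carrier (OPol m)"
    and "to_model ((\<Oplus>\<^bsub>OLam\<^esub> al \<in> {al. c al \<noteq> 0}. add_pow OLam (c al) (odd_schur al)) m)
      = (\<Sum>al\<in>{al. c al \<noteq> 0}. of_int (c al) * to_model (odd_schur al m))"
proof -
  interpret L: abelian_group OLam by (rule OLam_group)
  have p: "add_pow OLam (c al) (odd_schur al) \<in> carrier OLam"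
      "to_model (add_pow OLam (c al) (odd_schur al) m) = of_int (c al) * to_model (odd_schur al m)"
    if "al \<in> {al. c al \<noteq> 0}" for al
  proof -
    have s: "odd_schur al \<in> carrier OLam" by (rule schur_carrier[OF assms]) (use that in simp)
    show "add_pow OLam (c al) (odd_schur al) \<in> carrier OLam"
      by (rule additive_add_pow(2)[OF OLam_group, where phi = "\<lambda>x. to_model (x m)", OF _ _ s])
        (rule to_model_comp_add to_model_comp_zero; assumption)+
    show "to_model (add_pow OLam (c al) (odd_schur al) m) = of_int (c al) * to_model (odd_schur al m)"
      by (rule additive_add_pow(1)[OF OLam_group, where phi = "\<lambda>x. to_model (x m)", OF _ _ s])
        (rule to_model_comp_add to_model_comp_zero; assumption)+
  qed
  show "(\<Oplus>\<^bsub>OLam\<^esub> al \<in> {al. c al \<noteq> 0}. add_pow OLam (c al) (odd_schur al)) m \<in> carrier (OPol m)"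
    by (rule OLam_component, rule L.finsum_closed) (use p(1) in auto)
  have "to_model ((\<Oplus>\<^bsub>OLam\<^esub> al \<in> {al. c al \<noteq> 0}. add_pow OLam (c al) (odd_schur al)) m)
      = (\<Sum>al\<in>{al. c al \<noteq> 0}. to_model (add_pow OLam (c al) (odd_schur al) m))"
    by (rule additive_finsum[OF OLam_group, where phi = "\<lambda>x. to_model (x m)"])
      (rule to_model_comp_add to_model_comp_zero p(1); assumption)+
  then show "to_model ((\<Oplus>\<^bsub>OLam\<^esub> al \<in> {al. c al \<noteq> 0}. add_pow OLam (c al) (odd_schur al)) m)
      = (\<Sum>al\<in>{al. c al \<noteq> 0}. of_int (c al) * to_model (odd_schur al m))"
    using p(2) by simp
qed

text \<open>Two odd symmetric functions are equal iff all their components have the same image in the model.\<close>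

lemma expands_iff:
  assumes mu: "is_partition mu" and nu: "is_partition nu"
  shows "expands mu nu c \<longleftrightarrow> finite {al. c al \<noteq> 0} \<and> (\<forall>al. c al \<noteq> 0 \<longrightarrow> is_partition al) \<and>
    (\<forall>m. to_model (odd_schur mu m) * to_model (odd_schur nu m)
       = (\<Sum>al\<in>{al. c al \<noteq> 0}. of_int (c al) * to_model (odd_schur al m)))"
proof (cases "\<forall>al. c al \<noteq> 0 \<longrightarrow> is_partition al")
  case True
  then have c: "\<And>al. c al \<noteq> 0 \<Longrightarrow> is_partition al" by blast
  let ?S = "\<Oplus>\<^bsub>OLam\<^esub> al \<in> {al. c al \<noteq> 0}. add_pow OLam (c al) (odd_schur al)"
  have "odd_schur mu m \<otimes>\<^bsub>OPol m\<^esub> odd_schur nu m = ?S m \<longleftrightarrow>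
      to_model (odd_schur mu m) * to_model (odd_schur nu m) = (\<Sum>al\<in>{al. c al \<noteq> 0}. of_int (c al) * to_model (odd_schur al m))" for m
  proof -
    interpret R: ring "OPol m" by (rule OPol_ring)
    have k: "odd_schur mu m \<in> carrier (OPol m)" "odd_schur nu m \<in> carrier (OPol m)"
      using odd_schur_carrier mu nu by blast+
    have "odd_schur mu m \<otimes>\<^bsub>OPol m\<^esub> odd_schur nu m = ?S m \<longleftrightarrow>
        to_model (odd_schur mu m \<otimes>\<^bsub>OPol m\<^esub> odd_schur nu m) = to_model (?S m)"
    proof
      assume "to_model (odd_schur mu m \<otimes>\<^bsub>OPol m\<^esub> odd_schur nu m) = to_model (?S m)"
      with R.m_closed[OF k] expansion_component(1)[OF c]
      show "odd_schur mu m \<otimes>\<^bsub>OPol m\<^esub> odd_schur nu m = ?S m" by (rule to_model_inj)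
    qed simp
    moreover have "to_model (?S m) = (\<Sum>al\<in>{al. c al \<noteq> 0}. of_int (c al) * to_model (odd_schur al m))"
      by (rule expansion_component(2)) (rule c)
    ultimately show ?thesis unfolding to_model_simps(2)[OF k] by simp
  qed
  then have "odd_schur mu \<otimes>\<^bsub>OLam\<^esub> odd_schur nu = ?S \<longleftrightarrow>
      (\<forall>m. to_model (odd_schur mu m) * to_model (odd_schur nu m) = (\<Sum>al\<in>{al. c al \<noteq> 0}. of_int (c al) * to_model (odd_schur al m)))"
    unfolding OLam_simps fun_eq_iff by blast
  then show ?thesis unfolding expands_def by blast
next
  case False
  then show ?thesis unfolding expands_def by blast
qed

theorem odd_LR_eq:
  assumes mu: "is_partition mu" and nu: "is_partition nu" "length nu \<le> n"
  shows "odd_LR mu nu = lr_coeff n mu nu"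
  unfolding odd_LR_alt
proof (rule the_equality)
  have "is_partition al" if "lr_coeff n mu nu al \<noteq> 0" for al
    using that by (simp add: lr_coeff_def split: if_splits)
  then show e0: "expands mu nu (lr_coeff n mu nu)"
    unfolding expands_iff[OF mu nu(1)]
    using lr_coeff_support(1)[OF mu] schur_product[OF mu nu] by blast
  fix c assume e: "expands mu nu c"
  note E = e[unfolded expands_iff[OF mu nu(1)]] and E0 = e0[unfolded expands_iff[OF mu nu(1)]]
  define b where "b = lr_coeff n mu nu"
  define S where "S = {al. c al \<noteq> 0} \<union> {al. b al \<noteq> 0}"
  have S: "finite S" "\<And>al. al \<in> S \<Longrightarrow> is_partition al" using E E0 unfolding S_def b_def by blast+
  have enlarge: "(\<Sum>al\<in>{al. a al \<noteq> 0}. of_int (a al) * to_model (odd_schur al m)) = (\<Sum>al\<in>S. of_int (a al) * to_model (odd_schur al m))"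
    if "{al. a al \<noteq> 0} \<subseteq> S" for a :: "nat list \<Rightarrow> int" and m
    by (rule sum.mono_neutral_left[OF S(1) that]) auto
  have "(\<Sum>al\<in>S. of_int (c al - b al) * to_model (odd_schur al m)) = 0" for m
  proof -
    have "(\<Sum>al\<in>S. of_int (c al) * to_model (odd_schur al m)) = (\<Sum>al\<in>S. of_int (b al) * to_model (odd_schur al m))"
      using E E0 enlarge[of c m] enlarge[of b m] unfolding b_def[symmetric] S_def by simp
    then show ?thesis by (simp add: left_diff_distrib sum_subtractf)
  qed
  then have "c al - b al = 0" if "al \<in> S" for al
    using schur_independent[OF S, where d = "\<lambda>al. c al - b al"] that by blast
  then have "c al = b al" for al by (cases "al \<in> S") (auto simp: S_def)
  then show "c = lr_coeff n mu nu" unfolding b_def by (rule ext)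
qed

theorem mainTheorem3:
  fixes n :: nat and mu nu lam :: "nat list"
  assumes "n \<ge> 1"
    and "is_partition mu" "length mu \<le> n"
    and "is_partition nu" "length nu \<le> n"
    and "is_partition lam" "length lam \<le> n"
  shows "odd_LR mu nu lam =
    (-1) ^ (N mu + N lam) * (\<Sum>H\<in>integer_hives n lam mu nu. neg_one_pow (Q_hive n H))"
proof -
  have "odd_LR mu nu lam = signed (int (N mu + N lam)) (\<Sum>H\<in>integer_hives n lam mu nu. neg_one_pow (Q_hive n H))"
    unfolding odd_LR_eq[OF assms(2,4,5)] lr_coeff_def hive_chain_sum[OF assms(6,7,2,3,4,5)] b_sum_def
    using assms(6) by simp
  then show ?thesis by (simp add: signed_def minus_one_power_iff)
qed

end
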